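(* Below $g$ takes arguments of types $1$, $0\to1$, $0$ to type $0$, and $H$ takes arguments of types $1$, $0\to1$, $0$, $0$ to type $0$. Let - ($UF$): there is $\Theta^{((0\to2)\times(0\to1))\to(0\to1)}$ such that for all $\Phi^{0\to2},y^{0\to1}$: $(\forall k^0)(\forall z^1\le_1y(k))\big[\Phi(k)(z)\le_0\Phi(k)(\Theta(\Phi,y)(k))\wedge\Theta(\Phi,y)\le_{0\to1}y\big]$; - ($\mathfrak S$): $(\forall^{\mathrm{st}}y^{0\to1},H)\big[(\forall^{\mathrm{st}}k^0)(\forall^{\mathrm{st}}x^1\le_1y(k))(\exists^{\mathrm{st}}z^0)[H(x,y,z,k)=0]\to(\exists^{\mathrm{st}}\xi^1)(\forall^{\mathrm{st}}k^0)(\forall x^1\le_1y(k))(\exists z^0\le\xi(k))[H(x,y,z,k)=0]\big]$; - (USB): there is a functional $\Psi$, with $\Psi(y,g)$ of type $1$, such that for all $y^{0\to1},H,g$: \[(\forall k^0)(\forall x^1\le_1y(k))[H(x,y,g(x,y,k),k)=0]\to(\forall k^0)(\forall x^1\le_1y(k))(\exists z^0\le\Psi(y,g)(k))[H(x,y,z,k)=0],\] and moreover the numbers $\Psi(y,g)(k)$ are the least ones with this property (for all $H$). Then $\mathrm{RCA}_0^\Omega+\mathrm{QF\text{-}AC}^{2,0}$ proves $UF\leftrightarrow\mathfrak S\leftrightarrow\mathrm{USB}$.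
   Context: Types: $0$ is the type of natural numbers, $\sigma\to\tau$ that of functionals from type $\sigma$ to type $\tau$; $1:=0\to0$, $2:=1\to0$, $3:=2\to0$. Superscripts indicate types; finitely many arguments or values are combined by standard currying/coding (so a functional taking arguments of type $2$ and $1$ to type $0$ is also given type $3$). For $f,g$ of type $1$, $f\le_1g$ means $(\forall n^0)(f(n)\le g(n))$; for $u,v$ of type $0\to1$, $u\le_{0\to1}v$ means $(\forall k^0)(u(k)\le_1v(k))$; `$f\le_11$' says that $f$ is a $0/1$-sequence (an element of Cantor space); $\overline fn$ is (the code of) $\langle f(0),\dots,f(n-1)\rangle$; $\sigma*00\dots$ extends the finite sequence $\sigma$ by zeros. $\mathrm{RCA}_0^\omega$ (Kohlenbach) is $\mathrm{E\text{-}PRA}^\omega+\mathrm{QF\text{-}AC}^{1,0}$. Here $\mathrm{E\text{-}PRA}^\omega$ is classical arithmetic in all finite types with primitive equality $=_0$ only at type $0$ (at higher type, $x=_\tau y$ is defined as $xz_1\dots z_k=_0yz_1\dots z_k$ for all $z_i$), constants for zero, successor, the combinators and primitive recursion with values of type $0$, quantifier-free induction, and the extensionality axiom $x=_\rho y\to\varphi(x)=_\tau\varphi(y)$ for all $\varphi^{\rho\to\tau}$. $\mathrm{QF\text{-}AC}^{\sigma,0}$ is the schema $(\forall x^\sigma)(\exists n^0)A_0(x,n)\to(\exists F^{\sigma\to0})(\forall x^\sigma)A_0(x,F(x))$ for quantifier-free $A_0$. $\mathrm{RCA}_0^\Omega$ is $\mathrm{E\text{-}PRA}^{\omega*}_{\mathrm{st}}+\mathrm{QF\text{-}AC}^{1,0}+\mathrm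 I+\mathrm{HAC}_{\mathrm{int}}+\mathrm{PF\text{-}TP}_\forall$ plus the constant axioms below. The language adds a type $\sigma^*$ of finite sequences of objects of type $\sigma$ and, for each type, a predicate $\mathrm{st}(x)$ (`$x$ is standard'). $(\forall^{\mathrm{st}}x)\Phi$ is $(\forall x)(\mathrm{st}(x)\to\Phi)$ and $(\exists^{\mathrm{st}}x)\Phi$ is $(\exists x)(\mathrm{st}(x)\wedge\Phi)$. A formula is internal if `st' does not occur in it; $A^{\mathrm{st}}$ is obtained from $A$ by appending `st' to all quantifiers except bounded number quantifiers. Basic axioms of $\mathrm{E\text{-}PRA}^{\omega*}_{\mathrm{st}}$: $\mathrm{st}(x)\wedge x=y\to\mathrm{st}(y)$; $\mathrm{st}(t)$ for closed terms $t$; $\mathrm{st}(f)\wedge\mathrm{st}(x)\to\mathrm{st}(f(x))$; numbers below a standard number are standard. I (for internal $\varphi$): $(\forall^{\mathrm{st}}x^{\sigma^*})(\exists y^\tau)(\forall z^\sigma\in x)\varphi(z,y)\to(\exists y^\tau)(\forall^{\mathrm{st}}x^\sigma)\varphi(x,y)$. $\mathrm{HAC}_{\mathrm{int}}$ (for internal $\varphi$): $(\forall^{\mathrm{st}}x^\rho)(\exists^{\mathrm{st}}y^\tau)\varphi(x,y)\to(\exists^{\mathrm{st}}F^{\rho\to\tau^*})(\forall^{\mathrm{st}}x^\rho)(\exists y^\tau\in F(x))\varphi(x,y)$. $\mathrm{PF\text{-}TP}_\forall$: $(\forall^{\mathrm{st}}x^\tau)\varphi(x)\to(\forall x^\tau)\varphi(x)$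 for internal $\varphi(x)$ with no parameters other than $x$. Constant axioms: (i) there is a constant $\Omega_0$ with $\mathrm{st}(\Omega_0)\wedge(\forall^{\mathrm{st}}\Xi^3)[M^{\mathrm{st}}(\Xi)\to(\forall^{\mathrm{st}}\varphi^2)(\Omega_0(\varphi)=\Xi(\varphi))]$, where $M(\Xi)$ says that for all $\varphi^2$, $\Xi(\varphi)$ is the least $n$ with $(\forall f,g\le_11)(\overline fn=\overline gn\to\varphi(f)=\varphi(g))$; and analogous constants and axioms for other functionals uniquely defined by a parameter-free internal formula; (ii) there is a constant $\Lambda_0^3$ with $\mathrm{st}(\Lambda_0)$ and $(\forall^{\mathrm{st}}\Upsilon^3)[K^{\mathrm{st}}(\Upsilon)\to(\forall^{\mathrm{st}}\varphi^2,f^1\le_11)(\Xi(\varphi,\Upsilon(\varphi,\cdot))(\overline f\Lambda_0(\varphi,f))=\varphi(f)+1)]$, where $K(\Upsilon)$ is $(\forall\varphi^2,f^1,g^1\le_11)(\overline f\Upsilon(\varphi,f)=\overline g\Upsilon(\varphi,f)\to\varphi(f)=\varphi(g))$ and $\Xi(\varphi,\omega)$ is the associate of $\varphi$ computed from a modulus $\omega$: $\Xi(\varphi,\omega)(\sigma)=\varphi(\sigma*00\dots)+1$ if $\omega(\sigma*00\dots)\le|\sigma|$, and $0$ otherwise. *)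

theory Defs
  imports Main
begin

section \<open>Finite types, terms and formulas\<close>

text \<open>
  Many-sorted classical first-order syntax for arithmetic in all finite types with types
  of finite sequences. Several arguments are handled by currying.
  A (bound) variable is a name together with its type; variables of distinct type are
  distinct even if they share the name. Parameters \<open>Par a \<tau>\<close> are the free variables
  of derivations (eigenvariables); they are never bound. Hence only terms without bound
  variables are ever substituted under a quantifier and no capture can arise.
\<close>

datatype ty =
    N
  | Fun ty ty  (infixr "\<rightarrowtail>" 65)
  | Seq ty

type_synonym var = "string \<times> ty"

text \<open>
  \<open>Mk \<sigma> f n\<close> is the sequence \<open>\<langle>f 0, \<dots>, f (n - 1)\<rangle>\<close> of type \<open>Seq \<sigma>\<close>.
  \<open>Omega v M\<close> is the constant for the functional \<open>v\<close> which is uniquely defined by the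
  formula \<open>M\<close>; it is only governed by an axiom if \<open>M\<close> is of the right form
  (see \<open>Omega_axioms\<close>), and an arbitrary standard object otherwise.
\<close>

datatype con =
    Zero | Succ
  | CK ty ty | CS ty ty ty
  | Rec
  | Mk ty | Len ty | At ty
  | Omega var fm
  | Lambda0
and trm =
    Var var
  | Par nat ty
  | Con con
  | App trm trm  (infixl "\<cdot>" 200)
and fm =
    Eq trm trm  (infix "\<^bold>=" 60)
  | St trm
  | Bot  ("\<^bold>\<bottom>")
  | Imp fm fm  (infixr "\<^bold>\<longrightarrow>" 35)
  | All var fm

fun pure :: "nat \<Rightarrow> ty" where
  "pure 0 = N"
| "pure (Suc n) = pure n \<rightarrowtail> N"

abbreviation "t1 \<equiv> N \<rightarrowtail> N"
abbreviation "t2 \<equiv> t1 \<rightarrowtail> N"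

fun contype :: "con \<Rightarrow> ty" where
  "contype Zero = N"
| "contype Succ = N \<rightarrowtail> N"
| "contype (CK \<sigma> \<tau>) = \<sigma> \<rightarrowtail> \<tau> \<rightarrowtail> \<sigma>"
| "contype (CS \<rho> \<sigma> \<tau>) = (\<rho> \<rightarrowtail> \<sigma> \<rightarrowtail> \<tau>) \<rightarrowtail> (\<rho> \<rightarrowtail> \<sigma>) \<rightarrowtail> \<rho> \<rightarrowtail> \<tau>"
| "contype Rec = N \<rightarrowtail> N \<rightarrowtail> (N \<rightarrowtail> N \<rightarrowtail> N) \<rightarrowtail> N"
| "contype (Mk \<sigma>) = (N \<rightarrowtail> \<sigma>) \<rightarrowtail> N \<rightarrowtail> Seq \<sigma>"
| "contype (Len \<sigma>) = Seq \<sigma> \<rightarrowtail> N"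
| "contype (At \<sigma>) = Seq \<sigma> \<rightarrowtail> N \<rightarrowtail> \<sigma>"
| "contype (Omega v M) = snd v"
| "contype Lambda0 = t2 \<rightarrowtail> t1 \<rightarrowtail> N"

fun tyof :: "trm \<Rightarrow> ty option" where
  "tyof (Var v) = Some (snd v)"
| "tyof (Par a \<tau>) = Some \<tau>"
| "tyof (Con c) = Some (contype c)"
| "tyof (t \<cdot> u) = (case tyof t of
     Some (\<sigma> \<rightarrowtail> \<tau>) \<Rightarrow> if tyof u = Some \<sigma> then Some \<tau> else None
   | _ \<Rightarrow> None)"

fun wff :: "fm \<Rightarrow> bool" where
  "wff (t \<^bold>= u) \<longleftrightarrow> tyof t = Some N \<and> tyof u = Some N"
| "wff (St t) \<longleftrightarrow> tyof t \<noteq> None"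
| "wff \<^bold>\<bottom> \<longleftrightarrow> True"
| "wff (A \<^bold>\<longrightarrow> B) \<longleftrightarrow> wff A \<and> wff B"
| "wff (All v A) \<longleftrightarrow> wff A"

fun varlist :: "trm \<Rightarrow> var list" where
  "varlist (Var v) = [v]"
| "varlist (Par a \<tau>) = []"
| "varlist (Con c) = []"
| "varlist (t \<cdot> u) = varlist t @ varlist u"

abbreviation fvt :: "trm \<Rightarrow> var set" where
  "fvt t \<equiv> set (varlist t)"

fun fv :: "fm \<Rightarrow> var set" where
  "fv (t \<^bold>= u) = fvt t \<union> fvt u"
| "fv (St t) = fvt t"
| "fv \<^bold>\<bottom> = {}"
| "fv (A \<^bold>\<longrightarrow> B) = fv A \<union> fv B"
| "fv (All v A) = fv A - {v}"

fun parst :: "trm \<Rightarrow> (nat \<times> ty) set" where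
  "parst (Var v) = {}"
| "parst (Par a \<tau>) = {(a, \<tau>)}"
| "parst (Con c) = {}"
| "parst (t \<cdot> u) = parst t \<union> parst u"

fun pars :: "fm \<Rightarrow> (nat \<times> ty) set" where
  "pars (t \<^bold>= u) = parst t \<union> parst u"
| "pars (St t) = parst t"
| "pars \<^bold>\<bottom> = {}"
| "pars (A \<^bold>\<longrightarrow> B) = pars A \<union> pars B"
| "pars (All v A) = pars A"

fun substt :: "var \<Rightarrow> trm \<Rightarrow> trm \<Rightarrow> trm" where
  "substt v s (Var w) = (if w = v then s else Var w)"
| "substt v s (Par a \<tau>) = Par a \<tau>"
| "substt v s (Con c) = Con c"
| "substt v s (t \<cdot> u) = substt v s t \<cdot> substt v s u"

text \<open>Only used if \<open>s\<close> has no bound variables, or if the formula is quantifier-free.\<close>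

fun subst :: "var \<Rightarrow> trm \<Rightarrow> fm \<Rightarrow> fm" where
  "subst v s (t \<^bold>= u) = (substt v s t \<^bold>= substt v s u)"
| "subst v s (St t) = St (substt v s t)"
| "subst v s \<^bold>\<bottom> = \<^bold>\<bottom>"
| "subst v s (A \<^bold>\<longrightarrow> B) = (subst v s A \<^bold>\<longrightarrow> subst v s B)"
| "subst v s (All w A) = All w (if w = v then A else subst v s A)"

definition Neg :: "fm \<Rightarrow> fm"  ("\<^bold>\<not> _" [40] 40) where
  "(\<^bold>\<not> A) = (A \<^bold>\<longrightarrow> \<^bold>\<bottom>)"

definition Conj :: "fm \<Rightarrow> fm \<Rightarrow> fm"  (infixr "\<^bold>\<and>" 38) where
  "(A \<^bold>\<and> B) = (\<^bold>\<not> (A \<^bold>\<longrightarrow> \<^bold>\<not> B))"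

definition Iff :: "fm \<Rightarrow> fm \<Rightarrow> fm"  (infix "\<^bold>\<longleftrightarrow>" 34) where
  "(A \<^bold>\<longleftrightarrow> B) = ((A \<^bold>\<longrightarrow> B) \<^bold>\<and> (B \<^bold>\<longrightarrow> A))"

definition Ex :: "var \<Rightarrow> fm \<Rightarrow> fm" where
  "Ex v A = (\<^bold>\<not> All v (\<^bold>\<not> A))"

definition Allst :: "var \<Rightarrow> fm \<Rightarrow> fm" where
  "Allst v A = All v (St (Var v) \<^bold>\<longrightarrow> A)"

definition Exst :: "var \<Rightarrow> fm \<Rightarrow> fm" where
  "Exst v A = Ex v (St (Var v) \<^bold>\<and> A)"

abbreviation "Alls vs A \<equiv> foldr All vs A"
abbreviation "Allsts vs A \<equiv> foldr Allst vs A"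

fun internal :: "fm \<Rightarrow> bool" where
  "internal (t \<^bold>= u) \<longleftrightarrow> True"
| "internal (St t) \<longleftrightarrow> False"
| "internal \<^bold>\<bottom> \<longleftrightarrow> True"
| "internal (A \<^bold>\<longrightarrow> B) \<longleftrightarrow> internal A \<and> internal B"
| "internal (All v A) \<longleftrightarrow> internal A"

text \<open>Internal formulas without any quantifiers.\<close>

fun qfree :: "fm \<Rightarrow> bool" where
  "qfree (t \<^bold>= u) \<longleftrightarrow> True"
| "qfree (St t) \<longleftrightarrow> False"
| "qfree \<^bold>\<bottom> \<longleftrightarrow> True"
| "qfree (A \<^bold>\<longrightarrow> B) \<longleftrightarrow> qfree A \<and> qfree B"
| "qfree (All v A) \<longleftrightarrow> False"


section \<open>Classical natural deduction\<close>

definition sentence :: "fm \<Rightarrow> bool" where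
  "sentence A \<longleftrightarrow> wff A \<and> fv A = {}"

inductive proves :: "fm set \<Rightarrow> fm \<Rightarrow> bool"  (infix "\<turnstile>" 30) where
  Ax: "A \<in> \<Gamma> \<Longrightarrow> \<Gamma> \<turnstile> A"
| ImpI: "insert A \<Gamma> \<turnstile> B \<Longrightarrow> sentence A \<Longrightarrow> \<Gamma> \<turnstile> A \<^bold>\<longrightarrow> B"
| ImpE: "\<Gamma> \<turnstile> A \<^bold>\<longrightarrow> B \<Longrightarrow> \<Gamma> \<turnstile> A \<Longrightarrow> \<Gamma> \<turnstile> B"
| Raa: "insert (\<^bold>\<not> A) \<Gamma> \<turnstile> \<^bold>\<bottom> \<Longrightarrow> sentence A \<Longrightarrow> \<Gamma> \<turnstile> A"
| AllI: "\<Gamma> \<turnstile> subst v (Par a (snd v)) A \<Longrightarrow> (a, snd v) \<notin> pars A \<Longrightarrow>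
    \<forall>B\<in>\<Gamma>. (a, snd v) \<notin> pars B \<Longrightarrow> \<Gamma> \<turnstile> All v A"
| AllE: "\<Gamma> \<turnstile> All v A \<Longrightarrow> tyof t = Some (snd v) \<Longrightarrow> fvt t = {} \<Longrightarrow>
    \<Gamma> \<turnstile> subst v t A"


section \<open>Defined terms and formulas\<close>

abbreviation zero :: trm where "zero \<equiv> Con Zero"
abbreviation suc :: "trm \<Rightarrow> trm" where "suc t \<equiv> Con Succ \<cdot> t"
abbreviation len :: "ty \<Rightarrow> trm \<Rightarrow> trm" where "len \<sigma> s \<equiv> Con (Len \<sigma>) \<cdot> s"
abbreviation at :: "ty \<Rightarrow> trm \<Rightarrow> trm \<Rightarrow> trm" where "at \<sigma> s i \<equiv> Con (At \<sigma>) \<cdot> s \<cdot> i"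

definition const :: "ty \<Rightarrow> ty \<Rightarrow> trm \<Rightarrow> trm" where
  "const \<sigma> \<tau> t = Con (CK \<sigma> \<tau>) \<cdot> t"

fun zerot :: "ty \<Rightarrow> trm" where
  "zerot N = zero"
| "zerot (\<sigma> \<rightarrowtail> \<tau>) = const \<tau> \<sigma> (zerot \<tau>)"
| "zerot (Seq \<sigma>) = Con (Mk \<sigma>) \<cdot> const \<sigma> N (zerot \<sigma>) \<cdot> zero"

text \<open>
  Predecessor \<open>\<lambda>v. Rec v 0 (\<lambda>_ n. n)\<close> and cut-off subtraction
  \<open>t - u = Rec u t (\<lambda>v _. pred v)\<close>, written with combinators.
\<close>

definition idN :: trm where
  "idN = Con (CS N (N \<rightarrowtail> N) N) \<cdot> Con (CK N (N \<rightarrowtail> N)) \<cdot> Con (CK N N)"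

definition predf :: trm where
  "predf = (let \<alpha> = N \<rightarrowtail> N \<rightarrowtail> N in
     Con (CS N \<alpha> N) \<cdot> (Con (CS N N (\<alpha> \<rightarrowtail> N)) \<cdot> Con Rec \<cdot> const N N zero)
       \<cdot> const \<alpha> N (const (N \<rightarrowtail> N) N idN))"

definition monus :: "trm \<Rightarrow> trm \<Rightarrow> trm" where
  "monus t u = Con Rec \<cdot> u \<cdot> t
     \<cdot> (Con (CS N N (N \<rightarrowtail> N)) \<cdot> const (N \<rightarrowtail> N \<rightarrowtail> N) N (Con (CK N N)) \<cdot> predf)"

definition leF :: "trm \<Rightarrow> trm \<Rightarrow> fm"  (infix "\<^bold>\<le>" 60) where
  "(t \<^bold>\<le> u) = (monus t u \<^bold>= zero)"

definition ltF :: "trm \<Rightarrow> trm \<Rightarrow> fm"  (infix "\<^bold><" 60) where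
  "(t \<^bold>< u) = (suc t \<^bold>\<le> u)"

text \<open>Bounded number quantifiers; the variable \<open>v\<close> must not occur in \<open>t\<close>.\<close>

definition BAll :: "var \<Rightarrow> trm \<Rightarrow> fm \<Rightarrow> fm" where
  "BAll v t A = All v ((Var v \<^bold>\<le> t) \<^bold>\<longrightarrow> A)"

definition BAlll :: "var \<Rightarrow> trm \<Rightarrow> fm \<Rightarrow> fm" where
  "BAlll v t A = All v ((Var v \<^bold>< t) \<^bold>\<longrightarrow> A)"

definition BEx :: "var \<Rightarrow> trm \<Rightarrow> fm \<Rightarrow> fm" where
  "BEx v t A = (\<^bold>\<not> BAll v t (\<^bold>\<not> A))"

definition BExl :: "var \<Rightarrow> trm \<Rightarrow> fm \<Rightarrow> fm" where
  "BExl v t A = (\<^bold>\<not> BAlll v t (\<^bold>\<not> A))"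

text \<open>A name longer than, hence different from, every variable name in the terms.\<close>

definition fresh :: "trm \<Rightarrow> trm \<Rightarrow> string" where
  "fresh t u = CHR ''x'' # concat (map fst (varlist t @ varlist u))"

text \<open>Equality of higher type is defined from equality of type \<open>N\<close>.\<close>

fun eqF :: "ty \<Rightarrow> trm \<Rightarrow> trm \<Rightarrow> fm" where
  "eqF N t u = (t \<^bold>= u)"
| "eqF (\<sigma> \<rightarrowtail> \<tau>) t u =
     (let v = (fresh t u, \<sigma>) in All v (eqF \<tau> (t \<cdot> Var v) (u \<cdot> Var v)))"
| "eqF (Seq \<sigma>) t u =
     (let i = (fresh t u, N) in
        (len \<sigma> t \<^bold>= len \<sigma> u) \<^bold>\<and>
        BAlll i (len \<sigma> t) (eqF \<sigma> (at \<sigma> t (Var i)) (at \<sigma> u (Var i))))"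

definition memF :: "ty \<Rightarrow> trm \<Rightarrow> trm \<Rightarrow> fm" where
  "memF \<sigma> t s =
     (let i = (fresh t s, N) in BExl i (len \<sigma> s) (eqF \<sigma> t (at \<sigma> s (Var i))))"

text \<open>The pointwise orders \<open>\<le>\<^sub>1\<close> and \<open>\<le>\<^bsub>0\<rightarrow>1\<^esub>\<close>.\<close>

definition le1 :: "trm \<Rightarrow> trm \<Rightarrow> fm" where
  "le1 t u = (let n = (fresh t u, N) in All n (t \<cdot> Var n \<^bold>\<le> u \<cdot> Var n))"

definition le01 :: "trm \<Rightarrow> trm \<Rightarrow> fm" where
  "le01 t u = (let k = (fresh t u, N) in All k (le1 (t \<cdot> Var k) (u \<cdot> Var k)))"

definition one1 :: trm where
  "one1 = const N N (suc zero)"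

text \<open>
  Relativisation to the standard objects. Bounded number quantifiers are left unchanged;
  a bounded existential quantifier appears as \<open>\<not> (\<forall>v \<le> t. \<not> A)\<close>.
\<close>

definition bounded_all :: "var \<Rightarrow> fm \<Rightarrow> bool" where
  "bounded_all v A \<longleftrightarrow> snd v = N \<and>
     (\<exists>t B. v \<notin> fvt t \<and> (A = ((Var v \<^bold>\<le> t) \<^bold>\<longrightarrow> B) \<or> A = ((Var v \<^bold>< t) \<^bold>\<longrightarrow> B)))"

fun relst :: "fm \<Rightarrow> fm" where
  "relst (t \<^bold>= u) = (t \<^bold>= u)"
| "relst (St t) = St t"
| "relst \<^bold>\<bottom> = \<^bold>\<bottom>"
| "relst (A \<^bold>\<longrightarrow> B) = (relst A \<^bold>\<longrightarrow> relst B)"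
| "relst (All v A) = (if bounded_all v A then All v (relst A) else Allst v (relst A))"


section \<open>The axioms\<close>

text \<open>
  Axioms are the closed universal closures of the well-formed, parameter-free instances
  of the schemata; extra free variables of an instance are the schema's parameters.
  In the schemata for choice, idealisation and transfer, the universally quantified
  variable may be a finite tuple, as usual.
\<close>

definition closures :: "fm set \<Rightarrow> fm set" where
  "closures X = {Alls vs A | vs A. A \<in> X \<and> wff A \<and> pars A = {} \<and> fv A \<subseteq> set vs}"

inductive_set EPRA_schemata :: "fm set" where
  eq_refl: "t \<^bold>= t \<in> EPRA_schemata"
| eq_eucl: "((t \<^bold>= u) \<^bold>\<longrightarrow> (t \<^bold>= s) \<^bold>\<longrightarrow> (u \<^bold>= s)) \<in> EPRA_schemata"
| suc_nonzero: "(\<^bold>\<not> (suc t \<^bold>= zero)) \<in> EPRA_schemata"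
| suc_inj: "((suc t \<^bold>= suc u) \<^bold>\<longrightarrow> (t \<^bold>= u)) \<in> EPRA_schemata"
| comb_K: "eqF \<sigma> (Con (CK \<sigma> \<tau>) \<cdot> t \<cdot> u) t \<in> EPRA_schemata"
| comb_S: "eqF \<tau> (Con (CS \<rho> \<sigma> \<tau>) \<cdot> t \<cdot> u \<cdot> s) (t \<cdot> s \<cdot> (u \<cdot> s)) \<in> EPRA_schemata"
| rec_zero: "(Con Rec \<cdot> zero \<cdot> t \<cdot> u \<^bold>= t) \<in> EPRA_schemata"
| rec_suc: "(Con Rec \<cdot> suc n \<cdot> t \<cdot> u \<^bold>= u \<cdot> (Con Rec \<cdot> n \<cdot> t \<cdot> u) \<cdot> n) \<in> EPRA_schemata"
| seq_len: "(len \<sigma> (Con (Mk \<sigma>) \<cdot> t \<cdot> n) \<^bold>= n) \<in> EPRA_schemata"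
| seq_at: "((i \<^bold>< n) \<^bold>\<longrightarrow> eqF \<sigma> (at \<sigma> (Con (Mk \<sigma>) \<cdot> t \<cdot> n) i) (t \<cdot> i)) \<in> EPRA_schemata"
| seq_out: "((len \<sigma> s \<^bold>\<le> i) \<^bold>\<longrightarrow> eqF \<sigma> (at \<sigma> s i) (zerot \<sigma>)) \<in> EPRA_schemata"
| extensionality:
    "(eqF \<rho> t u \<^bold>\<longrightarrow> eqF \<tau> (f \<cdot> t) (f \<cdot> u)) \<in> EPRA_schemata"
| qf_induction: "qfree A \<Longrightarrow> snd n = N \<Longrightarrow>
    (subst n zero A \<^bold>\<and> All n (A \<^bold>\<longrightarrow> subst n (suc (Var n)) A) \<^bold>\<longrightarrow> All n A) \<in> EPRA_schemata"

definition EPRA :: "fm set" where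
  "EPRA = closures EPRA_schemata"

text \<open>
  \<open>QF_AC d\<close> is quantifier-free choice from objects of type \<open>d\<close> to numbers; several
  arguments of types \<open>0, \<dots>, d\<close> count as one of type \<open>d\<close>.
\<close>

definition QF_AC :: "nat \<Rightarrow> fm set" where
  "QF_AC d = closures
     {Alls xs (Ex n A) \<^bold>\<longrightarrow> Ex F (Alls xs (subst n (foldl App (Var F) (map Var xs)) A))
      | xs n F A. qfree A \<and> distinct (n # xs) \<and> snd n = N \<and>
          (\<forall>x\<in>set xs. \<exists>k\<le>d. snd x = pure k) \<and>
          snd F = foldr Fun (map snd xs) N \<and> F \<notin> fv A \<union> set (n # xs)}"

definition RCA0_omega :: "fm set" where
  "RCA0_omega = EPRA \<union> QF_AC 1"

inductive_set st_schemata :: "fm set" where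
  st_eq: "(St t \<^bold>\<longrightarrow> eqF \<sigma> t u \<^bold>\<longrightarrow> St u) \<in> st_schemata"
| st_closed: "fvt t = {} \<Longrightarrow> parst t = {} \<Longrightarrow> St t \<in> st_schemata"
| st_app: "(St f \<^bold>\<longrightarrow> St t \<^bold>\<longrightarrow> St (f \<cdot> t)) \<in> st_schemata"
| st_le: "(St n \<^bold>\<longrightarrow> (m \<^bold>\<le> n) \<^bold>\<longrightarrow> St m) \<in> st_schemata"

text \<open>In \<open>I_axioms\<close> the list \<open>zs\<close> pairs each variable \<open>z\<close> with the name of its finite sequence.\<close>

definition I_axioms :: "fm set" where
  "I_axioms = closures
     {Allsts (map (\<lambda>(z, s). (s, Seq (snd z))) zs)
        (Ex y (foldr (\<lambda>(z, s) B. All z (memF (snd z) (Var z) (Var (s, Seq (snd z))) \<^bold>\<longrightarrow> B)) zs A))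
      \<^bold>\<longrightarrow> Ex y (Allsts (map fst zs) A)
      | zs y A. internal A \<and>
          distinct (y # map fst zs @ map (\<lambda>(z, s). (s, Seq (snd z))) zs) \<and>
          fv A \<inter> set (map (\<lambda>(z, s). (s, Seq (snd z))) zs) = {}}"

definition HAC_int :: "fm set" where
  "HAC_int = closures
     {Allsts xs (Exst y A)
      \<^bold>\<longrightarrow> Exst F (Allsts xs (Ex y (memF (snd y) (Var y) (foldl App (Var F) (map Var xs)) \<^bold>\<and> A)))
      | xs y F A. internal A \<and> distinct (y # xs) \<and>
          snd F = foldr Fun (map snd xs) (Seq (snd y)) \<and> F \<notin> fv A \<union> set (y # xs)}"

definition PF_TP :: "fm set" where
  "PF_TP = {Allsts xs A \<^bold>\<longrightarrow> Alls xs A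
     | xs A. internal A \<and> wff A \<and> pars A = {} \<and> fv A \<subseteq> set xs}"

text \<open>
  \<open>restr f n\<close> is \<open>\<langle>f 0, \<dots>, f (n - 1)\<rangle>\<close>; as entries beyond the length of a sequence
  \<open>s\<close> of numbers are \<open>0\<close>, the function \<open>ext0 s\<close> is \<open>s * 00\<dots>\<close>.
\<close>

definition restr :: "trm \<Rightarrow> trm \<Rightarrow> trm" where
  "restr f n = Con (Mk N) \<cdot> f \<cdot> n"

definition ext0 :: "trm \<Rightarrow> trm" where
  "ext0 s = Con (At N) \<cdot> s"

definition vXi :: var where "vXi = (''Xi'', t2 \<rightarrowtail> N)"

definition fan_modulus :: "trm \<Rightarrow> trm \<Rightarrow> fm" where
  "fan_modulus \<phi> n = (let f = (''f'', t1); g = (''g'', t1) in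
     All f (All g (le1 (Var f) one1 \<^bold>\<longrightarrow> le1 (Var g) one1 \<^bold>\<longrightarrow>
       eqF (Seq N) (restr (Var f) n) (restr (Var g) n) \<^bold>\<longrightarrow> (\<phi> \<cdot> Var f \<^bold>= \<phi> \<cdot> Var g))))"

definition M_fan :: fm where
  "M_fan = (let \<phi> = (''phi'', t2); m = (''m'', N) in
     All \<phi> (fan_modulus (Var \<phi>) (Var vXi \<cdot> Var \<phi>) \<^bold>\<and>
       BAlll m (Var vXi \<cdot> Var \<phi>) (\<^bold>\<not> fan_modulus (Var \<phi>) (Var m))))"

text \<open>
  \<open>Omega_axiom v M\<close> says that the constant is standard and agrees on standard arguments
  with every standard functional satisfying the relativisation of \<open>M\<close>.
  The relativised equality is \<open>(\<forall>\<^sup>s\<^sup>t z\<^sub>1 \<dots> z\<^sub>k) (\<Omega> z\<^sub>1 \<dots> z\<^sub>k = v z\<^sub>1 \<dots> z\<^sub>k)\<close>.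
  The axiom is available for the fan functional and for all formulas \<open>M\<close> of which
  \<open>RCA0_omega\<close> proves that at most one functional satisfies them.
\<close>

definition Omega_axiom :: "var \<Rightarrow> fm \<Rightarrow> fm" where
  "Omega_axiom v M = (St (Con (Omega v M)) \<^bold>\<and>
     Allst v (relst M \<^bold>\<longrightarrow> relst (eqF (snd v) (Con (Omega v M)) (Var v))))"

definition uniquely_defines :: "fm \<Rightarrow> var \<Rightarrow> bool" where
  "uniquely_defines M v \<longleftrightarrow>
     internal M \<and> wff M \<and> pars M = {} \<and> fv M \<subseteq> {v} \<and>
     (RCA0_omega \<turnstile> subst v (Par 0 (snd v)) M \<^bold>\<longrightarrow> subst v (Par 1 (snd v)) M \<^bold>\<longrightarrow>
        eqF (snd v) (Par 0 (snd v)) (Par 1 (snd v)))"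

definition Omega_axioms :: "fm set" where
  "Omega_axioms =
     insert (Omega_axiom vXi M_fan) {Omega_axiom v M | v M. uniquely_defines M v}"

definition K_mod :: "trm \<Rightarrow> fm" where
  "K_mod \<Upsilon> = (let \<phi> = (''phi'', t2); f = (''f'', t1); g = (''g'', t1) in
     All \<phi> (All f (All g (le1 (Var f) one1 \<^bold>\<longrightarrow> le1 (Var g) one1 \<^bold>\<longrightarrow>
       eqF (Seq N) (restr (Var f) (\<Upsilon> \<cdot> Var \<phi> \<cdot> Var f)) (restr (Var g) (\<Upsilon> \<cdot> Var \<phi> \<cdot> Var f)) \<^bold>\<longrightarrow>
       (Var \<phi> \<cdot> Var f \<^bold>= Var \<phi> \<cdot> Var g)))))"

text \<open>
  The value at \<open>s\<close> of the associate of \<open>\<phi>\<close> computed from the modulus \<open>w\<close>, that is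
  \<open>\<phi> (s * 00\<dots>) + 1\<close> if \<open>w (s * 00\<dots>) \<le> |s|\<close> and \<open>0\<close> otherwise.
\<close>

definition associate :: "trm \<Rightarrow> trm \<Rightarrow> trm \<Rightarrow> trm" where
  "associate \<phi> w s = Con Rec \<cdot> monus (w \<cdot> ext0 s) (len N s)
     \<cdot> suc (\<phi> \<cdot> ext0 s) \<cdot> const (N \<rightarrowtail> N) N (const N N zero)"

definition Lambda_axiom :: fm where
  "Lambda_axiom = (let \<Upsilon> = (''Upsilon'', t2 \<rightarrowtail> t1 \<rightarrowtail> N); \<phi> = (''phi'', t2); f = (''f'', t1) in
     St (Con Lambda0) \<^bold>\<and>
     Allst \<Upsilon> (relst (K_mod (Var \<Upsilon>)) \<^bold>\<longrightarrow>
       Allst \<phi> (Allst f (le1 (Var f) one1 \<^bold>\<longrightarrow>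
         (associate (Var \<phi>) (Var \<Upsilon> \<cdot> Var \<phi>) (restr (Var f) (Con Lambda0 \<cdot> Var \<phi> \<cdot> Var f))
            \<^bold>= suc (Var \<phi> \<cdot> Var f))))))"

definition RCA0_Omega :: "fm set" where
  "RCA0_Omega = RCA0_omega \<union> closures st_schemata \<union> I_axioms \<union> HAC_int \<union> PF_TP
     \<union> Omega_axioms \<union> {Lambda_axiom}"


section \<open>The three principles\<close>

definition UF :: fm where
  "UF = (let \<Theta> = (''Theta'', (N \<rightarrowtail> t2) \<rightarrowtail> (N \<rightarrowtail> t1) \<rightarrowtail> N \<rightarrowtail> t1);
             \<Phi> = (''Phi'', N \<rightarrowtail> t2); y = (''y'', N \<rightarrowtail> t1); k = (''k'', N); z = (''z'', t1);
             \<theta> = Var \<Theta> \<cdot> Var \<Phi> \<cdot> Var y in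
     Ex \<Theta> (All \<Phi> (All y (All k (All z (le1 (Var z) (Var y \<cdot> Var k) \<^bold>\<longrightarrow>
       (Var \<Phi> \<cdot> Var k \<cdot> Var z \<^bold>\<le> Var \<Phi> \<cdot> Var k \<cdot> (\<theta> \<cdot> Var k)) \<^bold>\<and> le01 \<theta> (Var y)))))))"

text \<open>The variables below follow the argument orders \<open>H x y z k\<close> and \<open>g x y k\<close>.\<close>

definition vy :: var where "vy = (''y'', N \<rightarrowtail> t1)"
definition vH :: var where "vH = (''H'', t1 \<rightarrowtail> (N \<rightarrowtail> t1) \<rightarrowtail> N \<rightarrowtail> N \<rightarrowtail> N)"
definition vg :: var where "vg = (''g'', t1 \<rightarrowtail> (N \<rightarrowtail> t1) \<rightarrowtail> N \<rightarrowtail> N)"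
definition vk :: var where "vk = (''k'', N)"
definition vn :: var where "vn = (''n'', N)"
definition vx :: var where "vx = (''x'', t1)"
definition vz :: var where "vz = (''z'', N)"

definition H0 :: "trm \<Rightarrow> fm" where
  "H0 t = (Var vH \<cdot> Var vx \<cdot> Var vy \<cdot> t \<cdot> Var vk \<^bold>= zero)"

definition Sprinciple :: fm where
  "Sprinciple = (let \<xi> = (''xi'', t1) in
     Allst vy (Allst vH (
       Allst vk (Allst vx (le1 (Var vx) (Var vy \<cdot> Var vk) \<^bold>\<longrightarrow> Exst vz (H0 (Var vz)))) \<^bold>\<longrightarrow>
       Exst \<xi> (Allst vk (All vx (le1 (Var vx) (Var vy \<cdot> Var vk) \<^bold>\<longrightarrow>
         BEx vz (Var \<xi> \<cdot> Var vk) (H0 (Var vz))))))))"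

text \<open>
  In \<open>USB\<close> the bound is uniform in \<open>H\<close>, so leastness is as well: each number
  \<open>\<Psi> y g k\<close> is below every number \<open>n\<close> which works at \<open>k\<close> for all \<open>H\<close>.
\<close>

definition USB :: fm where
  "USB = (let \<Psi> = (''Psi'', (N \<rightarrowtail> t1) \<rightarrowtail> snd vg \<rightarrowtail> t1);
              bounds = (\<lambda>b. All vx (le1 (Var vx) (Var vy \<cdot> Var vk) \<^bold>\<longrightarrow> BEx vz b (H0 (Var vz))));
              hyp = All vk (All vx (le1 (Var vx) (Var vy \<cdot> Var vk) \<^bold>\<longrightarrow>
                      H0 (Var vg \<cdot> Var vx \<cdot> Var vy \<cdot> Var vk)));
              \<psi> = Var \<Psi> \<cdot> Var vy \<cdot> Var vg \<cdot> Var vk in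
     Ex \<Psi> (
       All vy (All vH (All vg (hyp \<^bold>\<longrightarrow> All vk (bounds \<psi>)))) \<^bold>\<and>
       All vy (All vg (All vk (All vn (All vH (hyp \<^bold>\<longrightarrow> bounds (Var vn)) \<^bold>\<longrightarrow> (\<psi> \<^bold>\<le> Var vn)))))))"

end

theory Submission
  imports Defs "HOL-Library.Countable"
begin

text \<open>
  By Henkin's completeness theorem it suffices to argue in an arbitrary model in which objects
  with the same values are identified. All three principles are compared with the existence of
  a maximum functional, which assigns to \<open>b\<close> of type \<open>1\<close> and \<open>u\<close> of type \<open>2\<close> the maximum of
  \<open>u\<close> on the box \<open>{x. x \<le>\<^sub>1 b}\<close>.

  (USB) with \<open>H\<close> expressing \<open>u(x) \<le> z\<close> is the existence of this functional. It yields
  UF: the rightmost path through the digits of the points at which \<open>u\<close> is maximal is definable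
  from maxima, and the maximum is attained at its limit \<open>\<alpha>\<close>. Otherwise quantifier-free choice
  gives for each maximal point \<open>x\<close> an index \<open>G(x)\<close> at which it differs from \<open>\<alpha>\<close>, although \<open>G\<close>
  is bounded on the box and some maximal point agrees with \<open>\<alpha>\<close> up to that bound.

  By transfer, UF provides a standard functional \<open>\<Theta>\<close>. If \<open>g(k,x)\<close> is a standard witness
  obtained from \<open>HAC\<^sub>i\<^sub>n\<^sub>t\<close>, then \<open>\<xi>(k) = g(k,\<Theta>(g,y)(k))\<close> is a bound at standard points, and
  a further application of \<open>\<Theta>\<close> to the characteristic function of the counterexamples shows
  that there are none at all. Conversely, \<open>\<SS>\<close> bounds every standard \<open>u\<close> and lets
  universal statements pass from the standard points of a box to all points. So every standard
  \<open>u\<close> has a standard point of maximum, and \<open>HAC\<^sub>i\<^sub>n\<^sub>t\<close> collects the maxima in a standard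
  functional. As this is the only one with its defining property, it agrees with a constant on
  standard arguments, and parameter-free transfer extends the property to all arguments.
\<close>

text \<open>The detour through the maximum is forced by the interplay of choice and transfer.
  \<open>HAC_int\<close> yields standard functionals that are right at standard arguments, and
  \<open>PF_TP\<close> admits no parameters, so such a functional cannot itself be carried over to
  all arguments. A closed term is needed in its place, and a constant with a usable axiom requires
  provable uniqueness. The points supplied by UF are not unique; the maxima are, and the points are
  recovered from them afterwards.

  The second obstacle is that induction is quantifier-free. Bounded search, maxima over finite lists
  and lexicographic comparison are therefore computed by closed terms, built by bracket abstraction,
  and each induction predicate is written without quantifiers in these terms. Such terms are
  moreover standard.

  Completeness is used twice: for the final equivalences, and for the derivation of uniqueness in
  \<open>RCA0_omega\<close> that the axiom of the constant demands.\<close>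

instance ty :: countable by countable_datatype
instance trm :: countable by countable_datatype
instance fm :: countable by countable_datatype

text \<open>Constants contain formulas, so the datatype rules would run over three mutually
  recursive types at once. The rules of these functions recurse through terms or formulas alone and
  leave constants atomic.\<close>

lemmas trm_induct [case_names Var Par Con App, induct type: trm] = varlist.induct
lemmas fm_induct [case_names Eq St Bot Imp All, induct type: fm] = wff.induct

section \<open>Derivations and parameters\<close>

fun rent :: "(nat \<times> ty \<Rightarrow> nat) \<Rightarrow> trm \<Rightarrow> trm" where
  "rent r (Var v) = Var v"
| "rent r (Par a \<tau>) = Par (r (a, \<tau>)) \<tau>"
| "rent r (Con c) = Con c"
| "rent r (t \<cdot> u) = rent r t \<cdot> rent r u"

fun ren :: "(nat \<times> ty \<Rightarrow> nat) \<Rightarrow> fm \<Rightarrow> fm" where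
  "ren r (t \<^bold>= u) = (rent r t \<^bold>= rent r u)"
| "ren r (St t) = St (rent r t)"
| "ren r \<^bold>\<bottom> = \<^bold>\<bottom>"
| "ren r (A \<^bold>\<longrightarrow> B) = (ren r A \<^bold>\<longrightarrow> ren r B)"
| "ren r (All v A) = All v (ren r A)"

lemma tyof_rent [simp]: "tyof (rent r t) = tyof t"
  by (induction t) (auto split: option.splits ty.splits)

lemma varlist_rent [simp]: "varlist (rent r t) = varlist t"
  by (induction t) auto

lemma wff_ren [simp]: "wff (ren r A) = wff A"
  by (induction A) auto

lemma fv_ren [simp]: "fv (ren r A) = fv A"
  by (induction A) auto

lemma sentence_ren [simp]: "sentence (ren r A) = sentence A"
  by (simp add: sentence_def)

lemma rent_substt: "rent r (substt v s t) = substt v (rent r s) (rent r t)"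
  by (induction t) auto

lemma ren_subst: "ren r (subst v s A) = subst v (rent r s) (ren r A)"
  by (induction A) (auto simp: rent_substt)

lemma rent_cong: "(\<And>p. p \<in> parst t \<Longrightarrow> r p = r' p) \<Longrightarrow> rent r t = rent r' t"
  by (induction t) auto

lemma ren_cong: "(\<And>p. p \<in> pars A \<Longrightarrow> r p = r' p) \<Longrightarrow> ren r A = ren r' A"
  by (induction A) (auto intro: rent_cong)

lemma rent_id: "rent fst t = t"
  by (induction t) auto

lemma ren_id: "ren fst A = A"
  by (induction A) (auto simp: rent_id)

lemma finite_parst [simp]: "finite (parst t)"
  by (induction t) auto

lemma finite_pars [simp]: "finite (pars A)"
  by (induction A) auto

definition parset :: "fm set \<Rightarrow> (nat \<times> ty) set" where
  "parset \<Gamma> = (\<Union>A\<in>\<Gamma>. pars A)"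

lemma parset_insert [simp]: "parset (insert A \<Gamma>) = pars A \<union> parset \<Gamma>"
  by (simp add: parset_def)

lemma fresh_par:
  assumes "finite (X :: (nat \<times> ty) set)"
  obtains a where "(a, \<tau>) \<notin> X"
proof -
  have "finite (fst ` X)" using assms by simp
  then obtain a where "a \<notin> fst ` X" using ex_new_if_finite infinite_UNIV_nat by blast
  then have "(a, \<tau>) \<notin> X" by force
  then show ?thesis using that by blast
qed

text \<open>
  An eigenvariable of the derivation may occur in \<open>\<Delta>\<close>. Hence the induction is for
  all renamings of the parameters.
\<close>

lemma weakening_ren:
  assumes "\<Gamma> \<turnstile> A" and "ren r ` \<Gamma> \<subseteq> \<Delta>" and "finite (parset \<Delta>)"
  shows "\<Delta> \<turnstile> ren r A"
  using assms
proof (induction arbitrary: r \<Delta> rule: proves.induct)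
  case (Ax A \<Gamma>)
  then show ?case by (auto intro: proves.Ax)
next
  case (ImpI A \<Gamma> B)
  have "insert (ren r A) \<Delta> \<turnstile> ren r B"
    using ImpI.prems by (intro ImpI.IH) auto
  then show ?case using ImpI.hyps by (auto intro: proves.ImpI)
next
  case (ImpE \<Gamma> A B)
  have "\<Delta> \<turnstile> ren r A \<^bold>\<longrightarrow> ren r B" using ImpE.IH(1)[OF ImpE.prems] by simp
  then show ?case using ImpE.IH(2)[OF ImpE.prems] by (rule proves.ImpE)
next
  case (Raa A \<Gamma>)
  have "insert (\<^bold>\<not> ren r A) \<Delta> \<turnstile> ren r \<^bold>\<bottom>"
    using Raa.prems by (intro Raa.IH) (auto simp: Neg_def)
  then show ?case using Raa.hyps by (auto intro: proves.Raa)
next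
  case (AllI \<Gamma> v a A)
  obtain b where b: "(b, snd v) \<notin> pars (ren r A) \<union> parset \<Delta>"
    using fresh_par[of "pars (ren r A) \<union> parset \<Delta>"] AllI.prems by auto
  \<comment> \<open>The eigenvariable is sent to a parameter that is new for
    \<open>\<Delta>\<close>. As it occurs neither in \<open>\<Gamma>\<close> nor in
    \<open>A\<close>, the changed renaming agrees with \<open>r\<close> on both.\<close>
  let ?r = "r((a, snd v) := b)"
  have "ren ?r B = ren r B" if "B \<in> \<Gamma>" for B
    using that AllI.hyps by (intro ren_cong) auto
  then have "ren ?r ` \<Gamma> = ren r ` \<Gamma>" by (rule image_cong[OF refl])
  then have "ren ?r ` \<Gamma> \<subseteq> \<Delta>" using AllI.prems by simp
  then have "\<Delta> \<turnstile> ren ?r (subst v (Par a (snd v)) A)" using AllI.prems(2) by (rule AllI.IH)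
  moreover have "ren ?r A = ren r A" using AllI.hyps by (intro ren_cong) auto
  ultimately have "\<Delta> \<turnstile> subst v (Par b (snd v)) (ren r A)" by (simp add: ren_subst)
  then have "\<Delta> \<turnstile> All v (ren r A)"
    by (rule proves.AllI) (use b in \<open>auto simp: parset_def\<close>)
  then show ?case by simp
next
  case (AllE \<Gamma> v A t)
  have "\<Delta> \<turnstile> All v (ren r A)" using AllE.IH[OF AllE.prems] by simp
  then show ?case using AllE.hyps by (auto simp: ren_subst intro: proves.AllE)
qed

lemma weakening:
  assumes "\<Gamma> \<turnstile> A" and "\<Gamma> \<subseteq> \<Delta>" and "finite (parset \<Delta>)"
  shows "\<Delta> \<turnstile> A"
  using weakening_ren[of \<Gamma> A fst \<Delta>] assms by (simp add: ren_id)

text \<open>Closed with respect to bound variables only: parameters are allowed. These terms name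
  the objects of the canonical model.\<close>

definition cterm :: "ty \<Rightarrow> trm \<Rightarrow> bool" where
  "cterm \<tau> t \<longleftrightarrow> tyof t = Some \<tau> \<and> fvt t = {}"

lemma cterm_Par [simp]: "cterm \<tau> (Par a \<sigma>) \<longleftrightarrow> \<sigma> = \<tau>"
  by (auto simp: cterm_def)

lemma cterm_Con [simp]: "cterm \<tau> (Con c) \<longleftrightarrow> contype c = \<tau>"
  by (auto simp: cterm_def)

lemma cterm_App [intro]: "cterm (\<sigma> \<rightarrowtail> \<tau>) t \<Longrightarrow> cterm \<sigma> u \<Longrightarrow> cterm \<tau> (t \<cdot> u)"
  by (auto simp: cterm_def)

lemma tyof_substt: "tyof s = Some (snd v) \<Longrightarrow> tyof (substt v s t) = tyof t"
  by (induction t) (auto split: option.splits ty.splits)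

lemma fvt_substt: "fvt s = {} \<Longrightarrow> fvt (substt v s t) = fvt t - {v}"
  by (induction t) auto

lemma wff_subst: "tyof s = Some (snd v) \<Longrightarrow> wff (subst v s A) = wff A"
  by (induction A) (auto simp: tyof_substt)

lemma parst_substt: "parst (substt v s t) \<subseteq> parst t \<union> parst s"
  by (induction t) auto

lemma pars_subst: "pars (subst v s A) \<subseteq> pars A \<union> parst s"
proof (induction A)
  case (Eq t u)
  show ?case using parst_substt[of v s t] parst_substt[of v s u] by auto
next
  case (St t)
  show ?case using parst_substt[of v s t] by simp
qed auto

lemma fv_subst: "fvt s = {} \<Longrightarrow> fv (subst v s A) = fv A - {v}"
  by (induction A) (auto simp: fvt_substt)

lemma sentence_subst: "sentence (All v A) \<Longrightarrow> cterm (snd v) t \<Longrightarrow> sentence (subst v t A)"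
  by (auto simp: sentence_def wff_subst fv_subst cterm_def)

lemma sentence_Imp [simp]: "sentence (A \<^bold>\<longrightarrow> B) \<longleftrightarrow> sentence A \<and> sentence B"
  by (auto simp: sentence_def)

lemma sentence_Bot [simp]: "sentence \<^bold>\<bottom>"
  by (auto simp: sentence_def)

lemma sentence_Neg [simp]: "sentence (\<^bold>\<not> A) \<longleftrightarrow> sentence A"
  by (auto simp: Neg_def)

lemma sentence_closures: "B \<in> closures X \<Longrightarrow> sentence B \<and> pars B = {}"
proof -
  have "wff (Alls vs A) = wff A" "fv (Alls vs A) = fv A - set vs" "pars (Alls vs A) = pars A"
    for vs A by (induction vs) auto
  then show "B \<in> closures X \<Longrightarrow> sentence B \<and> pars B = {}"
    by (auto simp: closures_def sentence_def)
qed

section \<open>Henkin extensions\<close>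

text \<open>Finitely many parameters leave fresh ones for the counterexamples added at each stage
  and for the eigenvariables when weakening.\<close>

locale henkin =
  fixes \<Gamma> :: "fm set"
  assumes consistent: "\<not> (\<Gamma> \<turnstile> \<^bold>\<bottom>)" and finpars: "finite (parset \<Gamma>)"
begin

text \<open>A counterexample to a negated universal formula, at a parameter new for the formula and
  the stage. Negation is matched in its unfolded form.\<close>

definition witness :: "fm set \<Rightarrow> fm \<Rightarrow> fm set" where
  "witness \<Delta> A = (case A of
     (All v B \<^bold>\<longrightarrow> \<^bold>\<bottom>) \<Rightarrow>
       {\<^bold>\<not> subst v (Par (SOME a. (a, snd v) \<notin> pars A \<union> parset \<Delta>) (snd v)) B}
   | _ \<Rightarrow> {})"

lemma witness_finite: "finite (witness \<Delta> A)"
  by (auto simp: witness_def split: fm.split)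

lemma witness_cases:
  obtains (empty) "witness \<Delta> A = {}"
  | (witness) v B where "A = (\<^bold>\<not> All v B)"
      "witness \<Delta> A = {\<^bold>\<not> subst v (Par (SOME a. (a, snd v) \<notin> pars A \<union> parset \<Delta>) (snd v)) B}"
proof (cases "\<exists>v B. A = (All v B \<^bold>\<longrightarrow> \<^bold>\<bottom>)")
  case True
  then show ?thesis using witness by (auto simp: witness_def Neg_def)
next
  case False
  then show ?thesis using empty by (auto simp: witness_def split: fm.split)
qed

text \<open>Completion and witnessing in one pass. As every formula is some
  \<open>from_nat n\<close>, a sentence \<open>A\<close> is settled at stage
  \<open>Suc (to_nat A)\<close>.\<close>

primrec stage :: "nat \<Rightarrow> fm set" where
  "stage 0 = \<Gamma>"
| "stage (Suc n) = (let A = from_nat n; \<Delta> = stage n in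
     if sentence A then
       (if (insert A \<Delta> \<turnstile> \<^bold>\<bottom>) then insert (\<^bold>\<not> A) \<Delta> else insert A \<Delta> \<union> witness \<Delta> A)
     else \<Delta>)"

lemma parset_Un [simp]: "parset (X \<union> Y) = parset X \<union> parset Y"
  by (simp add: parset_def)

lemma finite_parset_finite [simp]: "finite X \<Longrightarrow> finite (parset X)"
  by (simp add: parset_def)

lemma finpars_stage: "finite (parset (stage n))"
  by (induction n) (auto simp: finpars Let_def witness_finite)

lemma stage_Suc: "stage n \<subseteq> stage (Suc n)"
  by (auto simp: Let_def)

lemma stage_mono: "m \<le> n \<Longrightarrow> stage m \<subseteq> stage n"
  using lift_Suc_mono_le[of stage] stage_Suc by blast

text \<open>A contradiction from the counterexample at a fresh parameter would, by generalisation,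
  give the universal formula whose negation has just been added consistently.\<close>

lemma consistent_stage: "\<not> (stage n \<turnstile> \<^bold>\<bottom>)"
proof (induction n)
  case 0
  then show ?case by (simp add: consistent)
next
  case (Suc n)
  let ?A = "from_nat n :: fm" and ?\<Delta> = "stage n"
  show ?case
  proof
    assume bot: "stage (Suc n) \<turnstile> \<^bold>\<bottom>"
    have s: "sentence ?A" using bot Suc by (auto simp: Let_def split: if_splits)
    show False
    proof (cases "insert ?A ?\<Delta> \<turnstile> \<^bold>\<bottom>")
      case True
      then have "?\<Delta> \<turnstile> \<^bold>\<not> ?A" using s by (auto simp: Neg_def intro: ImpI)
      moreover have "?\<Delta> \<turnstile> ?A" using bot s True by (auto intro: Raa simp: Let_def)
      ultimately show False using Suc by (auto simp: Neg_def intro: ImpE)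
    next
      case cons: False
      let ?E = "insert ?A ?\<Delta>"
      show False
      proof (cases ?\<Delta> ?A rule: witness_cases)
        case empty
        then show False using bot s cons by (simp add: Let_def)
      next
        case (witness v B)
        define a where "a = (SOME a. (a, snd v) \<notin> pars ?A \<union> parset ?\<Delta>)"
        have a: "(a, snd v) \<notin> pars ?A \<union> parset ?\<Delta>"
          unfolding a_def using fresh_par[of "pars ?A \<union> parset ?\<Delta>"] finpars_stage
          by (metis (mono_tags, lifting) finite_UnI finite_pars someI_ex)
        have sB: "sentence (All v B)" using s witness(1) by simp
        have "insert (\<^bold>\<not> subst v (Par a (snd v)) B) ?E \<turnstile> \<^bold>\<bottom>"
          using bot s cons witness(2) by (simp add: Let_def a_def)
        then have "?E \<turnstile> subst v (Par a (snd v)) B"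
          by (rule Raa) (use sB in \<open>auto intro: sentence_subst\<close>)
        then have "?E \<turnstile> All v B"
          by (rule AllI) (use a witness(1) in \<open>auto simp: parset_def Neg_def\<close>)
        moreover have "?E \<turnstile> \<^bold>\<not> All v B" using witness(1) by (auto intro: Ax)
        ultimately show False using cons by (auto simp: Neg_def intro: ImpE)
      qed
    qed
  qed
qed

text \<open>
  The union of the stages leaves no parameter unused, so weakening to it is not available;
  truth is provability from some stage.
\<close>

definition T :: "fm \<Rightarrow> bool" where
  "T A \<longleftrightarrow> (\<exists>n. (stage n \<turnstile> A))"

lemma T_stage: "stage n \<turnstile> A \<Longrightarrow> n \<le> m \<Longrightarrow> stage m \<turnstile> A"
  using weakening stage_mono finpars_stage by blast

lemma T_Ax: "A \<in> \<Gamma> \<Longrightarrow> T A"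
  unfolding T_def by (rule exI[of _ 0]) (simp add: Ax)

lemma T_Bot [simp]: "\<not> T \<^bold>\<bottom>"
  by (simp add: T_def consistent_stage)

lemma T_MP: "T (A \<^bold>\<longrightarrow> B) \<Longrightarrow> T A \<Longrightarrow> T B"
  unfolding T_def by (meson ImpE T_stage linorder_linear)

lemma T_decided:
  assumes "sentence A" "\<not> T A"
  shows "T (\<^bold>\<not> A)"
proof -
  have "(stage (Suc (to_nat A)) \<turnstile> A) \<or> (stage (Suc (to_nat A)) \<turnstile> \<^bold>\<not> A)"
    using assms by (auto simp: Let_def intro: Ax)
  then show ?thesis using assms(2) unfolding T_def by blast
qed

lemma T_Imp:
  assumes "sentence A" "sentence B"
  shows "T (A \<^bold>\<longrightarrow> B) \<longleftrightarrow> (T A \<longrightarrow> T B)"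
proof
  show "T (A \<^bold>\<longrightarrow> B) \<Longrightarrow> T A \<longrightarrow> T B" using T_MP by blast
next
  assume *: "T A \<longrightarrow> T B"
  show "T (A \<^bold>\<longrightarrow> B)"
  proof (cases "T B")
    case True
    then obtain n where "stage n \<turnstile> B" by (auto simp: T_def)
    then have "insert A (stage n) \<turnstile> B" by (rule weakening) (auto simp: finpars_stage)
    then show ?thesis using assms by (auto simp: T_def intro: ImpI)
  next
    case False
    then have "T (\<^bold>\<not> A)" using * T_decided assms by blast
    then obtain n where "stage n \<turnstile> A \<^bold>\<longrightarrow> \<^bold>\<bottom>" by (auto simp: T_def Neg_def)
    then have n: "insert (\<^bold>\<not> B) (insert A (stage n)) \<turnstile> A \<^bold>\<longrightarrow> \<^bold>\<bottom>"
      by (rule weakening) (auto simp: finpars_stage)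
    have "insert (\<^bold>\<not> B) (insert A (stage n)) \<turnstile> \<^bold>\<bottom>" by (rule ImpE[OF n]) (auto intro: Ax)
    then have "insert A (stage n) \<turnstile> B" using assms by (auto intro: Raa)
    then show ?thesis using assms by (auto simp: T_def intro: ImpI)
  qed
qed

text \<open>If the universal formula is not true, its negation is consistent with the stage at which
  it is enumerated, and so is added there together with a counterexample.\<close>

lemma T_All:
  assumes s: "sentence (All v A)"
  shows "T (All v A) \<longleftrightarrow> (\<forall>t. cterm (snd v) t \<longrightarrow> T (subst v t A))"
proof
  show "T (All v A) \<Longrightarrow> \<forall>t. cterm (snd v) t \<longrightarrow> T (subst v t A)"
    by (auto simp: T_def cterm_def intro: AllE)
next
  assume *: "\<forall>t. cterm (snd v) t \<longrightarrow> T (subst v t A)"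
  show "T (All v A)"
  proof (rule ccontr)
    assume notT: "\<not> T (All v A)"
    let ?B = "\<^bold>\<not> All v A"
    let ?n = "to_nat ?B"
    have B: "from_nat ?n = ?B" "sentence ?B" using s by auto
    have cons: "\<not> (insert ?B (stage ?n) \<turnstile> \<^bold>\<bottom>)"
      using notT s unfolding T_def by (blast intro: Raa)
    define a where "a = (SOME a. (a, snd v) \<notin> pars ?B \<union> parset (stage ?n))"
    have "(\<^bold>\<not> subst v (Par a (snd v)) A) \<in> stage (Suc ?n)"
      using B cons by (simp add: Let_def witness_def Neg_def a_def)
    then have "T (\<^bold>\<not> subst v (Par a (snd v)) A)" unfolding T_def by (blast intro: Ax)
    moreover have "T (subst v (Par a (snd v)) A)" using * by simp
    ultimately show False using T_MP T_Bot unfolding Neg_def by blast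
  qed
qed

end

text \<open>Variables, parameters and objects of the canonical model are pairs; quantifiers over
  them are to stay unsplit.\<close>

declare split_paired_All [simp del] split_paired_Ex [simp del]

section \<open>Models\<close>

text \<open>Total, so that the type of an application is given by an equation without side
  conditions.\<close>

fun cod :: "ty \<Rightarrow> ty" where
  "cod (\<sigma> \<rightarrowtail> \<tau>) = \<tau>"
| "cod \<tau> = \<tau>"

lemma fvt_monus [simp]: "fvt (monus t u) = fvt t \<union> fvt u"
  by (auto simp: monus_def const_def predf_def idN_def Let_def)

lemma tyof_monus [simp]: "tyof t = Some N \<Longrightarrow> tyof u = Some N \<Longrightarrow> tyof (monus t u) = Some N"
  by (simp add: monus_def const_def predf_def idN_def Let_def)

lemma fresh_fresh: "v \<in> fvt t \<union> fvt u \<Longrightarrow> fst v \<noteq> fresh t u"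
proof -
  have "v \<in> set xs \<Longrightarrow> length (fst v) \<le> length (concat (map fst xs))" for xs :: "var list"
    by (induction xs) auto
  then show "v \<in> fvt t \<union> fvt u \<Longrightarrow> fst v \<noteq> fresh t u"
    unfolding fresh_def
    by (metis Suc_n_not_le_n length_Cons set_append)
qed

lemma fresh_notin [simp]: "(fresh t u, \<sigma>) \<notin> fvt t" "(fresh t u, \<sigma>) \<notin> fvt u"
  using fresh_fresh by fastforce+

lemma wff_Neg [simp]: "wff (\<^bold>\<not> A) = wff A" by (simp add: Neg_def)
lemma wff_Conj [simp]: "wff (A \<^bold>\<and> B) \<longleftrightarrow> wff A \<and> wff B" by (simp add: Conj_def)
lemma wff_Ex [simp]: "wff (Ex v A) = wff A" by (simp add: Ex_def)
lemma wff_leF [simp]: "tyof t = Some N \<Longrightarrow> tyof u = Some N \<Longrightarrow> wff (t \<^bold>\<le> u)"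
  by (simp add: leF_def)
lemma wff_ltF [simp]: "tyof t = Some N \<Longrightarrow> tyof u = Some N \<Longrightarrow> wff (t \<^bold>< u)"
  by (simp add: ltF_def)
lemma wff_BAlll [simp]:
  "snd v = N \<Longrightarrow> tyof t = Some N \<Longrightarrow> wff (BAlll v t A) = wff A" by (simp add: BAlll_def)
lemma wff_BExl [simp]:
  "snd v = N \<Longrightarrow> tyof t = Some N \<Longrightarrow> wff (BExl v t A) = wff A" by (simp add: BExl_def)
lemma wff_eqF [simp]: "tyof t = Some \<tau> \<Longrightarrow> tyof u = Some \<tau> \<Longrightarrow> wff (eqF \<tau> t u)"
  by (induction \<tau> arbitrary: t u) (auto simp: Let_def)
lemma wff_le1 [simp]: "tyof t = Some t1 \<Longrightarrow> tyof u = Some t1 \<Longrightarrow> wff (le1 t u)"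
  by (simp add: le1_def Let_def)
lemma wff_le01 [simp]: "tyof t = Some (N \<rightarrowtail> t1) \<Longrightarrow> tyof u = Some (N \<rightarrowtail> t1) \<Longrightarrow> wff (le01 t u)"
  by (simp add: le01_def Let_def)
lemma wff_memF [simp]: "tyof t = Some \<tau> \<Longrightarrow> tyof s = Some (Seq \<tau>) \<Longrightarrow> wff (memF \<tau> t s)"
  by (simp add: memF_def Let_def)
lemma wff_Allst [simp]: "wff (Allst v A) = wff A" by (simp add: Allst_def)
lemma wff_Exst [simp]: "wff (Exst v A) = wff A" by (simp add: Exst_def)

text \<open>One carrier for all types: \<open>el\<close> singles out the objects and
  \<open>ty\<close> sorts them. The bare interpretation suffices to define truth.\<close>

locale pre_model =
  fixes el :: "'d \<Rightarrow> bool" and ty :: "'d \<Rightarrow> ty" and ap :: "'d \<Rightarrow> 'd \<Rightarrow> 'd" (infixl "\<bullet>" 200)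
    and cn :: "con \<Rightarrow> 'd" and pr :: "nat \<Rightarrow> ty \<Rightarrow> 'd" and st :: "'d \<Rightarrow> bool"
begin

fun ev :: "(var \<Rightarrow> 'd) \<Rightarrow> trm \<Rightarrow> 'd" where
  "ev e (Var v) = e v"
| "ev e (Par a \<tau>) = pr a \<tau>"
| "ev e (Con c) = cn c"
| "ev e (t \<cdot> u) = ev e t \<bullet> ev e u"

fun sat :: "(var \<Rightarrow> 'd) \<Rightarrow> fm \<Rightarrow> bool" where
  "sat e (t \<^bold>= u) \<longleftrightarrow> ev e t = ev e u"
| "sat e (St t) \<longleftrightarrow> st (ev e t)"
| "sat e \<^bold>\<bottom> \<longleftrightarrow> False"
| "sat e (A \<^bold>\<longrightarrow> B) \<longleftrightarrow> (sat e A \<longrightarrow> sat e B)"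
| "sat e (All v A) \<longleftrightarrow> (\<forall>d. el d \<longrightarrow> ty d = snd v \<longrightarrow> sat (e(v := d)) A)"

definition wt :: "(var \<Rightarrow> 'd) \<Rightarrow> bool" where
  "wt e \<longleftrightarrow> (\<forall>v. el (e v) \<and> ty (e v) = snd v)"

text \<open>Read off the subtraction term itself, so that the order in formulas and the order of the
  model agree in any interpretation whatever.\<close>

definition mon :: "'d \<Rightarrow> 'd \<Rightarrow> 'd" where
  "mon a b = ev (\<lambda>v. if v = (''a'', N) then a else b) (monus (Var (''a'', N)) (Var (''b'', N)))"

abbreviation le :: "'d \<Rightarrow> 'd \<Rightarrow> bool" (infix "\<sqsubseteq>" 50) where
  "a \<sqsubseteq> b \<equiv> mon a b = cn Zero"

abbreviation sc :: "'d \<Rightarrow> 'd" where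
  "sc a \<equiv> cn Succ \<bullet> a"

lemma ev_monus [simp]: "ev e (monus t u) = mon (ev e t) (ev e u)"
  by (simp add: mon_def monus_def const_def predf_def idN_def Let_def)

lemma sat_leF [simp]: "sat e (t \<^bold>\<le> u) \<longleftrightarrow> ev e t \<sqsubseteq> ev e u"
  by (simp add: leF_def)

lemma sat_ltF [simp]: "sat e (t \<^bold>< u) \<longleftrightarrow> sc (ev e t) \<sqsubseteq> ev e u"
  by (simp add: ltF_def)

lemma sat_Neg [simp]: "sat e (\<^bold>\<not> A) \<longleftrightarrow> \<not> sat e A" by (simp add: Neg_def)
lemma sat_Conj [simp]: "sat e (A \<^bold>\<and> B) \<longleftrightarrow> sat e A \<and> sat e B" by (simp add: Conj_def)
lemma sat_Iff [simp]: "sat e (A \<^bold>\<longleftrightarrow> B) \<longleftrightarrow> (sat e A \<longleftrightarrow> sat e B)" by (auto simp: Iff_def)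
lemma sat_Ex [simp]: "sat e (Ex v A) \<longleftrightarrow> (\<exists>d. el d \<and> ty d = snd v \<and> sat (e(v := d)) A)"
  by (simp add: Ex_def)
lemma sat_Allst [simp]:
  "sat e (Allst v A) \<longleftrightarrow> (\<forall>d. el d \<longrightarrow> ty d = snd v \<longrightarrow> st d \<longrightarrow> sat (e(v := d)) A)"
  by (simp add: Allst_def)
lemma sat_Exst [simp]:
  "sat e (Exst v A) \<longleftrightarrow> (\<exists>d. el d \<and> ty d = snd v \<and> st d \<and> sat (e(v := d)) A)"
  by (simp add: Exst_def)

lemma ev_cong: "(\<And>v. v \<in> fvt t \<Longrightarrow> e v = e' v) \<Longrightarrow> ev e t = ev e' t"
  by (induction t) auto

lemma ev_upd_notin [simp]: "v \<notin> fvt t \<Longrightarrow> ev (e(v := d)) t = ev e t"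
  by (rule ev_cong) auto

lemma sat_cong: "(\<And>v. v \<in> fv A \<Longrightarrow> e v = e' v) \<Longrightarrow> sat e A \<longleftrightarrow> sat e' A"
proof (induction A arbitrary: e e')
  case (Eq t u)
  then have "ev e t = ev e' t" "ev e u = ev e' u" by (auto intro!: ev_cong)
  then show ?case by simp
next
  case (St t)
  then have "ev e t = ev e' t" by (auto intro!: ev_cong)
  then show ?case by simp
next
  case (Imp A B)
  have "sat e A = sat e' A" by (rule Imp.IH) (use Imp.prems in auto)
  moreover have "sat e B = sat e' B" by (rule Imp.IH) (use Imp.prems in auto)
  ultimately show ?case by simp
next
  case (All v A)
  have "sat (e(v := d)) A = sat (e'(v := d)) A" for d
    using All.prems by (intro All.IH) auto
  then show ?case by simp
qed auto

lemma sat_BAlll [simp]: "v \<notin> fvt t \<Longrightarrow> sat e (BAlll v t A) \<longleftrightarrow>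
    (\<forall>d. el d \<longrightarrow> ty d = snd v \<longrightarrow> sc d \<sqsubseteq> ev e t \<longrightarrow> sat (e(v := d)) A)"
  by (simp add: BAlll_def)

lemma sat_BExl [simp]: "v \<notin> fvt t \<Longrightarrow> sat e (BExl v t A) \<longleftrightarrow>
    (\<exists>d. el d \<and> ty d = snd v \<and> sc d \<sqsubseteq> ev e t \<and> sat (e(v := d)) A)"
  by (simp add: BExl_def)

lemma sat_BEx [simp]: "v \<notin> fvt t \<Longrightarrow> sat e (BEx v t A) \<longleftrightarrow>
    (\<exists>d. el d \<and> ty d = snd v \<and> d \<sqsubseteq> ev e t \<and> sat (e(v := d)) A)"
  by (simp add: BEx_def BAll_def)

lemma sat_le1 [simp]:
  "sat e (le1 t u) \<longleftrightarrow> (\<forall>d. el d \<longrightarrow> ty d = N \<longrightarrow> ev e t \<bullet> d \<sqsubseteq> ev e u \<bullet> d)"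
  by (simp add: le1_def Let_def)

lemma wt_upd [simp]: "wt e \<Longrightarrow> el d \<Longrightarrow> ty d = snd v \<Longrightarrow> wt (e(v := d))"
  by (simp add: wt_def)

end

text \<open>The two extensionality conditions make the defined equality of every type coincide with
  identity, which allows rewriting in HOL.\<close>

locale normal_model = pre_model +
  assumes el_ap: "el f \<Longrightarrow> el a \<Longrightarrow> ty f = ty a \<rightarrowtail> cod (ty f) \<Longrightarrow> el (f \<bullet> a)"
    and ty_ap [simp]: "ty (f \<bullet> a) = cod (ty f)"
    and el_cn [simp]: "el (cn c)" and ty_cn [simp]: "ty (cn c) = contype c"
    and el_pr [simp]: "el (pr k \<rho>)" and ty_pr [simp]: "ty (pr k \<rho>) = \<rho>"
    and ext: "el f \<Longrightarrow> el g \<Longrightarrow> ty f = \<sigma> \<rightarrowtail> \<tau> \<Longrightarrow> ty g = \<sigma> \<rightarrowtail> \<tau> \<Longrightarrow>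
        (\<And>a. el a \<Longrightarrow> ty a = \<sigma> \<Longrightarrow> f \<bullet> a = g \<bullet> a) \<Longrightarrow> f = g"
    and ext_Seq: "el s \<Longrightarrow> el r \<Longrightarrow> ty s = Seq \<sigma> \<Longrightarrow> ty r = Seq \<sigma> \<Longrightarrow>
        cn (Len \<sigma>) \<bullet> s = cn (Len \<sigma>) \<bullet> r \<Longrightarrow>
        (\<And>i. el i \<Longrightarrow> ty i = N \<Longrightarrow> sc i \<sqsubseteq> cn (Len \<sigma>) \<bullet> s \<Longrightarrow>
          cn (At \<sigma>) \<bullet> s \<bullet> i = cn (At \<sigma>) \<bullet> r \<bullet> i) \<Longrightarrow> s = r"
begin

lemma el_ap' [simp]: "el f \<Longrightarrow> el a \<Longrightarrow> ty f = ty a \<rightarrowtail> \<tau> \<Longrightarrow> el (f \<bullet> a)"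
  using el_ap by auto

lemma ev_type:
  "wt e \<Longrightarrow> tyof t = Some \<tau> \<Longrightarrow> el (ev e t) \<and> ty (ev e t) = \<tau>"
  by (induction t arbitrary: \<tau>) (auto simp: wt_def split: option.splits ty.splits if_splits)

lemma ev_el [simp]: "wt e \<Longrightarrow> tyof t = Some \<tau> \<Longrightarrow> el (ev e t)"
  and ev_ty: "wt e \<Longrightarrow> tyof t = Some \<tau> \<Longrightarrow> ty (ev e t) = \<tau>"
  using ev_type by auto

lemma sat_eqF [simp]:
  "wt e \<Longrightarrow> tyof t = Some \<tau> \<Longrightarrow> tyof u = Some \<tau> \<Longrightarrow> sat e (eqF \<tau> t u) \<longleftrightarrow> ev e t = ev e u"
proof (induction \<tau> arbitrary: e t u)
  case N
  then show ?case by simp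
next
  case (Fun \<sigma> \<tau>)
  let ?v = "(fresh t u, \<sigma>)"
  have "sat (e(?v := d)) (eqF \<tau> (t \<cdot> Var ?v) (u \<cdot> Var ?v)) \<longleftrightarrow> ev e t \<bullet> d = ev e u \<bullet> d"
    if "el d" "ty d = \<sigma>" for d
    by (subst Fun.IH(2)) (use that Fun.prems in simp_all)
  then have "sat e (eqF (\<sigma> \<rightarrowtail> \<tau>) t u) \<longleftrightarrow>
      (\<forall>d. el d \<longrightarrow> ty d = \<sigma> \<longrightarrow> ev e t \<bullet> d = ev e u \<bullet> d)"
    using Fun.prems by (auto simp: Let_def)
  also have "\<dots> \<longleftrightarrow> ev e t = ev e u"
    using ext[of "ev e t" "ev e u" \<sigma> \<tau>] ev_type[OF Fun.prems(1)] Fun.prems(2,3) by auto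
  finally show ?case .
next
  case (Seq \<sigma>)
  let ?v = "(fresh t u, N)"
  have "sat (e(?v := d)) (eqF \<sigma> (at \<sigma> t (Var ?v)) (at \<sigma> u (Var ?v))) \<longleftrightarrow>
      cn (At \<sigma>) \<bullet> ev e t \<bullet> d = cn (At \<sigma>) \<bullet> ev e u \<bullet> d"
    if "el d" "ty d = N" for d
    by (subst Seq.IH) (use that Seq.prems in simp_all)
  then have "sat e (eqF (Seq \<sigma>) t u) \<longleftrightarrow> cn (Len \<sigma>) \<bullet> ev e t = cn (Len \<sigma>) \<bullet> ev e u \<and>
      (\<forall>d. el d \<longrightarrow> ty d = N \<longrightarrow> sc d \<sqsubseteq> cn (Len \<sigma>) \<bullet> ev e t \<longrightarrow>
         cn (At \<sigma>) \<bullet> ev e t \<bullet> d = cn (At \<sigma>) \<bullet> ev e u \<bullet> d)"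
    using Seq.prems by (auto simp: Let_def)
  also have "\<dots> \<longleftrightarrow> ev e t = ev e u"
    using ext_Seq[of "ev e t" "ev e u" \<sigma>] ev_type[OF Seq.prems(1)] Seq.prems(2,3) by auto
  finally show ?case .
qed

lemma sat_memF [simp]:
  "wt e \<Longrightarrow> tyof t = Some \<tau> \<Longrightarrow> tyof s = Some (Seq \<tau>) \<Longrightarrow> sat e (memF \<tau> t s) \<longleftrightarrow>
    (\<exists>i. el i \<and> ty i = N \<and> sc i \<sqsubseteq> cn (Len \<tau>) \<bullet> ev e s \<and> ev e t = cn (At \<tau>) \<bullet> ev e s \<bullet> i)"
  by (simp add: memF_def Let_def cong: conj_cong)

lemma sat_Alls: "sat e (Alls vs A) \<Longrightarrow> wt e \<Longrightarrow> sat e A"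
proof (induction vs)
  case (Cons v vs)
  then have "sat (e(v := e v)) (Alls vs A)" unfolding foldr_Cons comp_apply sat.simps wt_def by blast
  then show ?case using Cons by simp
qed simp

lemma sat_closures:
  "A \<in> X \<Longrightarrow> (\<And>B. B \<in> closures X \<Longrightarrow> sat e B) \<Longrightarrow> wff A \<Longrightarrow> pars A = {} \<Longrightarrow> wt e \<Longrightarrow> sat e A"
proof -
  assume *: "A \<in> X" "\<And>B. B \<in> closures X \<Longrightarrow> sat e B" "wff A" "pars A = {}" "wt e"
  have "finite (fv A)"
    by (induction A) auto
  then obtain vs where "set vs = fv A" using finite_list by blast
  then have "Alls vs A \<in> closures X" using * by (auto simp: closures_def)
  then show ?thesis using * sat_Alls by blast
qed

end

section \<open>The canonical model\<close>

fun msub :: "(var \<Rightarrow> trm) \<Rightarrow> trm \<Rightarrow> trm" where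
  "msub e (Var v) = e v"
| "msub e (Par a \<tau>) = Par a \<tau>"
| "msub e (Con c) = Con c"
| "msub e (t \<cdot> u) = msub e t \<cdot> msub e u"

text \<open>Simultaneous substitution of closed terms plays the part of an assignment. Below a
  quantifier its variable is kept, and closed terms cannot be captured.\<close>

fun mfm :: "(var \<Rightarrow> trm) \<Rightarrow> fm \<Rightarrow> fm" where
  "mfm e (t \<^bold>= u) = (msub e t \<^bold>= msub e u)"
| "mfm e (St t) = St (msub e t)"
| "mfm e \<^bold>\<bottom> = \<^bold>\<bottom>"
| "mfm e (A \<^bold>\<longrightarrow> B) = (mfm e A \<^bold>\<longrightarrow> mfm e B)"
| "mfm e (All v A) = All v (mfm (e(v := Var v)) A)"

lemma tyof_msub: "(\<And>v. tyof (e v) = Some (snd v)) \<Longrightarrow> tyof (msub e t) = tyof t"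
  by (induction t) (auto split: option.splits ty.splits)

lemma fvt_msub: "fvt (msub e t) = (\<Union>v\<in>fvt t. fvt (e v))"
  by (induction t) auto

lemma msub_cong: "(\<And>v. v \<in> fvt t \<Longrightarrow> e v = e' v) \<Longrightarrow> msub e t = msub e' t"
  by (induction t) auto

lemma msub_id: "(\<And>v. v \<in> fvt t \<Longrightarrow> e v = Var v) \<Longrightarrow> msub e t = t"
  by (induction t) auto

lemma substt_id: "v \<notin> fvt t \<Longrightarrow> substt v s t = t"
  by (induction t) auto

lemma substt_msub:
  "e v = Var v \<Longrightarrow> (\<And>w. w \<noteq> v \<Longrightarrow> v \<notin> fvt (e w)) \<Longrightarrow> substt v s (msub e t) = msub (e(v := s)) t"
  by (induction t) (auto simp: substt_id)

text \<open>Instantiating the variable kept below a quantifier amounts to updating the assignment;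
  this is the quantifier step of the truth lemma.\<close>

lemma subst_mfm:
  "e v = Var v \<Longrightarrow> (\<And>w. w \<noteq> v \<Longrightarrow> v \<notin> fvt (e w)) \<Longrightarrow> subst v s (mfm e A) = mfm (e(v := s)) A"
proof (induction A arbitrary: e)
  case (All w A)
  show ?case
  proof (cases "w = v")
    case True
    then show ?thesis using All.prems by (simp add: fun_upd_idem fun_upd_upd del: fun_upd_apply)
  next
    case False
    have "subst v s (mfm (e(w := Var w)) A) = mfm (e(w := Var w, v := s)) A"
      using All.prems False by (intro All.IH) auto
    then show ?thesis using fun_upd_twist[OF False, of e "Var w" s] False by (simp del: fun_upd_apply)
  qed
qed (auto simp: substt_msub)

lemma mfm_id: "(\<And>v. v \<in> fv A \<Longrightarrow> e v = Var v) \<Longrightarrow> mfm e A = A"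
  by (induction A arbitrary: e) (auto simp: msub_id)

lemma wff_mfm: "(\<And>v. tyof (e v) = Some (snd v)) \<Longrightarrow> wff (mfm e A) = wff A"
  by (induction A arbitrary: e) (auto simp: tyof_msub)

lemma fv_mfm: "fv (mfm e A) \<subseteq> (\<Union>v\<in>fv A. fvt (e v))"
proof (induction A arbitrary: e)
  case (Imp A B)
  show ?case using Imp.IH(1)[of e] Imp.IH(2)[of e] by (simp add: UN_Un) blast
next
  case (All w A)
  show ?case using All.IH[of "e(w := Var w)"] by (fastforce split: if_splits)
qed (simp_all add: fvt_msub UN_Un)

definition ctermenv :: "(var \<Rightarrow> trm) \<Rightarrow> bool" where
  "ctermenv e \<longleftrightarrow> (\<forall>v. cterm (snd v) (e v))"

lemma ctermenv_upd [simp]: "ctermenv e \<Longrightarrow> cterm (snd v) t \<Longrightarrow> ctermenv (e(v := t))"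
  by (simp add: ctermenv_def)

lemma sentence_mfm: "ctermenv e \<Longrightarrow> wff A \<Longrightarrow> sentence (mfm e A)"
  using fv_mfm[of e A] by (auto simp: sentence_def wff_mfm ctermenv_def cterm_def)

lemma cterm_msub: "ctermenv e \<Longrightarrow> tyof t = Some \<tau> \<Longrightarrow> cterm \<tau> (msub e t)"
  by (auto simp: cterm_def ctermenv_def tyof_msub fvt_msub)

lemma msub_monus [simp]: "msub e (monus t u) = monus (msub e t) (msub e u)"
  by (simp add: monus_def const_def predf_def idN_def Let_def)

lemma mfm_leF [simp]: "mfm e (t \<^bold>\<le> u) = (msub e t \<^bold>\<le> msub e u)" by (simp add: leF_def)
lemma mfm_ltF [simp]: "mfm e (t \<^bold>< u) = (msub e t \<^bold>< msub e u)" by (simp add: ltF_def)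
lemma mfm_Neg [simp]: "mfm e (\<^bold>\<not> A) = (\<^bold>\<not> mfm e A)" by (simp add: Neg_def)
lemma mfm_Conj [simp]: "mfm e (A \<^bold>\<and> B) = (mfm e A \<^bold>\<and> mfm e B)" by (simp add: Conj_def)

lemma cterm_zerot: "cterm \<tau> (zerot \<tau>)"
  by (induction \<tau>) (auto simp: const_def cterm_def)

lemma pars_eqF [simp]: "pars (eqF \<tau> t u) = parst t \<union> parst u"
  by (induction \<tau> arbitrary: t u)
    (auto simp: Let_def BAlll_def Conj_def Neg_def ltF_def leF_def monus_def const_def predf_def idN_def)

section \<open>Provable equality and the model of its classes\<close>

locale henkin_theory = henkin +
  assumes EPRA: "EPRA \<subseteq> \<Gamma>"
begin

lemma T_mfm_Imp: "ctermenv e \<Longrightarrow> wff A \<Longrightarrow> wff B \<Longrightarrow>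
    T (mfm e A \<^bold>\<longrightarrow> mfm e B) \<longleftrightarrow> (T (mfm e A) \<longrightarrow> T (mfm e B))"
  by (simp add: T_Imp sentence_mfm)

lemma T_mfm_All:
  assumes "ctermenv e" "wff A"
  shows "T (mfm e (All v A)) \<longleftrightarrow> (\<forall>t. cterm (snd v) t \<longrightarrow> T (mfm (e(v := t)) A))"
proof -
  have "subst v t (mfm (e(v := Var v)) A) = mfm (e(v := t)) A" for t
    using assms by (subst subst_mfm) (auto simp: ctermenv_def cterm_def)
  moreover have "sentence (mfm e (All v A))" using assms by (intro sentence_mfm) auto
  ultimately show ?thesis using T_All[of v "mfm (e(v := Var v)) A"] by simp
qed

lemma T_Neg: "sentence A \<Longrightarrow> T (\<^bold>\<not> A) \<longleftrightarrow> \<not> T A"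
  by (simp add: Neg_def T_Imp)

lemma T_Conj: "sentence A \<Longrightarrow> sentence B \<Longrightarrow> T (A \<^bold>\<and> B) \<longleftrightarrow> T A \<and> T B"
  by (simp add: Conj_def T_Neg T_Imp)

lemma T_Alls: "T (mfm e (Alls vs A)) \<Longrightarrow> ctermenv e \<Longrightarrow> wff A \<Longrightarrow> T (mfm e A)"
proof (induction vs)
  case (Cons v vs)
  have w: "wff (Alls vs A)" using Cons.prems(3) by (induction vs) auto
  have "cterm (snd v) (e v)" using Cons.prems by (simp add: ctermenv_def)
  then have "T (mfm (e(v := e v)) (Alls vs A))"
    using Cons.prems w T_mfm_All[of e "Alls vs A" v] by auto
  then show ?case using Cons by simp
qed simp

lemma T_closures:
  assumes "A \<in> X" "closures X \<subseteq> \<Gamma>" "wff A" "pars A = {}" "ctermenv e"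
  shows "T (mfm e A)"
proof -
  have "finite (fv A)" by (induction A) auto
  then obtain vs where vs: "set vs = fv A" using finite_list by blast
  then have B: "Alls vs A \<in> closures X" using assms by (auto simp: closures_def)
  then have "mfm e (Alls vs A) = Alls vs A"
    using sentence_closures[OF B] by (intro mfm_id) (auto simp: sentence_def)
  then have "T (mfm e (Alls vs A))" using B assms(2) T_Ax by auto
  then show ?thesis using T_Alls assms by blast
qed

text \<open>What truth of \<open>eqF\<close> means for closed terms, with quantifiers over fresh
  variables turned into quantifiers over terms.\<close>

fun EQ :: "ty \<Rightarrow> trm \<Rightarrow> trm \<Rightarrow> bool" where
  "EQ N t u \<longleftrightarrow> T (t \<^bold>= u)"
| "EQ (\<sigma> \<rightarrowtail> \<tau>) t u \<longleftrightarrow> (\<forall>s. cterm \<sigma> s \<longrightarrow> EQ \<tau> (t \<cdot> s) (u \<cdot> s))"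
| "EQ (Seq \<sigma>) t u \<longleftrightarrow> T (len \<sigma> t \<^bold>= len \<sigma> u) \<and>
     (\<forall>i. cterm N i \<longrightarrow> T (i \<^bold>< len \<sigma> t) \<longrightarrow> EQ \<sigma> (at \<sigma> t i) (at \<sigma> u i))"

lemma msub_fresh [simp]: "v \<notin> fvt t \<Longrightarrow> msub (e(v := s)) t = msub e t"
  by (rule msub_cong) auto

lemma T_eqF:
  "ctermenv e \<Longrightarrow> tyof t = Some \<tau> \<Longrightarrow> tyof u = Some \<tau> \<Longrightarrow>
    T (mfm e (eqF \<tau> t u)) \<longleftrightarrow> EQ \<tau> (msub e t) (msub e u)"
proof (induction \<tau> arbitrary: e t u)
  case N
  then show ?case by simp
next
  case (Fun \<sigma> \<tau>)
  let ?v = "(fresh t u, \<sigma>)"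
  have "T (mfm e (eqF (\<sigma> \<rightarrowtail> \<tau>) t u)) \<longleftrightarrow>
      (\<forall>s. cterm \<sigma> s \<longrightarrow> T (mfm (e(?v := s)) (eqF \<tau> (t \<cdot> Var ?v) (u \<cdot> Var ?v))))"
    using Fun.prems T_mfm_All[of e "eqF \<tau> (t \<cdot> Var ?v) (u \<cdot> Var ?v)" ?v]
    by (simp add: Let_def del: mfm.simps)
  also have "\<dots> \<longleftrightarrow> EQ (\<sigma> \<rightarrowtail> \<tau>) (msub e t) (msub e u)"
  proof -
    have "T (mfm (e(?v := s)) (eqF \<tau> (t \<cdot> Var ?v) (u \<cdot> Var ?v))) \<longleftrightarrow> EQ \<tau> (msub e t \<cdot> s) (msub e u \<cdot> s)"
      if "cterm \<sigma> s" for s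
      by (subst Fun.IH(2)) (use that Fun.prems in simp_all)
    then show ?thesis by simp
  qed
  finally show ?case .
next
  case (Seq \<sigma>)
  let ?v = "(fresh t u, N)"
  let ?A = "eqF \<sigma> (at \<sigma> t (Var ?v)) (at \<sigma> u (Var ?v))"
  have w: "wff ?A" using Seq.prems by simp
  have IH: "T (mfm (e(?v := i)) ?A) \<longleftrightarrow> EQ \<sigma> (at \<sigma> (msub e t) i) (at \<sigma> (msub e u) i)"
    if "cterm N i" for i
    by (subst Seq.IH) (use that Seq.prems in simp_all)
  have "T (mfm e (eqF (Seq \<sigma>) t u)) \<longleftrightarrow>
      T (mfm e (len \<sigma> t \<^bold>= len \<sigma> u)) \<and> T (mfm e (BAlll ?v (len \<sigma> t) ?A))"
    unfolding eqF.simps Let_def mfm_Conj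
    using Seq.prems w by (intro T_Conj sentence_mfm) auto
  also have "T (mfm e (BAlll ?v (len \<sigma> t) ?A)) \<longleftrightarrow>
      (\<forall>i. cterm N i \<longrightarrow> T (mfm (e(?v := i)) ((Var ?v \<^bold>< len \<sigma> t) \<^bold>\<longrightarrow> ?A)))"
    unfolding BAlll_def using Seq.prems w by (subst T_mfm_All) auto
  also have "\<dots> \<longleftrightarrow> (\<forall>i. cterm N i \<longrightarrow> T (mfm (e(?v := i)) (Var ?v \<^bold>< len \<sigma> t)) \<longrightarrow>
      T (mfm (e(?v := i)) ?A))"
    using Seq.prems w by (auto simp: T_mfm_Imp simp del: mfm_ltF)
  finally show ?case using Seq.prems IH by simp
qed

lemma T_EPRA: "A \<in> EPRA_schemata \<Longrightarrow> wff A \<Longrightarrow> pars A = {} \<Longrightarrow> ctermenv e \<Longrightarrow> T (mfm e A)"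
  using T_closures EPRA unfolding EPRA_def by blast

definition zenv :: "var \<Rightarrow> trm" where "zenv v = zerot (snd v)"

lemma ctermenv_zenv [simp]: "ctermenv zenv"
  by (simp add: ctermenv_def zenv_def cterm_zerot)

lemma eq_refl: "cterm N t \<Longrightarrow> T (t \<^bold>= t)"
  using T_EPRA[OF EPRA_schemata.eq_refl[of "Var (''a'', N)"], of "zenv((''a'', N) := t)"] by simp

lemma cterm_wff: "cterm N t \<Longrightarrow> cterm N u \<Longrightarrow> sentence (t \<^bold>= u)"
  by (auto simp: sentence_def cterm_def)

lemma eq_eucl: "cterm N t \<Longrightarrow> cterm N u \<Longrightarrow> cterm N s \<Longrightarrow> T (t \<^bold>= u) \<Longrightarrow> T (t \<^bold>= s) \<Longrightarrow> T (u \<^bold>= s)"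
  using T_EPRA[OF EPRA_schemata.eq_eucl[of "Var (''a'', N)" "Var (''b'', N)" "Var (''c'', N)"],
      of "zenv((''a'', N) := t, (''b'', N) := u, (''c'', N) := s)"]
  by (simp add: T_Imp cterm_wff)

text \<open>This is the extensionality axiom; it lets application respect the classes in the
  argument.\<close>

lemma EQ_ap:
  assumes "cterm (\<sigma> \<rightarrowtail> \<tau>) f" "cterm \<sigma> t" "cterm \<sigma> u" "EQ \<sigma> t u"
  shows "EQ \<tau> (f \<cdot> t) (f \<cdot> u)"
proof -
  let ?f = "Var (''f'', \<sigma> \<rightarrowtail> \<tau>)" and ?a = "Var (''a'', \<sigma>)" and ?b = "Var (''b'', \<sigma>)"
  let ?e = "zenv((''f'', \<sigma> \<rightarrowtail> \<tau>) := f, (''a'', \<sigma>) := t, (''b'', \<sigma>) := u)"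
  have e: "ctermenv ?e" using assms by simp
  have "T (mfm ?e (eqF \<sigma> ?a ?b \<^bold>\<longrightarrow> eqF \<tau> (?f \<cdot> ?a) (?f \<cdot> ?b)))"
    by (rule T_EPRA[OF EPRA_schemata.extensionality]) (use e in auto)
  then show ?thesis using e assms by (simp add: T_mfm_Imp T_eqF)
qed

lemma eq_sym: "cterm N t \<Longrightarrow> cterm N u \<Longrightarrow> T (t \<^bold>= u) \<Longrightarrow> T (u \<^bold>= t)"
  using eq_eucl eq_refl by blast

lemma eq_trans: "cterm N t \<Longrightarrow> cterm N u \<Longrightarrow> cterm N s \<Longrightarrow> T (t \<^bold>= u) \<Longrightarrow> T (u \<^bold>= s) \<Longrightarrow> T (t \<^bold>= s)"
  using eq_eucl eq_sym by blast

text \<open>Equality of sequences bounds its index by the length of the left one, so symmetry and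
  transitivity need the bound replaced by an equal number. The bound is the recursion argument of
  the subtraction term, and extensionality is applied to \<open>Con Rec\<close>.\<close>

lemma lt_cong:
  assumes "cterm N i" "cterm N t" "cterm N u" "T (t \<^bold>= u)" "T (i \<^bold>< t)"
  shows "T (i \<^bold>< u)"
proof -
  obtain V where V: "\<And>t u. monus t u = Con Rec \<cdot> u \<cdot> t \<cdot> V"
    "cterm (N \<rightarrowtail> N \<rightarrowtail> N) V"
    by (auto simp: monus_def const_def predf_def idN_def Let_def cterm_def)
  have "EQ (N \<rightarrowtail> (N \<rightarrowtail> N \<rightarrowtail> N) \<rightarrowtail> N) (Con Rec \<cdot> t) (Con Rec \<cdot> u)"
    by (rule EQ_ap[where \<sigma> = N]) (use assms in auto)
  then have "EQ N (monus (suc i) t) (monus (suc i) u)"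
    using assms V cterm_App[of N N "Con Succ" i] by simp
  moreover have "cterm N (monus (suc i) t)" "cterm N (monus (suc i) u)" "cterm N zero"
    using assms by (simp_all add: cterm_def)
  ultimately have "T (monus (suc i) u \<^bold>= zero)"
    using eq_eucl[of "monus (suc i) t" "monus (suc i) u" zero] assms(5)
    by (simp add: ltF_def leF_def)
  then show ?thesis by (simp add: ltF_def leF_def)
qed

lemma EQ_equiv:
  "(cterm \<tau> t \<longrightarrow> EQ \<tau> t t) \<and>
   (cterm \<tau> t \<longrightarrow> cterm \<tau> u \<longrightarrow> EQ \<tau> t u \<longrightarrow> EQ \<tau> u t) \<and>
   (cterm \<tau> t \<longrightarrow> cterm \<tau> u \<longrightarrow> cterm \<tau> s \<longrightarrow> EQ \<tau> t u \<longrightarrow> EQ \<tau> u s \<longrightarrow> EQ \<tau> t s)"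
proof (induction \<tau> arbitrary: t u s)
  case N
  show ?case unfolding EQ.simps by (intro conjI impI) (fact eq_refl, fact eq_sym, fact eq_trans)
next
  case (Fun \<sigma> \<tau>)
  have "cterm (\<sigma> \<rightarrowtail> \<tau>) f \<Longrightarrow> cterm \<sigma> a \<Longrightarrow> cterm \<tau> (f \<cdot> a)" for f a by (rule cterm_App)
  note c = this
  show ?case
    unfolding EQ.simps
  proof (intro conjI impI allI)
    show "EQ \<tau> (t \<cdot> a) (t \<cdot> a)" if "cterm (\<sigma> \<rightarrowtail> \<tau>) t" "cterm \<sigma> a" for a
      using Fun.IH(2) c that by blast
    show "EQ \<tau> (u \<cdot> a) (t \<cdot> a)" if "cterm (\<sigma> \<rightarrowtail> \<tau>) t" "cterm (\<sigma> \<rightarrowtail> \<tau>) u"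
      "\<forall>a. cterm \<sigma> a \<longrightarrow> EQ \<tau> (t \<cdot> a) (u \<cdot> a)" "cterm \<sigma> a" for a
      using Fun.IH(2)[of "t \<cdot> a" "u \<cdot> a"] c that by simp
    show "EQ \<tau> (t \<cdot> a) (s \<cdot> a)" if "cterm (\<sigma> \<rightarrowtail> \<tau>) t" "cterm (\<sigma> \<rightarrowtail> \<tau>) u" "cterm (\<sigma> \<rightarrowtail> \<tau>) s"
      "\<forall>a. cterm \<sigma> a \<longrightarrow> EQ \<tau> (t \<cdot> a) (u \<cdot> a)" "\<forall>a. cterm \<sigma> a \<longrightarrow> EQ \<tau> (u \<cdot> a) (s \<cdot> a)"
      "cterm \<sigma> a" for a
      using Fun.IH(2)[of "t \<cdot> a" "u \<cdot> a" "s \<cdot> a"] c that by simp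
  qed
next
  case (Seq \<sigma>)
  have l: "cterm N (len \<sigma> a)" "cterm N i \<Longrightarrow> cterm \<sigma> (at \<sigma> a i)" if "cterm (Seq \<sigma>) a" for a i
    using that by (auto simp: cterm_def)
  have IH: "cterm \<sigma> a \<Longrightarrow> EQ \<sigma> a a"
    "cterm \<sigma> a \<Longrightarrow> cterm \<sigma> b \<Longrightarrow> EQ \<sigma> a b \<Longrightarrow> EQ \<sigma> b a"
    "cterm \<sigma> a \<Longrightarrow> cterm \<sigma> b \<Longrightarrow> cterm \<sigma> c \<Longrightarrow> EQ \<sigma> a b \<Longrightarrow> EQ \<sigma> b c \<Longrightarrow> EQ \<sigma> a c"
    for a b c using Seq.IH[of a b c] by simp_all
  have "EQ (Seq \<sigma>) t t" if t: "cterm (Seq \<sigma>) t"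
  proof -
    have "EQ \<sigma> (at \<sigma> t i) (at \<sigma> t i)" if "cterm N i" for i using l(2)[OF t that] by (rule IH)
    then show ?thesis using l(1)[OF t] by (simp add: eq_refl)
  qed
  moreover have "EQ (Seq \<sigma>) u t"
    if tu: "cterm (Seq \<sigma>) t" "cterm (Seq \<sigma>) u" "EQ (Seq \<sigma>) t u"
  proof -
    have L: "T (len \<sigma> u \<^bold>= len \<sigma> t)" by (rule eq_sym[OF l(1)[OF tu(1)] l(1)[OF tu(2)]]) (use tu(3) in simp)
    have "EQ \<sigma> (at \<sigma> u i) (at \<sigma> t i)" if i: "cterm N i" "T (i \<^bold>< len \<sigma> u)" for i
    proof -
      have "T (i \<^bold>< len \<sigma> t)" using lt_cong[OF i(1) l(1)[OF tu(2)] l(1)[OF tu(1)] L i(2)] .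
      then have "EQ \<sigma> (at \<sigma> t i) (at \<sigma> u i)" using tu i by simp
      then show ?thesis by (rule IH(2)[OF l(2)[OF tu(1) i(1)] l(2)[OF tu(2) i(1)]])
    qed
    then show ?thesis using L by simp
  qed
  moreover have "EQ (Seq \<sigma>) t s"
    if tus: "cterm (Seq \<sigma>) t" "cterm (Seq \<sigma>) u" "cterm (Seq \<sigma>) s"
      "EQ (Seq \<sigma>) t u" "EQ (Seq \<sigma>) u s"
  proof -
    have c: "cterm N (len \<sigma> t)" "cterm N (len \<sigma> u)" "cterm N (len \<sigma> s)"
      using l(1)[OF tus(1)] l(1)[OF tus(2)] l(1)[OF tus(3)] .
    have L: "T (len \<sigma> t \<^bold>= len \<sigma> u)" using tus by simp
    have "T (len \<sigma> t \<^bold>= len \<sigma> s)" by (rule eq_trans[OF c L]) (use tus in simp)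
    moreover have "EQ \<sigma> (at \<sigma> t i) (at \<sigma> s i)" if i: "cterm N i" "T (i \<^bold>< len \<sigma> t)" for i
    proof -
      have "T (i \<^bold>< len \<sigma> u)" using lt_cong[OF i(1) c(1,2) L i(2)] .
      then have "EQ \<sigma> (at \<sigma> t i) (at \<sigma> u i)" "EQ \<sigma> (at \<sigma> u i) (at \<sigma> s i)" using tus i by simp_all
      then show ?thesis
        by (rule IH(3)[OF l(2)[OF tus(1) i(1)] l(2)[OF tus(2) i(1)] l(2)[OF tus(3) i(1)]])
    qed
    ultimately show ?thesis by simp
  qed
  ultimately show ?case by blast
qed

lemma EQ_refl: "cterm \<tau> t \<Longrightarrow> EQ \<tau> t t"
  and EQ_sym: "cterm \<tau> t \<Longrightarrow> cterm \<tau> u \<Longrightarrow> EQ \<tau> t u \<Longrightarrow> EQ \<tau> u t"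
  and EQ_trans: "cterm \<tau> t \<Longrightarrow> cterm \<tau> u \<Longrightarrow> cterm \<tau> s \<Longrightarrow> EQ \<tau> t u \<Longrightarrow> EQ \<tau> u s \<Longrightarrow> EQ \<tau> t s"
  using EQ_equiv by blast+

text \<open>An object of the canonical model is a type with a chosen term of its class of equal terms.\<close>

definition nf :: "ty \<Rightarrow> trm \<Rightarrow> trm" where
  "nf \<tau> t = (SOME u. cterm \<tau> u \<and> EQ \<tau> t u)"

lemma nf: assumes "cterm \<tau> t" shows "cterm \<tau> (nf \<tau> t)" "EQ \<tau> t (nf \<tau> t)"
  using someI[of "\<lambda>u. cterm \<tau> u \<and> EQ \<tau> t u" t] assms EQ_refl unfolding nf_def by auto

lemma nf_eq_iff: assumes "cterm \<tau> t" "cterm \<tau> u" shows "nf \<tau> t = nf \<tau> u \<longleftrightarrow> EQ \<tau> t u"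
proof
  assume "nf \<tau> t = nf \<tau> u"
  then show "EQ \<tau> t u" using nf assms EQ_sym EQ_trans by metis
next
  assume "EQ \<tau> t u"
  then have "(cterm \<tau> s \<and> EQ \<tau> t s) = (cterm \<tau> s \<and> EQ \<tau> u s)" for s
    using assms EQ_sym EQ_trans by metis
  then show "nf \<tau> t = nf \<tau> u" unfolding nf_def by metis
qed

definition mel :: "ty \<times> trm \<Rightarrow> bool" where
  "mel d \<longleftrightarrow> cterm (fst d) (snd d) \<and> nf (fst d) (snd d) = snd d"

definition cls :: "ty \<Rightarrow> trm \<Rightarrow> ty \<times> trm" where
  "cls \<tau> t = (\<tau>, nf \<tau> t)"

definition map_ap :: "ty \<times> trm \<Rightarrow> ty \<times> trm \<Rightarrow> ty \<times> trm" where
  "map_ap d a = cls (cod (fst d)) (snd d \<cdot> snd a)"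

definition mcn :: "con \<Rightarrow> ty \<times> trm" where "mcn c = cls (contype c) (Con c)"
definition mpr :: "nat \<Rightarrow> ty \<Rightarrow> ty \<times> trm" where "mpr a \<tau> = cls \<tau> (Par a \<tau>)"
definition mst :: "ty \<times> trm \<Rightarrow> bool" where "mst d \<longleftrightarrow> T (St (snd d))"

lemma nf_nf: "cterm \<tau> t \<Longrightarrow> nf \<tau> (nf \<tau> t) = nf \<tau> t"
  by (subst nf_eq_iff) (simp_all add: nf EQ_sym)

lemma mel_cls: "cterm \<tau> t \<Longrightarrow> mel (cls \<tau> t)"
  by (simp add: mel_def cls_def nf nf_nf)

lemma mel_cases: assumes "mel d" "fst d = \<tau>" obtains t where "cterm \<tau> t" "d = cls \<tau> t"
  using assms by (metis cls_def mel_def prod.collapse)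

lemma cls_eq_iff: "cterm \<tau> t \<Longrightarrow> cterm \<tau> u \<Longrightarrow> cls \<tau> t = cls \<tau> u \<longleftrightarrow> EQ \<tau> t u"
  by (simp add: cls_def nf_eq_iff)

text \<open>Independence of the chosen terms: for the function by the definition of
  \<open>EQ\<close>, for the argument by extensionality.\<close>

lemma map_ap_cls: assumes "cterm (\<sigma> \<rightarrowtail> \<tau>) f" "cterm \<sigma> a"
  shows "map_ap (cls (\<sigma> \<rightarrowtail> \<tau>) f) (cls \<sigma> a) = cls \<tau> (f \<cdot> a)"
proof -
  let ?f = "nf (\<sigma> \<rightarrowtail> \<tau>) f" and ?a = "nf \<sigma> a"
  have c: "cterm \<tau> (f \<cdot> a)" "cterm \<tau> (?f \<cdot> a)" "cterm \<tau> (?f \<cdot> ?a)" using nf assms by auto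
  have "EQ \<tau> (f \<cdot> a) (?f \<cdot> a)" using nf(2)[OF assms(1)] assms(2) by simp
  moreover have "EQ \<tau> (?f \<cdot> a) (?f \<cdot> ?a)" using nf assms by (intro EQ_ap[of \<sigma>]) auto
  ultimately have "EQ \<tau> (f \<cdot> a) (?f \<cdot> ?a)" using c EQ_trans by blast
  then show ?thesis using c EQ_sym by (simp add: map_ap_def cls_def nf_eq_iff)
qed

sublocale M: pre_model mel fst map_ap mcn mpr mst .

lemma ev_cls:
  "ctermenv e \<Longrightarrow> tyof t = Some \<tau> \<Longrightarrow> M.ev (\<lambda>v. cls (snd v) (e v)) t = cls \<tau> (msub e t)"
proof (induction t arbitrary: \<tau>)
  case (App t u)
  then obtain \<sigma> where \<sigma>: "tyof t = Some (\<sigma> \<rightarrowtail> \<tau>)" "tyof u = Some \<sigma>"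
    by (auto split: option.splits ty.splits if_splits)
  then show ?case using App by (simp add: map_ap_cls cterm_msub)
qed (auto simp: mpr_def mcn_def)

lemma mon_cls:
  assumes "cterm N a" "cterm N b"
  shows "M.mon (cls N a) (cls N b) = cls N (monus a b)"
proof -
  let ?a = "Var (''a'', N)" and ?b = "Var (''b'', N)"
  let ?e = "zenv((''a'', N) := a, (''b'', N) := b)"
  have "ctermenv ?e" using assms by simp
  from ev_cls[OF this, of "monus ?a ?b" N] show ?thesis by simp
qed

lemma le_cls: "cterm N a \<Longrightarrow> cterm N b \<Longrightarrow> M.le (cls N a) (cls N b) \<longleftrightarrow> T (a \<^bold>\<le> b)"
  by (simp add: mon_cls mcn_def leF_def)
    (subst cls_eq_iff; auto simp: cterm_def)

text \<open>The extensionality conditions hold because every object is the class of a closed term,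
  and closed terms are what \<open>EQ\<close> quantifies over.\<close>

sublocale M: normal_model mel fst map_ap mcn mpr mst
proof unfold_locales
  fix f a :: "ty \<times> trm"
  assume "mel f" "mel a" "fst f = fst a \<rightarrowtail> cod (fst f)"
  then show "mel (map_ap f a)" unfolding map_ap_def by (metis cterm_App mel_cls mel_def)
next
  show "fst (map_ap f a) = cod (fst f)" for f a by (simp add: map_ap_def cls_def)
  show "mel (mcn c)" for c by (simp add: mcn_def mel_cls)
  show "fst (mcn c) = contype c" for c by (simp add: mcn_def cls_def)
  show "mel (mpr a \<tau>)" for a \<tau> by (simp add: mpr_def mel_cls)
  show "fst (mpr a \<tau>) = \<tau>" for a \<tau> by (simp add: mpr_def cls_def)
next
  fix f g :: "ty \<times> trm" and \<sigma> \<tau>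
  assume *: "mel f" "mel g" "fst f = \<sigma> \<rightarrowtail> \<tau>" "fst g = \<sigma> \<rightarrowtail> \<tau>"
    "\<And>a. mel a \<Longrightarrow> fst a = \<sigma> \<Longrightarrow> map_ap f a = map_ap g a"
  obtain t where t: "cterm (\<sigma> \<rightarrowtail> \<tau>) t" "f = cls (\<sigma> \<rightarrowtail> \<tau>) t" using *(1,3) by (rule mel_cases)
  obtain u where u: "cterm (\<sigma> \<rightarrowtail> \<tau>) u" "g = cls (\<sigma> \<rightarrowtail> \<tau>) u" using *(2,4) by (rule mel_cases)
  have "EQ \<tau> (t \<cdot> s) (u \<cdot> s)" if "cterm \<sigma> s" for s
    using *(5)[of "cls \<sigma> s"] that t u
    by (simp add: mel_cls map_ap_cls cls_eq_iff cterm_App) (simp add: cls_def)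
  then show "f = g" using t u by (simp add: cls_eq_iff)
next
  fix s r :: "ty \<times> trm" and \<sigma>
  assume *: "mel s" "mel r" "fst s = Seq \<sigma>" "fst r = Seq \<sigma>"
    "map_ap (mcn (Len \<sigma>)) s = map_ap (mcn (Len \<sigma>)) r"
    "\<And>i. mel i \<Longrightarrow> fst i = N \<Longrightarrow> M.le (map_ap (mcn Succ) i) (map_ap (mcn (Len \<sigma>)) s) \<Longrightarrow>
          map_ap (map_ap (mcn (At \<sigma>)) s) i = map_ap (map_ap (mcn (At \<sigma>)) r) i"
  obtain t where t: "cterm (Seq \<sigma>) t" "s = cls (Seq \<sigma>) t" using *(1,3) by (rule mel_cases)
  obtain u where u: "cterm (Seq \<sigma>) u" "r = cls (Seq \<sigma>) u" using *(2,4) by (rule mel_cases)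
  have l: "map_ap (mcn (Len \<sigma>)) (cls (Seq \<sigma>) a) = cls N (len \<sigma> a)" "cterm N (len \<sigma> a)"
    "cterm N i \<Longrightarrow> map_ap (map_ap (mcn (At \<sigma>)) (cls (Seq \<sigma>) a)) (cls N i) = cls \<sigma> (at \<sigma> a i)"
    "cterm N i \<Longrightarrow> cterm \<sigma> (at \<sigma> a i)"
    "cterm N i \<Longrightarrow> map_ap (mcn Succ) (cls N i) = cls N (suc i)"
    if "cterm (Seq \<sigma>) a" for a i
    using that by (auto simp: mcn_def map_ap_cls) (auto simp: cterm_def map_ap_cls)
  have "EQ \<sigma> (at \<sigma> t i) (at \<sigma> u i)" if i: "cterm N i" "T (i \<^bold>< len \<sigma> t)" for i
  proof -
    have "M.le (map_ap (mcn Succ) (cls N i)) (map_ap (mcn (Len \<sigma>)) s)"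
      using i l[OF t(1)] t unfolding ltF_def
      by (simp add: le_cls) (subst le_cls; auto simp: cterm_def)
    then have "cls \<sigma> (at \<sigma> t i) = cls \<sigma> (at \<sigma> u i)"
      using *(6)[of "cls N i"] i t u l by (auto simp: mel_cls) (auto simp: cls_def)
    then show ?thesis using l t u i by (simp add: cls_eq_iff)
  qed
  moreover have "T (len \<sigma> t \<^bold>= len \<sigma> u)" using *(5) t u l by (simp add: cls_eq_iff)
  ultimately show "s = r" using t u by (simp add: cls_eq_iff)
qed

text \<open>The model judges standardness at the chosen term of a class, so the case
  \<open>St\<close> needs \<open>st_eq\<close> to return to the given term.\<close>

lemma truth:
  assumes "internal A \<or> closures st_schemata \<subseteq> \<Gamma>"
  shows "wff A \<Longrightarrow> ctermenv e \<Longrightarrow> M.sat (\<lambda>v. cls (snd v) (e v)) A \<longleftrightarrow> T (mfm e A)"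
  using assms
proof (induction A arbitrary: e)
  case (Eq t u)
  then show ?case using cterm_msub[OF Eq(2)] by (simp add: ev_cls cls_eq_iff)
next
  case (St t)
  then obtain \<tau> where \<tau>: "tyof t = Some \<tau>" by auto
  let ?t = "msub e t"
  let ?n = "nf \<tau> ?t"
  have c: "cterm \<tau> ?t" "cterm \<tau> ?n" using \<tau> St cterm_msub nf by auto
  have "T (St b)" if ab: "cterm \<tau> a" "cterm \<tau> b" "EQ \<tau> a b" "T (St a)" for a b
  proof -
    let ?a = "Var (''a'', \<tau>)" and ?b = "Var (''b'', \<tau>)"
    let ?e = "zenv((''a'', \<tau>) := a, (''b'', \<tau>) := b)"
    have "T (mfm ?e (St ?a \<^bold>\<longrightarrow> eqF \<tau> ?a ?b \<^bold>\<longrightarrow> St ?b))"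
      by (rule T_closures[OF st_schemata.st_eq]) (use St.prems ab in auto)
    then show ?thesis using ab T_MP T_eqF[of ?e ?a \<tau> ?b] by (auto dest: T_MP)
  qed
  from this[of ?t ?n] this[of ?n ?t] have "T (St ?n) \<longleftrightarrow> T (St ?t)"
    using c nf(2)[OF c(1)] EQ_sym[OF c nf(2)[OF c(1)]] by metis
  then show ?case using \<tau> St by (simp add: ev_cls) (simp add: mst_def cls_def)
next
  case (Imp A B)
  then show ?case by (auto simp: T_mfm_Imp)
next
  case (All v A)
  have "M.sat (\<lambda>v. cls (snd v) (e v)) (All v A) \<longleftrightarrow>
      (\<forall>t. cterm (snd v) t \<longrightarrow> M.sat ((\<lambda>v. cls (snd v) (e v))(v := cls (snd v) t)) A)"
    using mel_cls by (auto elim!: mel_cases) (auto simp: cls_def)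
  also have "\<dots> \<longleftrightarrow> (\<forall>t. cterm (snd v) t \<longrightarrow> M.sat (\<lambda>w. cls (snd w) ((e(v := t)) w)) A)"
    by (intro all_cong arg_cong2[of _ _ _ _ M.sat]) (auto simp: fun_eq_iff)
  also have "\<dots> \<longleftrightarrow> (\<forall>t. cterm (snd v) t \<longrightarrow> T (mfm (e(v := t)) A))"
    using All.IH[of "e(v := t)" for t] All.prems by (simp del: fun_upd_apply cong: imp_cong)
  also have "\<dots> \<longleftrightarrow> T (mfm e (All v A))" using All.prems T_mfm_All by auto
  finally show ?case .
qed auto

end

text \<open>
  Unless the axiom \<open>st_eq\<close> is present, standardness need not respect equality and only
  internal formulas have a meaning for the identified objects.
\<close>

theorem completeness:
  assumes \<Gamma>: "\<And>B. B \<in> \<Gamma> \<Longrightarrow> sentence B" "finite (parset \<Gamma>)" "EPRA \<subseteq> \<Gamma>" and A: "sentence A"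
    and st: "closures st_schemata \<subseteq> \<Gamma> \<or> (\<forall>B\<in>insert A \<Gamma>. internal B)"
    and valid: "\<And>el ap cn pr st e. normal_model el fst ap cn pr \<Longrightarrow>
      pre_model.wt el fst e \<Longrightarrow>
      (\<And>B e. B \<in> \<Gamma> \<Longrightarrow> pre_model.sat el fst ap cn pr st e B) \<Longrightarrow>
      pre_model.sat el fst ap cn pr st (e :: var \<Rightarrow> ty \<times> trm) A"
  shows "\<Gamma> \<turnstile> A"
proof (rule ccontr)
  assume "\<not> (\<Gamma> \<turnstile> A)"
  then have cons: "\<not> (insert (\<^bold>\<not> A) \<Gamma> \<turnstile> \<^bold>\<bottom>)" using A by (blast intro: Raa)
  interpret henkin_theory "insert (\<^bold>\<not> A) \<Gamma>"
    by unfold_locales (use cons \<Gamma> in auto)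
  let ?e = "\<lambda>v. cls (snd v) (zenv v)"
  have iff: "M.sat e B \<longleftrightarrow> T B"
    if "sentence B" "internal B \<or> closures st_schemata \<subseteq> insert (\<^bold>\<not> A) \<Gamma>" for B e
  proof -
    have "M.sat e B \<longleftrightarrow> M.sat ?e B" using that by (intro M.sat_cong) (auto simp: sentence_def)
    also have "\<dots> \<longleftrightarrow> T (mfm zenv B)"
      using that by (intro truth) (auto simp: sentence_def)
    also have "mfm zenv B = B" using that by (intro mfm_id) (auto simp: sentence_def)
    finally show ?thesis .
  qed
  have "M.sat ?e A"
  proof (rule valid)
    show "normal_model mel fst map_ap mcn mpr" by unfold_locales
    show "M.wt ?e" using ctermenv_zenv unfolding ctermenv_def M.wt_def by (auto simp: mel_cls) (auto simp: cls_def)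
    show "M.sat e B" if "B \<in> \<Gamma>" for B e
      by (subst iff) (use that \<Gamma> st T_Ax in auto)
  qed
  then have "T A" using iff A st by auto
  moreover have "T (\<^bold>\<not> A)" by (auto intro: T_Ax)
  ultimately show False using A by (simp add: T_Neg)
qed

section \<open>Lambda abstraction and arithmetic in models\<close>

text \<open>Bracket abstraction; the combinators carry types, which are recovered by
  \<open>tyof\<close>. It turns every explicit definition into a term, so that the defined
  functional exists in all models.\<close>

fun lam :: "var \<Rightarrow> trm \<Rightarrow> trm" where
  "lam v (t \<cdot> u) = Con (CS (snd v) (the (tyof u)) (the (tyof (t \<cdot> u)))) \<cdot> lam v t \<cdot> lam v u"
| "lam v (Var w) = (if w = v
     then Con (CS (snd v) (snd v \<rightarrowtail> snd v) (snd v)) \<cdot> Con (CK (snd v) (snd v \<rightarrowtail> snd v))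
       \<cdot> Con (CK (snd v) (snd v))
     else const (snd w) (snd v) (Var w))"
| "lam v t = const (the (tyof t)) (snd v) t"

lemma tyof_const [simp]: "tyof t = Some \<sigma> \<Longrightarrow> tyof (const \<sigma> \<tau> t) = Some (\<tau> \<rightarrowtail> \<sigma>)"
  by (simp add: const_def)

lemma tyof_lam [simp]: "tyof t = Some \<tau> \<Longrightarrow> tyof (lam v t) = Some (snd v \<rightarrowtail> \<tau>)"
  by (induction t arbitrary: \<tau>) (auto simp: const_def split: option.splits ty.splits if_splits)

lemma fvt_const [simp]: "fvt (const \<sigma> \<tau> t) = fvt t"
  by (simp add: const_def)

lemma parst_const [simp]: "parst (const \<sigma> \<tau> t) = parst t"
  by (simp add: const_def)

lemma parst_monus [simp]: "parst (monus t u) = parst t \<union> parst u"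
  by (auto simp: monus_def const_def predf_def idN_def Let_def)

lemma fvt_lam [simp]: "fvt (lam v t) = fvt t - {v}"
  by (induction t) auto

lemma parst_lam [simp]: "parst (lam v t) = parst t"
  by (induction t) auto

declare lam.simps [simp del]

text \<open>Recursion whose step ignores its arguments: \<open>a\<close> at zero and
  \<open>b\<close> elsewhere. As comparison is a subtraction, this yields definition by cases on an
  inequality.\<close>

definition ifz :: "trm \<Rightarrow> trm \<Rightarrow> trm \<Rightarrow> trm" where
  "ifz t a b = Con Rec \<cdot> t \<cdot> a \<cdot> const (N \<rightarrowtail> N) N (const N N b)"

definition vi :: var where "vi = (''i'', N)"
definition vj :: var where "vj = (''j'', N)"

definition plus :: "trm \<Rightarrow> trm \<Rightarrow> trm" where
  "plus a b = Con Rec \<cdot> b \<cdot> a \<cdot> lam vi (lam vj (suc (Var vi)))"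

lemma tyof_ifz [simp]:
  "tyof t = Some N \<Longrightarrow> tyof a = Some N \<Longrightarrow> tyof b = Some N \<Longrightarrow> tyof (ifz t a b) = Some N"
  by (simp add: ifz_def)

lemma fvt_ifz [simp]: "fvt (ifz t a b) = fvt t \<union> fvt a \<union> fvt b"
  by (auto simp: ifz_def)

lemma parst_ifz [simp]: "parst (ifz t a b) = parst t \<union> parst a \<union> parst b"
  by (auto simp: ifz_def)

lemma tyof_plus [simp]: "tyof a = Some N \<Longrightarrow> tyof b = Some N \<Longrightarrow> tyof (plus a b) = Some N"
  by (simp add: plus_def vi_def vj_def)

lemma fvt_plus [simp]: "fvt (plus a b) = fvt a \<union> fvt b"
  by (auto simp: plus_def)

lemma parst_plus [simp]: "parst (plus a b) = parst a \<union> parst b"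
  by (auto simp: plus_def)

lemma pars_leF [simp]: "pars (t \<^bold>\<le> u) = parst t \<union> parst u" by (simp add: leF_def)
lemma pars_ltF [simp]: "pars (t \<^bold>< u) = parst t \<union> parst u" by (simp add: ltF_def)
lemma pars_Neg [simp]: "pars (\<^bold>\<not> A) = pars A" by (simp add: Neg_def)
lemma pars_Conj [simp]: "pars (A \<^bold>\<and> B) = pars A \<union> pars B" by (simp add: Conj_def)
lemma pars_Ex [simp]: "pars (Ex v A) = pars A" by (simp add: Ex_def)
lemma pars_Allst [simp]: "pars (Allst v A) = pars A" by (simp add: Allst_def)
lemma pars_Exst [simp]: "pars (Exst v A) = pars A" by (simp add: Exst_def)
lemma pars_le1 [simp]: "pars (le1 t u) = parst t \<union> parst u" by (simp add: le1_def Let_def)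
lemma pars_le01 [simp]: "pars (le01 t u) = parst t \<union> parst u" by (simp add: le01_def Let_def)
lemma pars_BExl [simp]: "pars (BExl v t A) = parst t \<union> pars A" by (simp add: BExl_def BAlll_def)
lemma pars_memF [simp]: "pars (memF \<sigma> t s) = parst t \<union> parst s"
  by (auto simp: memF_def Let_def)

lemma qfree_Neg [simp]: "qfree (\<^bold>\<not> A) = qfree A" by (simp add: Neg_def)
lemma qfree_leF [simp]: "qfree (t \<^bold>\<le> u)" by (simp add: leF_def)

context pre_model
begin

lemma ev_substt: "ev e (substt v s t) = ev (e(v := ev e s)) t"
  by (induction t) auto

text \<open>The induction axiom substitutes a term containing a variable, so capture has to be ruled
  out by the absence of quantifiers.\<close>

lemma sat_subst_qfree: "qfree A \<Longrightarrow> sat e (subst v s A) \<longleftrightarrow> sat (e(v := ev e s)) A"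
  by (induction A) (auto simp: ev_substt)

definition nt :: "'d \<Rightarrow> bool" where "nt a \<longleftrightarrow> el a \<and> ty a = N"

lemma nt_el [simp]: "nt a \<Longrightarrow> el a" and nt_ty [simp]: "nt a \<Longrightarrow> ty a = N"
  by (auto simp: nt_def)

lemma ntI: "el a \<Longrightarrow> ty a = N \<Longrightarrow> nt a"
  unfolding nt_def by blast

lemma nt_all: "(\<forall>d. el d \<longrightarrow> ty d = N \<longrightarrow> P d) \<longleftrightarrow> (\<forall>d. nt d \<longrightarrow> P d)"
  and nt_ex: "(\<exists>d. el d \<and> ty d = N \<and> P d) \<longleftrightarrow> (\<exists>d. nt d \<and> P d)"
  unfolding nt_def by blast+

end

locale epra_model = normal_model +
  assumes sat_EPRA: "B \<in> EPRA \<Longrightarrow> sat e B"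
begin

lemma sat_schema: "A \<in> EPRA_schemata \<Longrightarrow> wff A \<Longrightarrow> pars A = {} \<Longrightarrow> wt e \<Longrightarrow> sat e A"
  using sat_closures[of A EPRA_schemata] sat_EPRA unfolding EPRA_def by blast

text \<open>A well-typed assignment to start from; the objects of interest are put in by
  updates.\<close>

definition e0 :: "var \<Rightarrow> 'a" where
  "e0 v = ev (\<lambda>_. cn Zero) (zerot (snd v))"

lemma wt_e0 [simp]: "wt e0"
proof -
  have "el (ev e (zerot \<tau>)) \<and> ty (ev e (zerot \<tau>)) = \<tau>" for \<tau> e
    by (induction \<tau>) (auto simp: const_def)
  then show ?thesis by (simp add: wt_def e0_def)
qed

abbreviation "oo \<equiv> cn Zero"

section \<open>Computation rules for the constants\<close>

lemma K_eq [simp]: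
  assumes "el a" "ty a = \<sigma>" "el b" "ty b = \<tau>"
  shows "cn (CK \<sigma> \<tau>) \<bullet> a \<bullet> b = a"
proof -
  have "wt (e0((''a'', \<sigma>) := a, (''b'', \<tau>) := b))" using assms by simp
  from sat_schema[OF comb_K[of \<sigma> \<tau> "Var (''a'', \<sigma>)" "Var (''b'', \<tau>)"] _ _ this] this
  show ?thesis by simp
qed

lemma S_eq [simp]:
  assumes "el a" "ty a = \<rho> \<rightarrowtail> \<sigma> \<rightarrowtail> \<tau>" "el b" "ty b = \<rho> \<rightarrowtail> \<sigma>" "el c" "ty c = \<rho>"
  shows "cn (CS \<rho> \<sigma> \<tau>) \<bullet> a \<bullet> b \<bullet> c = a \<bullet> c \<bullet> (b \<bullet> c)"
proof -
  have "wt (e0((''a'', \<rho> \<rightarrowtail> \<sigma> \<rightarrowtail> \<tau>) := a, (''b'', \<rho> \<rightarrowtail> \<sigma>) := b, (''c'', \<rho>) := c))"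
    using assms by simp
  from sat_schema[OF comb_S[of \<tau> \<rho> \<sigma> "Var (''a'', \<rho> \<rightarrowtail> \<sigma> \<rightarrowtail> \<tau>)" "Var (''b'', \<rho> \<rightarrowtail> \<sigma>)" "Var (''c'', \<rho>)"] _ _ this] this
  show ?thesis by simp
qed

lemma Rec_0 [simp]:
  assumes "nt a" "el f" "ty f = N \<rightarrowtail> N \<rightarrowtail> N"
  shows "cn Rec \<bullet> oo \<bullet> a \<bullet> f = a"
proof -
  have "wt (e0((''a'', N) := a, (''f'', N \<rightarrowtail> N \<rightarrowtail> N) := f))" using assms by simp
  from sat_schema[OF rec_zero[of "Var (''a'', N)" "Var (''f'', N \<rightarrowtail> N \<rightarrowtail> N)"] _ _ this]
  show ?thesis by simp
qed

lemma Rec_S [simp]: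
  assumes "nt n" "nt a" "el f" "ty f = N \<rightarrowtail> N \<rightarrowtail> N"
  shows "cn Rec \<bullet> sc n \<bullet> a \<bullet> f = f \<bullet> (cn Rec \<bullet> n \<bullet> a \<bullet> f) \<bullet> n"
proof -
  have "wt (e0((''n'', N) := n, (''a'', N) := a, (''f'', N \<rightarrowtail> N \<rightarrowtail> N) := f))" using assms by simp
  from sat_schema[OF rec_suc[of "Var (''n'', N)" "Var (''a'', N)" "Var (''f'', N \<rightarrowtail> N \<rightarrowtail> N)"] _ _ this]
  show ?thesis by simp
qed

lemma S_ne_0 [simp]: assumes "nt a" shows "sc a \<noteq> oo"
proof -
  have "wt (e0((''a'', N) := a))" using assms by simp
  from sat_schema[OF suc_nonzero[of "Var (''a'', N)"] _ _ this] show ?thesis by simp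
qed

lemma S_inj [simp]: assumes "nt a" "nt b" shows "sc a = sc b \<longleftrightarrow> a = b"
proof -
  have "wt (e0((''a'', N) := a, (''b'', N) := b))" using assms by simp
  from sat_schema[OF suc_inj[of "Var (''a'', N)" "Var (''b'', N)"] _ _ this] show ?thesis by auto
qed

lemma ev_lam [simp]:
  assumes "wt e" "tyof t \<noteq> None" "el d" "ty d = snd v"
  shows "ev e (lam v t) \<bullet> d = ev (e(v := d)) t"
  using assms
proof (induction t)
  case (Var w)
  then show ?case by (auto simp: lam.simps const_def wt_def)
next
  case (App t u)
  then obtain \<sigma> \<tau> where *: "tyof t = Some (\<sigma> \<rightarrowtail> \<tau>)" "tyof u = Some \<sigma>"
    by (auto split: option.splits ty.splits if_splits)
  then have "el (ev e (lam v t))" "ty (ev e (lam v t)) = snd v \<rightarrowtail> \<sigma> \<rightarrowtail> \<tau>"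
    "el (ev e (lam v u))" "ty (ev e (lam v u)) = snd v \<rightarrowtail> \<sigma>"
    using App.prems(1) tyof_lam by (auto simp: ev_ty)
  then show ?case using App * by (simp add: lam.simps)
qed (auto simp: lam.simps const_def)

lemma ev_el' [simp]: "wt e \<Longrightarrow> tyof t \<noteq> None \<Longrightarrow> el (ev e t)"
  and ev_ty' [simp]: "wt e \<Longrightarrow> tyof t \<noteq> None \<Longrightarrow> ty (ev e t) = the (tyof t)"
  using ev_type by auto

lemma nt_0 [simp]: "nt oo" by (rule ntI) simp_all

lemma nt_ap [simp]: "el f \<Longrightarrow> el a \<Longrightarrow> ty f = ty a \<rightarrowtail> N \<Longrightarrow> nt (f \<bullet> a)"
  by (rule ntI) simp_all

lemma nt_ev [simp]: "wt e \<Longrightarrow> tyof t = Some N \<Longrightarrow> nt (ev e t)"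
  by (rule ntI) (simp_all add: ev_ty)

lemma nt_mon [simp]: "nt a \<Longrightarrow> nt b \<Longrightarrow> nt (mon a b)"
  using nt_ev[of "e0((''a'', N) := a, (''b'', N) := b)" "monus (Var (''a'', N)) (Var (''b'', N))"] by simp

text \<open>Axioms have no parameters, so the objects that \<open>P\<close> mentions enter the
  formula \<open>A\<close> as values of the assignment \<open>e\<close>.\<close>

lemma ind:
  assumes "qfree A" "wff A" "pars A = {}" "snd v = N" "wt e"
    and P: "\<And>n. nt n \<Longrightarrow> P n \<longleftrightarrow> sat (e(v := n)) A"
    and "P oo" "\<And>n. nt n \<Longrightarrow> P n \<Longrightarrow> P (sc n)" "nt n"
  shows "P n"
proof -
  have sub: "wff (subst v s A)" "pars (subst v s A) = {}"
    if "tyof s = Some N" "parst s = {}" for s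
    using that assms pars_subst[of v s A] by (auto simp: wff_subst)
  have "sat e (subst v zero A \<^bold>\<and> All v (A \<^bold>\<longrightarrow> subst v (suc (Var v)) A) \<^bold>\<longrightarrow> All v A)"
    by (rule sat_schema[OF qf_induction]) (use assms sub in simp_all)
  then have "(\<And>n. nt n \<Longrightarrow> sat (e(v := n)) A \<Longrightarrow> sat (e(v := sc n)) A) \<Longrightarrow>
      sat (e(v := oo)) A \<Longrightarrow> sat (e(v := n)) A"
    using assms by (auto simp: sat_subst_qfree nt_all)
  then show ?thesis using assms by auto
qed

section \<open>Predecessor and cut-off subtraction\<close>

definition pd :: "'a \<Rightarrow> 'a" where "pd a = ev e0 predf \<bullet> a"

lemma predf_tyof [simp]: "tyof predf = Some (N \<rightarrowtail> N)"
  by (simp add: predf_def idN_def Let_def)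

lemma nt_pd [simp]: "nt a \<Longrightarrow> nt (pd a)"
  by (simp add: pd_def)

lemma pd_0 [simp]: "pd oo = oo"
  by (simp add: pd_def predf_def idN_def Let_def const_def)

lemma pd_S [simp]: "nt a \<Longrightarrow> pd (sc a) = a"
  by (simp add: pd_def predf_def idN_def Let_def const_def)

lemma mon_eq: "mon a b = cn Rec \<bullet> b \<bullet> a
     \<bullet> (cn (CS N N (N \<rightarrowtail> N)) \<bullet> (cn (CK (N \<rightarrowtail> N \<rightarrowtail> N) N) \<bullet> (cn (CK N N))) \<bullet> ev e0 predf)"
proof -
  have "ev e predf = ev e0 predf" for e
    by (rule ev_cong) (simp add: predf_def idN_def Let_def)
  then show ?thesis unfolding mon_def monus_def by (simp add: const_def) metis
qed

lemma mon_0 [simp]: "nt a \<Longrightarrow> mon a oo = a"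
  by (simp add: mon_eq)

lemma mon_S [simp]: "nt a \<Longrightarrow> nt b \<Longrightarrow> mon a (sc b) = pd (mon a b)"
  by (simp add: mon_eq pd_def)

lemma zero_mon [simp]: "nt b \<Longrightarrow> mon oo b = oo"
  by (rule ind[where A = "monus zero (Var vn) \<^bold>= zero" and v = vn and e = e0]) (simp_all add: vn_def)

lemma mon_SS: "nt a \<Longrightarrow> nt b \<Longrightarrow> mon (sc a) (sc b) = mon a b"
  by (rule ind[where A = "monus (suc (Var vi)) (suc (Var vn)) \<^bold>= monus (Var vi) (Var vn)" and v = vn
        and e = "e0(vi := a)" and P = "\<lambda>b. mon (sc a) (sc b) = mon a b"])
    (simp_all add: vn_def vi_def)

lemma mon_self [simp]: "nt a \<Longrightarrow> mon a a = oo"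
  by (rule ind[where A = "monus (Var vn) (Var vn) \<^bold>= zero" and v = vn and e = e0])
    (simp_all add: vn_def mon_SS del: mon_S)

lemma S_pd: "nt a \<Longrightarrow> a \<noteq> oo \<Longrightarrow> a = sc (pd a)"
  using ind[where A = "(\<^bold>\<not> (Var vn \<^bold>= zero)) \<^bold>\<longrightarrow> (Var vn \<^bold>= suc (predf \<cdot> Var vn))" and v = vn and e = e0
      and P = "\<lambda>a. a \<noteq> oo \<longrightarrow> a = sc (pd a)" and n = a]
  by (simp add: vn_def pd_def[symmetric])
    (simp add: pd_def predf_def idN_def Let_def const_def)

lemma nt_cases: assumes "nt a" obtains "a = oo" | b where "nt b" "a = sc b"
  using S_pd[OF assms] nt_pd[OF assms] by metis

text \<open>
  Induction on \<open>a\<close> for all \<open>b\<close> is not quantifier-free. Instead, with \<open>a\<close> and \<open>b\<close> fixed,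
  the induction on \<open>n\<close> is along the pairs \<open>(a - (a - n), b - (a - n))\<close>, which end
  in \<open>(a, b)\<close> for \<open>n = a\<close>.
\<close>

lemma double_ind:
  assumes f: "el f" "ty f = N \<rightarrowtail> N \<rightarrowtail> N" and g: "el g" "ty g = N \<rightarrowtail> N \<rightarrowtail> N"
    and "\<And>b. nt b \<Longrightarrow> f \<bullet> oo \<bullet> b = g \<bullet> oo \<bullet> b"
    and "\<And>a. nt a \<Longrightarrow> f \<bullet> a \<bullet> oo = g \<bullet> a \<bullet> oo"
    and step: "\<And>a b. nt a \<Longrightarrow> nt b \<Longrightarrow> f \<bullet> a \<bullet> b = g \<bullet> a \<bullet> b \<Longrightarrow> f \<bullet> sc a \<bullet> sc b = g \<bullet> sc a \<bullet> sc b"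
    and "nt a" "nt b"
  shows "f \<bullet> a \<bullet> b = g \<bullet> a \<bullet> b"
proof -
  let ?v = "\<lambda>s. Var (s, N)" and ?f = "(''f'', N \<rightarrowtail> N \<rightarrowtail> N)" and ?g = "(''g'', N \<rightarrowtail> N \<rightarrowtail> N)"
  let ?t = "\<lambda>h. Var h \<cdot> monus (?v ''a'') (monus (?v ''a'') (Var vn))
    \<cdot> monus (?v ''b'') (monus (?v ''a'') (Var vn))"
  let ?P = "\<lambda>n. f \<bullet> mon a (mon a n) \<bullet> mon b (mon a n) = g \<bullet> mon a (mon a n) \<bullet> mon b (mon a n)"
  have "?P a"
  proof (rule ind[where A = "?t ?f \<^bold>= ?t ?g" and v = vn and P = ?P
        and e = "e0((''a'', N) := a, (''b'', N) := b, ?f := f, ?g := g)"])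
    fix n assume n: "nt n" and IH: "?P n"
    have nt: "nt (mon a n)" using assms n by simp
    then show "?P (sc n)"
    proof (cases rule: nt_cases)
      case 1
      then show ?thesis using IH assms n by simp
    next
      case (2 j)
      let ?p = "mon a j" and ?q = "mon b j"
      have p: "nt ?p" and q: "nt ?q" using assms 2 by auto
      \<comment> \<open>As \<open>a - n\<close> is \<open>j + 1\<close>, the pair for
        \<open>n\<close> consists of the predecessors of \<open>a - j\<close> and
        \<open>b - j\<close>, which form the pair for \<open>n + 1\<close>.\<close>
      have IH': "f \<bullet> pd ?p \<bullet> pd ?q = g \<bullet> pd ?p \<bullet> pd ?q" using IH 2 assms by simp
      have "f \<bullet> ?p \<bullet> ?q = g \<bullet> ?p \<bullet> ?q"
        using p
      proof (cases rule: nt_cases)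
        case 1
        then show ?thesis using assms q by simp
      next
        case pp: (2 p')
        from q show ?thesis
        proof (cases rule: nt_cases)
          case 1
          then show ?thesis using assms p by simp
        next
          case (2 q')
          then show ?thesis using pp IH' step by simp
        qed
      qed
      then show ?thesis using 2 assms n by simp
    qed
  qed (use assms in \<open>simp_all add: vn_def\<close>)
  then show ?thesis using assms by simp
qed

section \<open>Addition and the linear order of the numbers\<close>

definition add :: "'a \<Rightarrow> 'a \<Rightarrow> 'a" where
  "add a b = cn Rec \<bullet> b \<bullet> a \<bullet> ev e0 (lam vi (lam vj (suc (Var vi))))"

lemma ev_plus [simp]: "ev e (plus a b) = add (ev e a) (ev e b)"
proof -
  have "ev e (lam vi (lam vj (suc (Var vi)))) = ev e0 (lam vi (lam vj (suc (Var vi))))"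
    by (rule ev_cong) simp
  then show ?thesis by (simp add: plus_def add_def)
qed

lemma nt_add [simp]: "nt a \<Longrightarrow> nt b \<Longrightarrow> nt (add a b)"
  by (simp add: add_def vi_def vj_def)

lemma add_0 [simp]: "nt a \<Longrightarrow> add a oo = a"
  by (simp add: add_def vi_def vj_def)

lemma add_S [simp]: "nt a \<Longrightarrow> nt b \<Longrightarrow> add a (sc b) = sc (add a b)"
  by (simp add: add_def vi_def vj_def)

definition ifd :: "'a \<Rightarrow> 'a \<Rightarrow> 'a \<Rightarrow> 'a" where
  "ifd t a b = cn Rec \<bullet> t \<bullet> a \<bullet> (cn (CK (N \<rightarrowtail> N) N) \<bullet> (cn (CK N N) \<bullet> b))"

lemma ev_ifz [simp]: "ev e (ifz t a b) = ifd (ev e t) (ev e a) (ev e b)"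
  by (simp add: ifz_def ifd_def const_def)

lemma ifd_if: "nt t \<Longrightarrow> nt a \<Longrightarrow> nt b \<Longrightarrow> ifd t a b = (if t = oo then a else b)"
  by (erule nt_cases) (simp_all add: ifd_def)

lemma zero_add [simp]: "nt b \<Longrightarrow> add oo b = b"
  by (rule ind[where A = "plus zero (Var vn) \<^bold>= Var vn" and v = vn and e = e0]) (simp_all add: vn_def)

lemma S_add [simp]: "nt a \<Longrightarrow> nt b \<Longrightarrow> add (sc a) b = sc (add a b)"
  by (rule ind[where A = "plus (suc (Var vi)) (Var vn) \<^bold>= suc (plus (Var vi) (Var vn))" and v = vn
        and e = "e0(vi := a)" and P = "\<lambda>b. add (sc a) b = sc (add a b)"])
    (simp_all add: vn_def vi_def)

lemma add_assoc: "nt a \<Longrightarrow> nt b \<Longrightarrow> nt c \<Longrightarrow> add (add a b) c = add a (add b c)"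
  by (rule ind[where A = "plus (plus (Var vi) (Var vj)) (Var vn) \<^bold>= plus (Var vi) (plus (Var vj) (Var vn))"
        and v = vn and e = "e0(vi := a, vj := b)" and P = "\<lambda>c. add (add a b) c = add a (add b c)"])
    (simp_all add: vn_def vi_def vj_def)

lemma add_comm: "nt a \<Longrightarrow> nt b \<Longrightarrow> add a b = add b a"
  by (rule ind[where A = "plus (Var vi) (Var vn) \<^bold>= plus (Var vn) (Var vi)"
        and v = vn and e = "e0(vi := a)" and P = "\<lambda>b. add a b = add b a"])
    (simp_all add: vn_def vi_def)

text \<open>Both sides are the maximum of \<open>a\<close> and \<open>b\<close>. Antisymmetry and
  the existence of differences are read off from this equation.\<close>

lemma add_mon_eq:
  assumes "nt a" "nt b"
  shows "add b (mon a b) = add a (mon b a)"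
proof -
  let ?f = "ev e0 (lam vi (lam vj (plus (Var vj) (monus (Var vi) (Var vj)))))"
  let ?g = "ev e0 (lam vi (lam vj (plus (Var vi) (monus (Var vj) (Var vi)))))"
  have [simp]: "?f \<bullet> a \<bullet> b = add b (mon a b)" "?g \<bullet> a \<bullet> b = add a (mon b a)"
    if "nt a" "nt b" for a b
    using that by (simp_all add: vi_def vj_def)
  have "?f \<bullet> a \<bullet> b = ?g \<bullet> a \<bullet> b"
    by (rule double_ind)
      (use assms in \<open>simp_all add: mon_SS del: mon_S ev_lam\<close>, simp_all add: vi_def vj_def)
  then show ?thesis using assms by simp
qed

lemma le_antisym: "a \<sqsubseteq> b \<Longrightarrow> b \<sqsubseteq> a \<Longrightarrow> nt a \<Longrightarrow> nt b \<Longrightarrow> a = b"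
  using add_mon_eq[of a b] by simp

text \<open>The disjunction is coded as the vanishing of a term, since \<open>double_ind\<close>
  proves equations.\<close>

lemma le_total: assumes "nt a" "nt b" shows "a \<sqsubseteq> b \<or> b \<sqsubseteq> a"
proof -
  let ?f = "ev e0 (lam vi (lam vj (ifz (monus (Var vi) (Var vj)) zero (monus (Var vj) (Var vi)))))"
  let ?g = "ev e0 (lam vi (lam vj zero))"
  have [simp]: "?f \<bullet> a \<bullet> b = (if mon a b = oo then oo else mon b a)" "?g \<bullet> a \<bullet> b = oo"
    if "nt a" "nt b" for a b
    using that by (simp_all add: vi_def vj_def ifd_if)
  have "?f \<bullet> a \<bullet> b = ?g \<bullet> a \<bullet> b"
    by (rule double_ind)
      (use assms in \<open>auto simp: mon_SS simp del: mon_S ev_lam split: if_splits\<close>, simp_all add: vi_def vj_def)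
  then show ?thesis using assms by (simp split: if_splits)
qed

lemma le_add [simp]: "nt a \<Longrightarrow> nt b \<Longrightarrow> a \<sqsubseteq> add a b"
  by (rule ind[where A = "monus (Var vi) (plus (Var vi) (Var vn)) \<^bold>= zero"
        and v = vn and e = "e0(vi := a)" and P = "\<lambda>b. a \<sqsubseteq> add a b"])
    (simp_all add: vn_def vi_def)

lemma le_iff_add: "nt a \<Longrightarrow> nt b \<Longrightarrow> a \<sqsubseteq> b \<longleftrightarrow> (\<exists>c. nt c \<and> b = add a c)"
  using add_mon_eq[of a b] by (metis add_0 le_add nt_mon)

lemma le_trans: "a \<sqsubseteq> b \<Longrightarrow> b \<sqsubseteq> c \<Longrightarrow> nt a \<Longrightarrow> nt b \<Longrightarrow> nt c \<Longrightarrow> a \<sqsubseteq> c"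
  by (metis add_assoc le_iff_add nt_add)

lemma le_SS [simp]: "nt a \<Longrightarrow> nt b \<Longrightarrow> sc a \<sqsubseteq> sc b \<longleftrightarrow> a \<sqsubseteq> b"
  by (simp add: mon_SS del: mon_S)

lemma not_S_le [simp]: "nt a \<Longrightarrow> \<not> sc a \<sqsubseteq> a"
  by (rule ind[where A = "\<^bold>\<not> (suc (Var vn) \<^bold>\<le> Var vn)" and v = vn and e = e0])
    (simp_all add: vn_def del: mon_S)

lemma le_S: "nt a \<Longrightarrow> nt b \<Longrightarrow> a \<sqsubseteq> b \<Longrightarrow> a \<sqsubseteq> sc b"
  by simp

lemma not_le: assumes "nt a" "nt b" shows "\<not> a \<sqsubseteq> b \<longleftrightarrow> sc b \<sqsubseteq> a"
proof
  assume *: "\<not> a \<sqsubseteq> b"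
  then obtain c where c: "nt c" "a = add b c" using le_total le_iff_add assms by blast
  then have "c \<noteq> oo" using * assms by auto
  then obtain d where "nt d" "c = sc d" using c nt_cases by blast
  then have "a = add (sc b) d" using c assms by simp
  then show "sc b \<sqsubseteq> a" using \<open>nt d\<close> assms by (simp del: S_add)
next
  assume "sc b \<sqsubseteq> a"
  then show "\<not> a \<sqsubseteq> b" using le_trans[of "sc b" a b] assms by auto
qed

lemma le_S_iff: "nt a \<Longrightarrow> nt b \<Longrightarrow> a \<sqsubseteq> sc b \<longleftrightarrow> a \<sqsubseteq> b \<or> a = sc b"
  using not_le[of a b] le_antisym[of a "sc b"] le_S[of a b] mon_self[of "sc b"] by (auto simp del: mon_S)

end

section \<open>From maxima to points where they are attained\<close>

definition vu :: var where "vu = (''u'', t2)"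
definition vb :: var where "vb = (''b'', t1)"
definition vm :: var where "vm = (''m'', N)"
definition vv :: var where "vv = (''v'', N)"
definition vmx :: var where "vmx = (''mx'', t1 \<rightarrowtail> t2 \<rightarrowtail> N)"

lemmas vdefs = vn_def vi_def vj_def vu_def vb_def vm_def vv_def vmx_def vx_def vk_def vy_def vz_def

text \<open>\<open>pairC B v i\<close> is \<open>v * (B + 1) + i\<close>.\<close>

definition pairC :: trm where
  "pairC = lam vm (lam vv (lam vn (Con Rec \<cdot> Var vv \<cdot> Var vn \<cdot> lam vi (lam vj (plus (Var vi) (suc (Var vm)))))))"

text \<open>Mixed-radix value of the first \<open>n\<close> digits of \<open>x\<close>, digit
  \<open>k\<close> having base \<open>b(k) + 1\<close> and the first digit being the most
  significant. On the box, comparing values compares initial segments lexicographically.\<close>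

definition valC :: trm where
  "valC = lam vb (lam vx (lam vn (Con Rec \<cdot> Var vn \<cdot> zero
     \<cdot> lam vv (lam vk (pairC \<cdot> (Var vb \<cdot> Var vk) \<cdot> Var vv \<cdot> (Var vx \<cdot> Var vk))))))"

text \<open>The successor separates the points where \<open>u\<close> is maximal, of positive
  weight, from all others, of weight 0.\<close>

definition wC :: trm where
  "wC = lam vmx (lam vu (lam vb (lam vn (lam vx
     (ifz (monus (Var vmx \<cdot> Var vb \<cdot> Var vu) (Var vu \<cdot> Var vx)) (suc (valC \<cdot> Var vb \<cdot> Var vx \<cdot> Var vn)) zero)))))"

text \<open>Length \<open>n + 1\<close> makes the weight include digit \<open>n\<close>. That digit
  is the same at all points of greatest weight, so the maximum of this function returns it.\<close>

definition digitC :: trm where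
  "digitC = lam vmx (lam vu (lam vb (lam vn (lam vx
     (ifz (monus (Var vmx \<cdot> Var vb \<cdot> (wC \<cdot> Var vmx \<cdot> Var vu \<cdot> Var vb \<cdot> suc (Var vn)))
        (wC \<cdot> Var vmx \<cdot> Var vu \<cdot> Var vb \<cdot> suc (Var vn) \<cdot> Var vx)) (Var vx \<cdot> Var vn) zero)))))"

definition argmaxC :: trm where
  "argmaxC = lam vmx (lam vu (lam vb (lam vn (Var vmx \<cdot> Var vb \<cdot> (digitC \<cdot> Var vmx \<cdot> Var vu \<cdot> Var vb \<cdot> Var vn)))))"

lemma pairC_closed [simp]: "tyof pairC = Some (N \<rightarrowtail> N \<rightarrowtail> N \<rightarrowtail> N)" "fvt pairC = {}" "parst pairC = {}"
  by (simp_all add: pairC_def vdefs insert_Diff_if)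

lemma valC_closed [simp]: "tyof valC = Some (t1 \<rightarrowtail> t1 \<rightarrowtail> t1)" "fvt valC = {}" "parst valC = {}"
  by (simp_all add: valC_def vdefs insert_Diff_if)

lemma wC_closed [simp]:
  "tyof wC = Some ((t1 \<rightarrowtail> t2 \<rightarrowtail> N) \<rightarrowtail> t2 \<rightarrowtail> t1 \<rightarrowtail> N \<rightarrowtail> t2)" "fvt wC = {}" "parst wC = {}"
  by (simp_all add: wC_def vdefs insert_Diff_if)

lemma digitC_closed [simp]:
  "tyof digitC = Some ((t1 \<rightarrowtail> t2 \<rightarrowtail> N) \<rightarrowtail> t2 \<rightarrowtail> t1 \<rightarrowtail> N \<rightarrowtail> t2)" "fvt digitC = {}" "parst digitC = {}"
  by (simp_all add: digitC_def vdefs insert_Diff_if)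

lemma argmaxC_closed [simp]:
  "tyof argmaxC = Some ((t1 \<rightarrowtail> t2 \<rightarrowtail> N) \<rightarrowtail> t2 \<rightarrowtail> t1 \<rightarrowtail> t1)" "fvt argmaxC = {}" "parst argmaxC = {}"
  by (simp_all add: argmaxC_def vdefs insert_Diff_if)

context epra_model
begin

lemma ev_closed: "fvt t = {} \<Longrightarrow> ev e t = ev e0 t"
  by (rule ev_cong) auto

lemma add_mono: "a \<sqsubseteq> b \<Longrightarrow> nt a \<Longrightarrow> nt b \<Longrightarrow> nt c \<Longrightarrow> add a c \<sqsubseteq> add b c"
proof -
  assume *: "a \<sqsubseteq> b" "nt a" "nt b" "nt c"
  then obtain d where d: "nt d" "b = add a d" using le_iff_add by blast
  have "add b c = add (add a c) d"
    using * d add_comm[of d c] by (simp add: add_assoc)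
  then show ?thesis using * d by simp
qed

lemma le_add2: "a \<sqsubseteq> b \<Longrightarrow> nt a \<Longrightarrow> nt b \<Longrightarrow> nt c \<Longrightarrow> a \<sqsubseteq> add b c"
  by (rule le_trans[of a b]) simp_all

lemma add_cancel:
  assumes "nt a" "nt b" "nt c" "add a c = add b c"
  shows "a = b"
proof -
  have "add a c = add b c \<longrightarrow> a = b"
    by (rule ind[where A = "(plus (Var vi) (Var vn) \<^bold>= plus (Var vj) (Var vn)) \<^bold>\<longrightarrow> (Var vi \<^bold>= Var vj)"
        and v = vn and e = "e0(vi := a, vj := b)" and P = "\<lambda>c. add a c = add b c \<longrightarrow> a = b"])
      (use assms in \<open>simp_all add: vdefs\<close>)
  then show ?thesis using assms by blast
qed

section \<open>Comparison of mixed-radix values\<close>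

definition pairM where "pairM = ev e0 pairC"

lemma ev_pairC [simp]: "ev e pairC = pairM"
  unfolding pairM_def by (rule ev_closed) simp

lemma pairM_type [simp]: "el pairM" "ty pairM = N \<rightarrowtail> N \<rightarrowtail> N \<rightarrowtail> N"
  by (simp_all add: pairM_def del: ev_pairC)

lemma pairM_eqs [simp]:
  assumes "nt B" "nt i"
  shows "pairM \<bullet> B \<bullet> oo \<bullet> i = i"
    and "nt v \<Longrightarrow> pairM \<bullet> B \<bullet> sc v \<bullet> i = sc (add (pairM \<bullet> B \<bullet> v \<bullet> i) B)"
  using assms by (simp_all add: pairM_def pairC_def vdefs del: ev_pairC)

lemma pair_less_Suc:
  assumes "nt B" "nt v" "nt i" "nt i'" "i \<sqsubseteq> B"
  shows "sc (pairM \<bullet> B \<bullet> v \<bullet> i) \<sqsubseteq> pairM \<bullet> B \<bullet> sc v \<bullet> i'"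
proof -
  let ?t = "\<lambda>s. pairC \<cdot> Var vm \<cdot> Var vn \<cdot> Var s"
  \<comment> \<open>One recursion step on the right-hand side of the claim leaves exactly this
    inequality, which is suited to induction on \<open>v\<close>.\<close>
  have "pairM \<bullet> B \<bullet> v \<bullet> i \<sqsubseteq> add (pairM \<bullet> B \<bullet> v \<bullet> i') B"
  proof (rule ind[where A = "?t vi \<^bold>\<le> plus (?t vj) (Var vm)" and v = vn
        and e = "e0(vi := i, vj := i', vm := B)"
        and P = "\<lambda>v. pairM \<bullet> B \<bullet> v \<bullet> i \<sqsubseteq> add (pairM \<bullet> B \<bullet> v \<bullet> i') B"])
    show "pairM \<bullet> B \<bullet> oo \<bullet> i \<sqsubseteq> add (pairM \<bullet> B \<bullet> oo \<bullet> i') B"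
      using assms le_add2[of i B i'] by (simp add: add_comm)
    show "pairM \<bullet> B \<bullet> sc n \<bullet> i \<sqsubseteq> add (pairM \<bullet> B \<bullet> sc n \<bullet> i') B"
      if "nt n" "pairM \<bullet> B \<bullet> n \<bullet> i \<sqsubseteq> add (pairM \<bullet> B \<bullet> n \<bullet> i') B" for n
      using that assms by (simp add: add_mono del: mon_S)
  qed (use assms in \<open>simp_all add: vdefs\<close>)
  then show ?thesis using assms by (simp del: mon_S)
qed

text \<open>A larger leading part wins whatever the last digits, because the last digit on the
  smaller side is at most \<open>B\<close>. The induction is on the difference of \<open>v'\<close>
  and \<open>sc v\<close>, starting from \<open>pair_less_Suc\<close>.\<close>

lemma pair_less:
  assumes "nt B" "nt v" "nt v'" "nt i" "nt i'" "i \<sqsubseteq> B" "sc v \<sqsubseteq> v'"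
  shows "sc (pairM \<bullet> B \<bullet> v \<bullet> i) \<sqsubseteq> pairM \<bullet> B \<bullet> v' \<bullet> i'"
proof -
  obtain d where d: "nt d" "v' = add (sc v) d" using assms le_iff_add by (metis nt_ap el_cn ty_cn contype.simps(2) nt_el nt_ty)
  have "sc (pairM \<bullet> B \<bullet> v \<bullet> i) \<sqsubseteq> pairM \<bullet> B \<bullet> (add (sc v) d) \<bullet> i'"
  proof (rule ind[where A = "suc (pairC \<cdot> Var vm \<cdot> Var vv \<cdot> Var vi) \<^bold>\<le>
        pairC \<cdot> Var vm \<cdot> (plus (suc (Var vv)) (Var vn)) \<cdot> Var vj" and v = vn
        and e = "e0(vi := i, vj := i', vm := B, vv := v)"
        and P = "\<lambda>d. sc (pairM \<bullet> B \<bullet> v \<bullet> i) \<sqsubseteq> pairM \<bullet> B \<bullet> (add (sc v) d) \<bullet> i'"])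
    show "sc (pairM \<bullet> B \<bullet> v \<bullet> i) \<sqsubseteq> pairM \<bullet> B \<bullet> add (sc v) oo \<bullet> i'"
      using pair_less_Suc[of B v i i'] assms by simp
    show "sc (pairM \<bullet> B \<bullet> v \<bullet> i) \<sqsubseteq> pairM \<bullet> B \<bullet> add (sc v) (sc n) \<bullet> i'"
      if n: "nt n" and IH: "sc (pairM \<bullet> B \<bullet> v \<bullet> i) \<sqsubseteq> pairM \<bullet> B \<bullet> add (sc v) n \<bullet> i'" for n
    proof -
      let ?p = "pairM \<bullet> B \<bullet> add (sc v) n \<bullet> i'"
      have nt: "nt ?p" "nt (add (sc v) n)" using n assms by simp_all
      have "sc (pairM \<bullet> B \<bullet> v \<bullet> i) \<sqsubseteq> add ?p B"
        using IH nt assms by (intro le_add2) (simp_all del: S_add)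
      then have "sc (pairM \<bullet> B \<bullet> v \<bullet> i) \<sqsubseteq> sc (add ?p B)"
        using nt assms by (intro le_S) (simp_all del: S_add)
      then show ?thesis using n assms nt by (simp del: S_add mon_S)
    qed
  qed (use assms d in \<open>simp_all add: vdefs\<close>)
  then show ?thesis using d by simp
qed

lemma pair_inj:
  assumes "nt B" "nt v" "nt i" "nt i'" "pairM \<bullet> B \<bullet> v \<bullet> i = pairM \<bullet> B \<bullet> v \<bullet> i'"
  shows "i = i'"
proof -
  let ?t = "\<lambda>s. pairC \<cdot> Var vm \<cdot> Var vn \<cdot> Var s"
  have "pairM \<bullet> B \<bullet> v \<bullet> i = pairM \<bullet> B \<bullet> v \<bullet> i' \<longrightarrow> i = i'"
  proof (rule ind[where A = "(?t vi \<^bold>= ?t vj) \<^bold>\<longrightarrow> (Var vi \<^bold>= Var vj)" and v = vn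
        and e = "e0(vi := i, vj := i', vm := B)"
        and P = "\<lambda>v. pairM \<bullet> B \<bullet> v \<bullet> i = pairM \<bullet> B \<bullet> v \<bullet> i' \<longrightarrow> i = i'"])
    show "pairM \<bullet> B \<bullet> sc n \<bullet> i = pairM \<bullet> B \<bullet> sc n \<bullet> i' \<longrightarrow> i = i'"
      if "nt n" "pairM \<bullet> B \<bullet> n \<bullet> i = pairM \<bullet> B \<bullet> n \<bullet> i' \<longrightarrow> i = i'" for n
      using that assms add_cancel[of "pairM \<bullet> B \<bullet> n \<bullet> i" "pairM \<bullet> B \<bullet> n \<bullet> i'" B] by simp
  qed (use assms in \<open>simp_all add: vdefs\<close>)
  then show ?thesis using assms by simp
qed

definition valM where "valM = ev e0 valC"

lemma ev_valC [simp]: "ev e valC = valM"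
  unfolding valM_def by (rule ev_closed) simp

lemma valM_type [simp]: "el valM" "ty valM = t1 \<rightarrowtail> t1 \<rightarrowtail> t1"
  by (simp_all add: valM_def del: ev_valC)

lemma valM_eqs [simp]:
  assumes "el b" "ty b = t1" "el x" "ty x = t1"
  shows "valM \<bullet> b \<bullet> x \<bullet> oo = oo"
    and "nt n \<Longrightarrow> valM \<bullet> b \<bullet> x \<bullet> sc n = pairM \<bullet> (b \<bullet> n) \<bullet> (valM \<bullet> b \<bullet> x \<bullet> n) \<bullet> (x \<bullet> n)"
  using assms by (simp_all add: valM_def valC_def vdefs del: ev_valC)

definition wM where "wM = ev e0 wC"

lemma ev_wC [simp]: "ev e wC = wM"
  unfolding wM_def by (rule ev_closed) simp

lemma wM_type [simp]: "el wM" "ty wM = (t1 \<rightarrowtail> t2 \<rightarrowtail> N) \<rightarrowtail> t2 \<rightarrowtail> t1 \<rightarrowtail> N \<rightarrowtail> t2"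
  by (simp_all add: wM_def del: ev_wC)

lemma wM_eq:
  assumes "el mx" "ty mx = t1 \<rightarrowtail> t2 \<rightarrowtail> N" "el u" "ty u = t2" "el b" "ty b = t1" "nt n" "el x" "ty x = t1"
  shows "wM \<bullet> mx \<bullet> u \<bullet> b \<bullet> n \<bullet> x = (if mx \<bullet> b \<bullet> u \<sqsubseteq> u \<bullet> x then sc (valM \<bullet> b \<bullet> x \<bullet> n) else oo)"
  using assms by (simp add: wM_def wC_def vdefs ifd_if del: ev_wC)

definition digitM where "digitM = ev e0 digitC"

lemma ev_digitC [simp]: "ev e digitC = digitM"
  unfolding digitM_def by (rule ev_closed) simp

lemma digitM_type [simp]: "el digitM" "ty digitM = (t1 \<rightarrowtail> t2 \<rightarrowtail> N) \<rightarrowtail> t2 \<rightarrowtail> t1 \<rightarrowtail> N \<rightarrowtail> t2"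
  by (simp_all add: digitM_def del: ev_digitC)

lemma digitM_eq:
  assumes "el mx" "ty mx = t1 \<rightarrowtail> t2 \<rightarrowtail> N" "el u" "ty u = t2" "el b" "ty b = t1" "nt n" "el x" "ty x = t1"
  shows "digitM \<bullet> mx \<bullet> u \<bullet> b \<bullet> n \<bullet> x =
    (if mx \<bullet> b \<bullet> (wM \<bullet> mx \<bullet> u \<bullet> b \<bullet> sc n) \<sqsubseteq> wM \<bullet> mx \<bullet> u \<bullet> b \<bullet> sc n \<bullet> x then x \<bullet> n else oo)"
  using assms by (simp add: digitM_def digitC_def vdefs ifd_if del: ev_digitC)

definition argmaxM where "argmaxM = ev e0 argmaxC"

lemma ev_argmaxC [simp]: "ev e argmaxC = argmaxM"
  unfolding argmaxM_def by (rule ev_closed) simp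

lemma argmaxM_type [simp]: "el argmaxM" "ty argmaxM = (t1 \<rightarrowtail> t2 \<rightarrowtail> N) \<rightarrowtail> t2 \<rightarrowtail> t1 \<rightarrowtail> t1"
  by (simp_all add: argmaxM_def del: ev_argmaxC)

lemma argmaxM_eq:
  assumes "el mx" "ty mx = t1 \<rightarrowtail> t2 \<rightarrowtail> N" "el u" "ty u = t2" "el b" "ty b = t1" "nt n"
  shows "argmaxM \<bullet> mx \<bullet> u \<bullet> b \<bullet> n = mx \<bullet> b \<bullet> (digitM \<bullet> mx \<bullet> u \<bullet> b \<bullet> n)"
  using assms by (simp add: argmaxM_def argmaxC_def vdefs del: ev_argmaxC)

section \<open>Boxes and maxima over them\<close>

definition box :: "'a \<Rightarrow> 'a set" where
  "box b = {x. el x \<and> ty x = t1 \<and> (\<forall>i. nt i \<longrightarrow> x \<bullet> i \<sqsubseteq> b \<bullet> i)}"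

lemma boxD [simp]: "x \<in> box b \<Longrightarrow> el x" "x \<in> box b \<Longrightarrow> ty x = t1"
  "x \<in> box b \<Longrightarrow> nt i \<Longrightarrow> x \<bullet> i \<sqsubseteq> b \<bullet> i"
  by (auto simp: box_def)

lemma boxI: "el x \<Longrightarrow> ty x = t1 \<Longrightarrow> (\<And>i. nt i \<Longrightarrow> x \<bullet> i \<sqsubseteq> b \<bullet> i) \<Longrightarrow> x \<in> box b"
  by (simp add: box_def del: boxD)

lemma box_self: "el b \<Longrightarrow> ty b = t1 \<Longrightarrow> b \<in> box b"
  by (simp add: box_def del: boxD)

text \<open>Stated as a least upper bound, the form in which USB supplies it; that it is a value is
  \<open>max_attained\<close>.\<close>

definition max_functional :: "'a \<Rightarrow> bool" where
  "max_functional mx \<longleftrightarrow> el mx \<and> ty mx = t1 \<rightarrowtail> t2 \<rightarrowtail> N \<and>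
     (\<forall>b u. el b \<longrightarrow> ty b = t1 \<longrightarrow> el u \<longrightarrow> ty u = t2 \<longrightarrow>
        (\<forall>x\<in>box b. u \<bullet> x \<sqsubseteq> mx \<bullet> b \<bullet> u) \<and>
        (\<forall>n. nt n \<longrightarrow> (\<forall>x\<in>box b. u \<bullet> x \<sqsubseteq> n) \<longrightarrow> mx \<bullet> b \<bullet> u \<sqsubseteq> n))"

lemma max_functionalD:
  assumes "max_functional mx"
  shows "el mx" "ty mx = t1 \<rightarrowtail> t2 \<rightarrowtail> N"
    "el b \<Longrightarrow> ty b = t1 \<Longrightarrow> el u \<Longrightarrow> ty u = t2 \<Longrightarrow> x \<in> box b \<Longrightarrow> u \<bullet> x \<sqsubseteq> mx \<bullet> b \<bullet> u"
    "el b \<Longrightarrow> ty b = t1 \<Longrightarrow> el u \<Longrightarrow> ty u = t2 \<Longrightarrow> nt n \<Longrightarrow> (\<And>x. x \<in> box b \<Longrightarrow> u \<bullet> x \<sqsubseteq> n) \<Longrightarrow> mx \<bullet> b \<bullet> u \<sqsubseteq> n"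
  using assms unfolding max_functional_def by blast+

text \<open>If no point attained a positive least bound, its predecessor would be a bound too; the
  bound 0 is attained at \<open>b\<close>.\<close>

lemma max_attained:
  assumes mx: "max_functional mx" and b: "el b" "ty b = t1" and u: "el u" "ty u = t2"
  obtains x where "x \<in> box b" "u \<bullet> x = mx \<bullet> b \<bullet> u"
proof -
  note [simp] = max_functionalD(1,2)[OF mx] b u
  have nt: "nt (mx \<bullet> b \<bullet> u)" by simp
  then have "\<exists>x\<in>box b. mx \<bullet> b \<bullet> u \<sqsubseteq> u \<bullet> x"
  proof (cases rule: nt_cases)
    case 1
    then show ?thesis by (intro bexI[of _ b]) (simp_all add: box_self)
  next
    case (2 m)
    show ?thesis
    proof (rule ccontr)
      assume *: "\<not> ?thesis"
      have "u \<bullet> x \<sqsubseteq> m" if "x \<in> box b" for x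
        using * that 2 not_le[of "u \<bullet> x" m] by auto
      then have "mx \<bullet> b \<bullet> u \<sqsubseteq> m" using max_functionalD(4)[OF mx b u \<open>nt m\<close>] by blast
      then show False using 2 by simp
    qed
  qed
  then obtain x where "x \<in> box b" "mx \<bullet> b \<bullet> u \<sqsubseteq> u \<bullet> x" by blast
  then show ?thesis using that max_functionalD(3)[OF mx b u] le_antisym by simp
qed

end

section \<open>The lexicographically greatest point of maximum\<close>

locale rca_model = epra_model +
  assumes sat_QF_AC: "B \<in> QF_AC 1 \<Longrightarrow> sat e B"
begin

text \<open>Quantifier-free choice of an index. A point with value \<open>m\<close> is not
  \<open>a\<close>, hence by extensionality differs from it somewhere; at the remaining points any
  index will do.\<close>

lemma separating_index:
  assumes [simp]: "el u" "ty u = t2" "el a" "ty a = t1" and ne: "u \<bullet> a \<noteq> m" and m: "nt m"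
  obtains G where "el G" "ty G = t2"
    "\<And>x. el x \<Longrightarrow> ty x = t1 \<Longrightarrow> u \<bullet> x = m \<Longrightarrow> x \<bullet> (G \<bullet> x) \<noteq> a \<bullet> (G \<bullet> x)"
proof -
  let ?A = "(Var vu \<cdot> Var vx \<^bold>= Var vm) \<^bold>\<longrightarrow> \<^bold>\<not> (Var vx \<cdot> Var vn \<^bold>= Var vb \<cdot> Var vn)"
  let ?F = "(''F'', t2)"
  let ?e = "e0(vu := u, vm := m, vb := a)"
  let ?C = "Alls [vx] (Ex vn ?A) \<^bold>\<longrightarrow> Ex ?F (Alls [vx] (subst vn (foldl App (Var ?F) (map Var [vx])) ?A))"
  have "sat ?e ?C"
  proof (rule sat_closures[OF _ sat_QF_AC[unfolded QF_AC_def]])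
    show "?C \<in> {Alls xs (Ex n A) \<^bold>\<longrightarrow> Ex F (Alls xs (subst n (foldl App (Var F) (map Var xs)) A)) | xs n F A.
        qfree A \<and> distinct (n # xs) \<and> snd n = N \<and> (\<forall>x\<in>set xs. \<exists>k\<le>1. snd x = pure k) \<and>
        snd F = foldr Fun (map snd xs) N \<and> F \<notin> fv A \<union> set (n # xs)}"
      apply (rule CollectI)
      apply (rule exI[of _ "[vx]"], rule exI[of _ vn], rule exI[of _ ?F], rule exI[of _ ?A])
      by (auto simp: vdefs Neg_def intro!: exI[of _ "Suc 0"])
  qed (use m in \<open>simp_all add: vdefs Neg_def Ex_def\<close>)
  moreover have "\<exists>i. nt i \<and> (u \<bullet> x = m \<longrightarrow> x \<bullet> i \<noteq> a \<bullet> i)" if x: "el x" "ty x = t1" for x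
  proof (cases "u \<bullet> x = m")
    case True
    then have "x \<noteq> a" using ne by blast
    then obtain i where "el i" "ty i = N" "x \<bullet> i \<noteq> a \<bullet> i" using ext[of x a N N] x by auto
    then show ?thesis using ntI by blast
  qed (use nt_0 in blast)
  ultimately show ?thesis using that m
    by (auto simp: vdefs Neg_def nt_ex nt_all)
qed

theorem argmax:
  assumes mx: "max_functional mx" and b: "el b" "ty b = t1" and u: "el u" "ty u = t2"
  shows "argmaxM \<bullet> mx \<bullet> u \<bullet> b \<in> box b" "u \<bullet> (argmaxM \<bullet> mx \<bullet> u \<bullet> b) = mx \<bullet> b \<bullet> u"
proof -
  note [simp] = max_functionalD(1,2)[OF mx] b u
  define M where "M = mx \<bullet> b \<bullet> u"
  define w where "w n = wM \<bullet> mx \<bullet> u \<bullet> b \<bullet> n" for n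
  define W where "W n = mx \<bullet> b \<bullet> w n" for n
  define \<alpha> where "\<alpha> = argmaxM \<bullet> mx \<bullet> u \<bullet> b"
  \<comment> \<open>the points of maximum whose first \<open>n\<close> digits are lexicographically greatest\<close>
  define top where "top n x \<longleftrightarrow> x \<in> box b \<and> w n \<bullet> x = W n" for n x
  let ?val = "\<lambda>x n. valM \<bullet> b \<bullet> x \<bullet> n"
  have [simp]: "el \<alpha>" "ty \<alpha> = t1" "nt M" by (simp_all add: \<alpha>_def M_def)
  have w_el [simp]: "el (w n)" "ty (w n) = t2" "nt (W n)" if "nt n" for n
    using that by (simp_all add: w_def W_def)
  have uM: "M \<sqsubseteq> u \<bullet> x \<longleftrightarrow> u \<bullet> x = M" if "x \<in> box b" for x
    using max_functionalD(3)[OF mx b u that] le_antisym[of M "u \<bullet> x"] that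
    by (auto simp: M_def[symmetric])
  have w_eq: "w n \<bullet> x = (if u \<bullet> x = M then sc (?val x n) else oo)" if "nt n" "x \<in> box b" for n x
    unfolding w_def using that uM by (subst wM_eq) (simp_all add: M_def)
  have w_le: "w n \<bullet> x \<sqsubseteq> W n" if "nt n" "x \<in> box b" for n x
    unfolding W_def using max_functionalD(3)[OF mx b _ _ that(2)] that(1) by simp
  obtain x0 where x0: "x0 \<in> box b" "u \<bullet> x0 = M" using max_attained[OF mx b u] M_def by blast
  have top_ex: "\<exists>x. top n x" if "nt n" for n
    unfolding top_def W_def using max_attained[OF mx b, of "w n"] that by (metis w_el(1,2))
  \<comment> \<open>Some maximal point exists and has positive weight, so a point of weight 0 cannot
    be on top.\<close>
  have top_M: "u \<bullet> x = M" if "nt n" "top n x" for n x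
  proof (rule ccontr)
    assume "u \<bullet> x \<noteq> M"
    then have "W n = oo" using that w_eq[of n x] by (simp add: top_def)
    moreover have "sc (?val x0 n) \<sqsubseteq> W n" using w_le[OF that(1) x0(1)] w_eq[OF that(1) x0(1)] x0 by simp
    ultimately show False using that x0 by simp
  qed
  have top_iff: "top n x \<longleftrightarrow> x \<in> box b \<and> u \<bullet> x = M \<and> (\<forall>z\<in>box b. u \<bullet> z = M \<longrightarrow> ?val z n \<sqsubseteq> ?val x n)"
    if n: "nt n" for n x
  proof
    assume t: "top n x"
    then have x: "x \<in> box b" "u \<bullet> x = M" using top_M n by (auto simp: top_def)
    have "?val z n \<sqsubseteq> ?val x n" if z: "z \<in> box b" "u \<bullet> z = M" for z
    proof -
      have "sc (?val z n) \<sqsubseteq> sc (?val x n)"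
        using w_le[OF n z(1)] w_eq[OF n z(1)] w_eq[OF n x(1)] t z x by (simp add: top_def del: mon_S le_SS)
      then show ?thesis using z x n by (simp del: mon_S)
    qed
    then show "x \<in> box b \<and> u \<bullet> x = M \<and> (\<forall>z\<in>box b. u \<bullet> z = M \<longrightarrow> ?val z n \<sqsubseteq> ?val x n)" using x by blast
  next
    assume *: "x \<in> box b \<and> u \<bullet> x = M \<and> (\<forall>z\<in>box b. u \<bullet> z = M \<longrightarrow> ?val z n \<sqsubseteq> ?val x n)"
    obtain z where z: "top n z" using top_ex n by blast
    then have z': "z \<in> box b" "u \<bullet> z = M" using top_M n by (auto simp: top_def)
    have "?val z n \<sqsubseteq> ?val x n" using * z' by blast
    have x: "x \<in> box b" "u \<bullet> x = M" using * by blast+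
    with \<open>?val z n \<sqsubseteq> ?val x n\<close> have "w n \<bullet> z \<sqsubseteq> w n \<bullet> x" using z' n w_eq[of n z] w_eq[of n x] by (simp del: mon_S)
    then have "W n \<sqsubseteq> w n \<bullet> x" using z by (simp add: top_def)
    then show "top n x" using x w_le[of n x] n le_antisym[of "w n \<bullet> x" "W n"] by (simp add: top_def)
  qed
  \<comment> \<open>A point beaten on its first \<open>n\<close> digits stays beaten with one more
    digit, by \<open>pair_less\<close>.\<close>
  have top_S: "top n x" if n: "nt n" and t: "top (sc n) x" for n x
  proof -
    have x: "x \<in> box b" "u \<bullet> x = M" using t n top_iff[of "sc n"] by auto
    have "?val z n \<sqsubseteq> ?val x n" if z: "z \<in> box b" "u \<bullet> z = M" for z
    proof (rule ccontr)
      assume "\<not> ?thesis"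
      then have "sc (?val x n) \<sqsubseteq> ?val z n" using not_le x z n by simp
      then have "sc (?val x (sc n)) \<sqsubseteq> ?val z (sc n)"
        using x z n by (simp add: pair_less del: mon_S)
      moreover have "?val z (sc n) \<sqsubseteq> ?val x (sc n)" using t z top_iff[of "sc n" x] n by simp
      ultimately show False using not_le[of "?val z (sc n)" "?val x (sc n)"] x z n by simp
    qed
    then show ?thesis using top_iff[OF n] x by blast
  qed
  \<comment> \<open>The values agree for length \<open>n\<close> and for length
    \<open>n + 1\<close>, and by \<open>pair_inj\<close> these two values determine the
    digit.\<close>
  have top_digit: "x \<bullet> n = z \<bullet> n" if n: "nt n" and t: "top (sc n) x" "top (sc n) z" for n x z
  proof -
    have x: "x \<in> box b" "u \<bullet> x = M" and z: "z \<in> box b" "u \<bullet> z = M"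
      using t n top_iff[of "sc n"] by auto
    have eq: "?val x m = ?val z m" if "nt m" "top m x" "top m z" for m
      by (rule le_antisym) (use top_iff[OF that(1)] that x z in simp_all)
    have "?val x n = ?val z n" using eq[OF n] top_S n t by blast
    moreover have "?val x (sc n) = ?val z (sc n)" using eq[of "sc n"] t n by simp
    ultimately show ?thesis using x z n pair_inj[of "b \<bullet> n" "?val z n" "x \<bullet> n" "z \<bullet> n"] by simp
  qed
  \<comment> \<open>The function maximised has the common digit on the top points and 0 elsewhere,
    so its maximum over the box is that digit.\<close>
  have digit: "\<alpha> \<bullet> n = x \<bullet> n" if n: "nt n" and t: "top (sc n) x" for n x
  proof -
    let ?d = "digitM \<bullet> mx \<bullet> u \<bullet> b \<bullet> n"
    have d: "el ?d" "ty ?d = t2" using n by simp_all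
    have d_eq: "?d \<bullet> z = (if top (sc n) z then z \<bullet> n else oo)" if "z \<in> box b" for z
    proof -
      have "W (sc n) \<sqsubseteq> w (sc n) \<bullet> z \<longleftrightarrow> top (sc n) z"
        using w_le[of "sc n" z] le_antisym[of "w (sc n) \<bullet> z" "W (sc n)"] that n unfolding top_def by auto
      then show ?thesis using that n by (subst digitM_eq) (simp_all add: W_def w_def)
    qed
    have x: "x \<in> box b" using t by (simp add: top_def)
    have "mx \<bullet> b \<bullet> ?d \<sqsubseteq> x \<bullet> n"
    proof (rule max_functionalD(4)[OF mx b d])
      show "?d \<bullet> z \<sqsubseteq> x \<bullet> n" if "z \<in> box b" for z
        using d_eq[OF that] top_digit[OF n t, of z] x n that by auto
    qed (use x n in simp)
    moreover have "x \<bullet> n \<sqsubseteq> mx \<bullet> b \<bullet> ?d"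
      using max_functionalD(3)[OF mx b d x] d_eq[OF x] t by simp
    moreover have "\<alpha> \<bullet> n = mx \<bullet> b \<bullet> ?d" unfolding \<alpha>_def using n by (subst argmaxM_eq) simp_all
    ultimately show ?thesis using le_antisym[of "\<alpha> \<bullet> n" "x \<bullet> n"] x n by simp
  qed
  have "\<alpha> \<bullet> n \<sqsubseteq> b \<bullet> n" if n: "nt n" for n
  proof -
    obtain x where "top (sc n) x" using top_ex[of "sc n"] n by auto
    then show ?thesis using digit[OF n] n by (simp add: top_def)
  qed
  then have \<alpha>_box: "\<alpha> \<in> box b" by (intro boxI) simp_all
  have agree: "x \<bullet> m = \<alpha> \<bullet> m" if m: "nt m" and n: "nt n" and t: "top n x" and less: "sc m \<sqsubseteq> n" for m n x
  proof -
    have x: "x \<in> box b" using t by (simp add: top_def)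
    \<comment> \<open>Membership in the box involves a quantifier. As \<open>x\<close> is fixed in
      the box, the equation alone enters the induction formula.\<close>
    let ?top = "\<lambda>t. (wC \<cdot> Var vmx \<cdot> Var vu \<cdot> Var vb \<cdot> t \<cdot> Var vx \<^bold>=
      Var vmx \<cdot> Var vb \<cdot> (wC \<cdot> Var vmx \<cdot> Var vu \<cdot> Var vb \<cdot> t))"
    have "sc m \<sqsubseteq> n \<longrightarrow> top n x \<longrightarrow> top (sc m) x"
    proof (rule ind[where A = "(suc (Var vi) \<^bold>\<le> Var vn) \<^bold>\<longrightarrow> ?top (Var vn) \<^bold>\<longrightarrow> ?top (suc (Var vi))" and v = vn
          and e = "e0(vmx := mx, vu := u, vb := b, vx := x, vi := m)"
          and P = "\<lambda>n. sc m \<sqsubseteq> n \<longrightarrow> top n x \<longrightarrow> top (sc m) x"])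
      show "sc m \<sqsubseteq> sc n \<longrightarrow> top (sc n) x \<longrightarrow> top (sc m) x"
        if n: "nt n" and IH: "sc m \<sqsubseteq> n \<longrightarrow> top n x \<longrightarrow> top (sc m) x" for n
        using IH n m top_S[OF n] le_S_iff[of "sc m" n] by (auto simp del: le_SS mon_S)
    qed (use m n x in \<open>simp_all add: vdefs top_def w_def W_def\<close>)
    then show ?thesis using digit[OF m] t less by simp
  qed
  have "u \<bullet> \<alpha> = M"
  proof (rule ccontr)
    assume "u \<bullet> \<alpha> \<noteq> M"
    then obtain G where [simp]: "el G" "ty G = t2"
      and G: "\<And>x. el x \<Longrightarrow> ty x = t1 \<Longrightarrow> u \<bullet> x = M \<Longrightarrow> x \<bullet> (G \<bullet> x) \<noteq> \<alpha> \<bullet> (G \<bullet> x)"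
      using separating_index[of u \<alpha> M] by auto
    \<comment> \<open>The successor puts every index \<open>G x\<close> strictly below
      \<open>?n\<close>, in the range where a top point agrees with \<open>\<alpha>\<close>.\<close>
    let ?n = "sc (mx \<bullet> b \<bullet> G)"
    have n: "nt ?n" by simp
    obtain x where t: "top ?n x" using top_ex n by blast
    then have x: "x \<in> box b" "u \<bullet> x = M" using top_iff n by auto
    have "sc (G \<bullet> x) \<sqsubseteq> ?n" using max_functionalD(3)[OF mx b _ _ x(1), of G] x by (simp del: mon_S)
    then have "x \<bullet> (G \<bullet> x) = \<alpha> \<bullet> (G \<bullet> x)" using agree[OF _ n t] x by simp
    then show False using G x by simp
  qed
  then show "argmaxM \<bullet> mx \<bullet> u \<bullet> b \<in> box b" "u \<bullet> (argmaxM \<bullet> mx \<bullet> u \<bullet> b) = mx \<bullet> b \<bullet> u"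
    using \<alpha>_box by (simp_all add: \<alpha>_def M_def)
qed

end

section \<open>Maxima of lists, bounded search and truncation\<close>

text \<open>\<open>HAC_int\<close> returns finite lists of candidates; this condenses such a list
  into one value.\<close>

definition lmaxC :: "ty \<Rightarrow> trm" where
  "lmaxC \<sigma> = (let h = (''h'', \<sigma> \<rightarrowtail> N); s = (''s'', Seq \<sigma>); t = Var h \<cdot> at \<sigma> (Var s) (Var vi) in
     lam h (lam s (lam vn (Con Rec \<cdot> Var vn \<cdot> zero \<cdot> lam vv (lam vi (ifz (monus (Var vv) t) t (Var vv)))))))"

text \<open>A bounded existential quantifier as a term: 0 for success and 1 for failure. Thus a
  maximum of 0 over a box means success at every point.\<close>

definition srchC :: trm where
  "srchC = lam vx (lam vn (Con Rec \<cdot> Var vn \<cdot> suc zero \<cdot> lam vv (lam vi (ifz (Var vx \<cdot> Var vi) zero (Var vv)))))"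

text \<open>A retraction of type 1 onto the box below \<open>b\<close>.\<close>

definition minC :: trm where
  "minC = lam vx (lam vb (lam vi (ifz (monus (Var vx \<cdot> Var vi) (Var vb \<cdot> Var vi)) (Var vx \<cdot> Var vi) (Var vb \<cdot> Var vi))))"

definition vTheta :: var where "vTheta = (''Theta'', (N \<rightarrowtail> t2) \<rightarrowtail> (N \<rightarrowtail> t1) \<rightarrowtail> N \<rightarrowtail> t1)"

text \<open>UF without its leading quantifier: an internal formula with \<open>vTheta\<close> as its
  only free variable, hence fit for transfer.\<close>

definition UF_matrix :: fm where
  "UF_matrix = (let \<Phi> = (''Phi'', N \<rightarrowtail> t2); y = (''y'', N \<rightarrowtail> t1); k = (''k'', N); z = (''z'', t1);
             \<theta> = Var vTheta \<cdot> Var \<Phi> \<cdot> Var y in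
     All \<Phi> (All y (All k (All z (le1 (Var z) (Var y \<cdot> Var k) \<^bold>\<longrightarrow>
       (Var \<Phi> \<cdot> Var k \<cdot> Var z \<^bold>\<le> Var \<Phi> \<cdot> Var k \<cdot> (\<theta> \<cdot> Var k)) \<^bold>\<and> le01 \<theta> (Var y))))))"

lemma snd_vTheta: "snd vTheta = (N \<rightarrowtail> t2) \<rightarrowtail> (N \<rightarrowtail> t1) \<rightarrowtail> N \<rightarrowtail> t1"
  by (simp add: vTheta_def)

lemma UF_eq: "UF = Ex vTheta UF_matrix"
  by (simp add: UF_def UF_matrix_def vTheta_def Let_def)

lemma lmaxC_closed [simp]: "tyof (lmaxC \<sigma>) = Some ((\<sigma> \<rightarrowtail> N) \<rightarrowtail> Seq \<sigma> \<rightarrowtail> N \<rightarrowtail> N)"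
    "fvt (lmaxC \<sigma>) = {}" "parst (lmaxC \<sigma>) = {}"
  by (simp_all add: lmaxC_def Let_def vdefs insert_Diff_if)

lemma srchC_closed [simp]: "tyof srchC = Some (t1 \<rightarrowtail> t1)" "fvt srchC = {}" "parst srchC = {}"
  by (simp_all add: srchC_def vdefs insert_Diff_if)

lemma minC_closed [simp]: "tyof minC = Some (t1 \<rightarrowtail> t1 \<rightarrowtail> t1)" "fvt minC = {}" "parst minC = {}"
  by (simp_all add: minC_def vdefs insert_Diff_if)

context epra_model
begin

definition lmaxM where "lmaxM \<sigma> = ev e0 (lmaxC \<sigma>)"

lemma ev_lmaxC [simp]: "ev e (lmaxC \<sigma>) = lmaxM \<sigma>"
  unfolding lmaxM_def by (rule ev_closed) simp

lemma lmaxM_type [simp]: "el (lmaxM \<sigma>)" "ty (lmaxM \<sigma>) = (\<sigma> \<rightarrowtail> N) \<rightarrowtail> Seq \<sigma> \<rightarrowtail> N \<rightarrowtail> N"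
  by (simp_all add: lmaxM_def del: ev_lmaxC)

lemma lmaxM_eqs [simp]:
  assumes "el h" "ty h = \<sigma> \<rightarrowtail> N" "el s" "ty s = Seq \<sigma>"
  shows "lmaxM \<sigma> \<bullet> h \<bullet> s \<bullet> oo = oo"
    and "nt n \<Longrightarrow> lmaxM \<sigma> \<bullet> h \<bullet> s \<bullet> sc n =
      (if lmaxM \<sigma> \<bullet> h \<bullet> s \<bullet> n \<sqsubseteq> h \<bullet> (cn (At \<sigma>) \<bullet> s \<bullet> n) then h \<bullet> (cn (At \<sigma>) \<bullet> s \<bullet> n) else lmaxM \<sigma> \<bullet> h \<bullet> s \<bullet> n)"
  using assms by (simp_all add: lmaxM_def lmaxC_def Let_def vdefs ifd_if del: ev_lmaxC)

lemma lmax_ge: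
  assumes "el h" "ty h = \<sigma> \<rightarrowtail> N" "el s" "ty s = Seq \<sigma>" "nt i" "nt n" "sc i \<sqsubseteq> n"
  shows "h \<bullet> (cn (At \<sigma>) \<bullet> s \<bullet> i) \<sqsubseteq> lmaxM \<sigma> \<bullet> h \<bullet> s \<bullet> n"
proof -
  let ?h = "(''h'', \<sigma> \<rightarrowtail> N)" and ?s = "(''s'', Seq \<sigma>)"
  have "sc i \<sqsubseteq> n \<longrightarrow> h \<bullet> (cn (At \<sigma>) \<bullet> s \<bullet> i) \<sqsubseteq> lmaxM \<sigma> \<bullet> h \<bullet> s \<bullet> n"
  proof (rule ind[where A = "(suc (Var vi) \<^bold>\<le> Var vn) \<^bold>\<longrightarrow>
        (Var ?h \<cdot> at \<sigma> (Var ?s) (Var vi) \<^bold>\<le> lmaxC \<sigma> \<cdot> Var ?h \<cdot> Var ?s \<cdot> Var vn)" and v = vn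
        and e = "e0(?h := h, ?s := s, vi := i)"
        and P = "\<lambda>n. sc i \<sqsubseteq> n \<longrightarrow> h \<bullet> (cn (At \<sigma>) \<bullet> s \<bullet> i) \<sqsubseteq> lmaxM \<sigma> \<bullet> h \<bullet> s \<bullet> n"])
    fix n assume n: "nt n" and IH: "sc i \<sqsubseteq> n \<longrightarrow> h \<bullet> (cn (At \<sigma>) \<bullet> s \<bullet> i) \<sqsubseteq> lmaxM \<sigma> \<bullet> h \<bullet> s \<bullet> n"
    let ?m = "lmaxM \<sigma> \<bullet> h \<bullet> s \<bullet> n" and ?t = "\<lambda>n. h \<bullet> (cn (At \<sigma>) \<bullet> s \<bullet> n)"
    have nt: "nt ?m" "nt (?t n)" "nt (?t i)" using assms n by simp_all
    show "sc i \<sqsubseteq> sc n \<longrightarrow> ?t i \<sqsubseteq> lmaxM \<sigma> \<bullet> h \<bullet> s \<bullet> sc n"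
    proof
      assume "sc i \<sqsubseteq> sc n"
      then consider "sc i \<sqsubseteq> n" | "i = n" using le_S_iff[of "sc i" n] n assms by auto
      then show "?t i \<sqsubseteq> lmaxM \<sigma> \<bullet> h \<bullet> s \<bullet> sc n"
      proof cases
        case 1
        then have "?t i \<sqsubseteq> ?m" using IH by blast
        then show ?thesis using le_trans[of "?t i" ?m "?t n"] nt assms n by simp
      next
        case 2
        then show ?thesis using le_total[of ?m "?t n"] nt assms n by auto
      qed
    qed
  qed (use assms in \<open>simp_all add: vdefs\<close>)
  then show ?thesis using assms by blast
qed

lemma lmax_le:
  assumes "el h" "ty h = \<sigma> \<rightarrowtail> N" "el s" "ty s = Seq \<sigma>" "nt c" "nt n"
    and le: "\<And>x. el x \<Longrightarrow> ty x = \<sigma> \<Longrightarrow> h \<bullet> x \<sqsubseteq> c"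
  shows "lmaxM \<sigma> \<bullet> h \<bullet> s \<bullet> n \<sqsubseteq> c"
proof -
  let ?h = "(''h'', \<sigma> \<rightarrowtail> N)" and ?s = "(''s'', Seq \<sigma>)"
  show ?thesis
  proof (rule ind[where A = "lmaxC \<sigma> \<cdot> Var ?h \<cdot> Var ?s \<cdot> Var vn \<^bold>\<le> Var vi" and v = vn
        and e = "e0(?h := h, ?s := s, vi := c)" and P = "\<lambda>n. lmaxM \<sigma> \<bullet> h \<bullet> s \<bullet> n \<sqsubseteq> c"])
    show "lmaxM \<sigma> \<bullet> h \<bullet> s \<bullet> sc n \<sqsubseteq> c" if "nt n" "lmaxM \<sigma> \<bullet> h \<bullet> s \<bullet> n \<sqsubseteq> c" for n
      using that assms by simp
  qed (use assms(1-6) in \<open>simp_all add: vdefs\<close>)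
qed

definition srchM where "srchM = ev e0 srchC"

lemma ev_srchC [simp]: "ev e srchC = srchM"
  unfolding srchM_def by (rule ev_closed) simp

lemma srchM_type [simp]: "el srchM" "ty srchM = t1 \<rightarrowtail> t1"
  by (simp_all add: srchM_def del: ev_srchC)

lemma srchM_eqs [simp]:
  assumes "el h" "ty h = t1"
  shows "srchM \<bullet> h \<bullet> oo = sc oo"
    and "nt n \<Longrightarrow> srchM \<bullet> h \<bullet> sc n = (if h \<bullet> n = oo then oo else srchM \<bullet> h \<bullet> n)"
  using assms by (simp_all add: srchM_def srchC_def vdefs ifd_if del: ev_srchC)

lemma srch_0:
  assumes "el h" "ty h = t1" "nt i" "nt n" "sc i \<sqsubseteq> n" "h \<bullet> i = oo"
  shows "srchM \<bullet> h \<bullet> n = oo"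
proof -
  have "sc i \<sqsubseteq> n \<longrightarrow> srchM \<bullet> h \<bullet> n = oo"
  proof (rule ind[where A = "(suc (Var vi) \<^bold>\<le> Var vn) \<^bold>\<longrightarrow> (srchC \<cdot> Var vx \<cdot> Var vn \<^bold>= zero)" and v = vn
        and e = "e0(vx := h, vi := i)" and P = "\<lambda>n. sc i \<sqsubseteq> n \<longrightarrow> srchM \<bullet> h \<bullet> n = oo"])
    show "sc i \<sqsubseteq> sc n \<longrightarrow> srchM \<bullet> h \<bullet> sc n = oo" if "nt n" "sc i \<sqsubseteq> n \<longrightarrow> srchM \<bullet> h \<bullet> n = oo" for n
      using that assms le_S_iff[of "sc i" n] by auto
  qed (use assms in \<open>simp_all add: vdefs\<close>)
  then show ?thesis using assms by blast
qed

lemma srch_witness: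
  assumes "el h" "ty h = t1" "nt n" "srchM \<bullet> h \<bullet> n = oo"
  shows "\<exists>i. nt i \<and> sc i \<sqsubseteq> n \<and> h \<bullet> i = oo"
proof (rule ccontr)
  assume *: "\<not> ?thesis"
  \<comment> \<open>The existence of a zero is not quantifier-free. Its failure, fixed from outside,
    supports an induction on the search value alone, restricted to \<open>m\<close> up to
    \<open>n\<close>.\<close>
  have "m \<sqsubseteq> n \<longrightarrow> srchM \<bullet> h \<bullet> m = sc oo" if "nt m" for m
  proof (rule ind[where A = "(Var vn \<^bold>\<le> Var vi) \<^bold>\<longrightarrow> (srchC \<cdot> Var vx \<cdot> Var vn \<^bold>= suc zero)" and v = vn
        and e = "e0(vx := h, vi := n)" and P = "\<lambda>m. m \<sqsubseteq> n \<longrightarrow> srchM \<bullet> h \<bullet> m = sc oo"])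
    show "sc m \<sqsubseteq> n \<longrightarrow> srchM \<bullet> h \<bullet> sc m = sc oo" if m: "nt m" "m \<sqsubseteq> n \<longrightarrow> srchM \<bullet> h \<bullet> m = sc oo" for m
    proof
      assume l: "sc m \<sqsubseteq> n"
      then have "m \<sqsubseteq> n" using le_trans[of m "sc m" n] le_S[of m m] m assms by simp
      then show "srchM \<bullet> h \<bullet> sc m = sc oo" using * l m assms by auto
    qed
  qed (use that assms(1-3) in \<open>simp_all add: vdefs\<close>)
  then show False using assms by simp
qed

definition minM where "minM = ev e0 minC"

lemma ev_minC [simp]: "ev e minC = minM"
  unfolding minM_def by (rule ev_closed) simp

lemma minM_type [simp]: "el minM" "ty minM = t1 \<rightarrowtail> t1 \<rightarrowtail> t1"
  by (simp_all add: minM_def del: ev_minC)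

lemma minM_eq:
  assumes "el x" "ty x = t1" "el b" "ty b = t1" "nt i"
  shows "minM \<bullet> x \<bullet> b \<bullet> i = (if x \<bullet> i \<sqsubseteq> b \<bullet> i then x \<bullet> i else b \<bullet> i)"
  using assms by (simp add: minM_def minC_def vdefs ifd_if del: ev_minC)

lemma min_box: "el x \<Longrightarrow> ty x = t1 \<Longrightarrow> el b \<Longrightarrow> ty b = t1 \<Longrightarrow> minM \<bullet> x \<bullet> b \<in> box b"
  by (rule boxI) (simp_all add: minM_eq)

lemma min_eq: assumes "x \<in> box b" "el b" "ty b = t1" shows "minM \<bullet> x \<bullet> b = x"
proof (rule ext[of _ _ N N])
  show "minM \<bullet> x \<bullet> b \<bullet> i = x \<bullet> i" if "el i" "ty i = N" for i
    using ntI[OF that] assms by (simp add: minM_eq)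
qed (use assms in simp_all)

section \<open>The three principles read in a model\<close>

lemma mem_box: "x \<in> box b \<longleftrightarrow> el x \<and> ty x = t1 \<and> (\<forall>i. el i \<longrightarrow> ty i = N \<longrightarrow> x \<bullet> i \<sqsubseteq> b \<bullet> i)"
  unfolding box_def nt_def by blast

lemma sat_le1_box: "el x \<Longrightarrow> ty x = t1 \<Longrightarrow> (\<forall>d. el d \<longrightarrow> ty d = N \<longrightarrow> x \<bullet> d \<sqsubseteq> b \<bullet> d) \<longleftrightarrow> x \<in> box b"
  unfolding mem_box by blast

lemma sat_UF_matrix:
  assumes "el \<Theta>" "ty \<Theta> = snd vTheta"
  shows "sat (e(vTheta := \<Theta>)) UF_matrix \<longleftrightarrow>
     (\<forall>\<Phi> y k z. el \<Phi> \<longrightarrow> ty \<Phi> = N \<rightarrowtail> t2 \<longrightarrow> el y \<longrightarrow> ty y = N \<rightarrowtail> t1 \<longrightarrow> nt k \<longrightarrow> z \<in> box (y \<bullet> k) \<longrightarrow>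
        \<Phi> \<bullet> k \<bullet> z \<sqsubseteq> \<Phi> \<bullet> k \<bullet> (\<Theta> \<bullet> \<Phi> \<bullet> y \<bullet> k) \<and> (\<forall>j. nt j \<longrightarrow> \<Theta> \<bullet> \<Phi> \<bullet> y \<bullet> j \<in> box (y \<bullet> j)))"
proof -
  have le01: "sat e (le01 t u) \<longleftrightarrow>
      (\<forall>k. nt k \<longrightarrow> (\<forall>i. nt i \<longrightarrow> ev e t \<bullet> k \<bullet> i \<sqsubseteq> ev e u \<bullet> k \<bullet> i))" for e t u
    by (simp add: le01_def Let_def nt_all del: nt_el nt_ty)
  have "el \<Phi> \<Longrightarrow> ty \<Phi> = N \<rightarrowtail> t2 \<Longrightarrow> el y \<Longrightarrow> ty y = N \<rightarrowtail> t1 \<Longrightarrow> nt k \<Longrightarrow>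
      (\<forall>i. nt i \<longrightarrow> \<Theta> \<bullet> \<Phi> \<bullet> y \<bullet> k \<bullet> i \<sqsubseteq> y \<bullet> k \<bullet> i) \<longleftrightarrow> \<Theta> \<bullet> \<Phi> \<bullet> y \<bullet> k \<in> box (y \<bullet> k)" for \<Phi> y k
    using assms by (simp add: box_def vTheta_def del: boxD)
  then show ?thesis
    unfolding UF_matrix_def Let_def
    by (simp add: le01 sat_le1_box nt_all vTheta_def del: boxD)
      (auto simp: box_def simp del: boxD)
qed

lemma sat_UF:
  "sat e UF \<longleftrightarrow> (\<exists>\<Theta>. el \<Theta> \<and> ty \<Theta> = snd vTheta \<and> sat (e(vTheta := \<Theta>)) UF_matrix)"
  unfolding UF_eq by simp

definition bound :: "'a \<Rightarrow> 'a \<Rightarrow> 'a \<Rightarrow> 'a \<Rightarrow> bool" where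
  "bound y H k n \<longleftrightarrow> (\<forall>x\<in>box (y \<bullet> k). \<exists>z. nt z \<and> z \<sqsubseteq> n \<and> H \<bullet> x \<bullet> y \<bullet> z \<bullet> k = oo)"

definition selects :: "'a \<Rightarrow> 'a \<Rightarrow> 'a \<Rightarrow> bool" where
  "selects y H g \<longleftrightarrow> (\<forall>k. nt k \<longrightarrow> (\<forall>x\<in>box (y \<bullet> k). H \<bullet> x \<bullet> y \<bullet> (g \<bullet> x \<bullet> y \<bullet> k) \<bullet> k = oo))"

abbreviation "tH \<equiv> t1 \<rightarrowtail> (N \<rightarrowtail> t1) \<rightarrowtail> N \<rightarrowtail> N \<rightarrowtail> N"
abbreviation "tg \<equiv> t1 \<rightarrowtail> (N \<rightarrowtail> t1) \<rightarrowtail> N \<rightarrowtail> N"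

lemma sat_USB:
  "sat e USB \<longleftrightarrow> (\<exists>\<Psi>. el \<Psi> \<and> ty \<Psi> = (N \<rightarrowtail> t1) \<rightarrowtail> tg \<rightarrowtail> t1 \<and>
     (\<forall>y. el y \<longrightarrow> ty y = N \<rightarrowtail> t1 \<longrightarrow> (\<forall>H. el H \<longrightarrow> ty H = tH \<longrightarrow> (\<forall>g. el g \<longrightarrow> ty g = tg \<longrightarrow>
        selects y H g \<longrightarrow> (\<forall>k. nt k \<longrightarrow> bound y H k (\<Psi> \<bullet> y \<bullet> g \<bullet> k))))) \<and>
     (\<forall>y. el y \<longrightarrow> ty y = N \<rightarrowtail> t1 \<longrightarrow> (\<forall>g. el g \<longrightarrow> ty g = tg \<longrightarrow> (\<forall>k. nt k \<longrightarrow> (\<forall>n. nt n \<longrightarrow>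
        (\<forall>H. el H \<longrightarrow> ty H = tH \<longrightarrow> selects y H g \<longrightarrow> bound y H k n) \<longrightarrow> \<Psi> \<bullet> y \<bullet> g \<bullet> k \<sqsubseteq> n)))))"
  unfolding USB_def Let_def bound_def selects_def Ball_def mem_box nt_def
  by (simp add: vdefs vH_def vg_def H0_def imp_conjL del: nt_el nt_ty boxD)

lemma sat_S:
  "sat e Sprinciple \<longleftrightarrow> (\<forall>y. el y \<longrightarrow> ty y = N \<rightarrowtail> t1 \<longrightarrow> st y \<longrightarrow> (\<forall>H. el H \<longrightarrow> ty H = tH \<longrightarrow> st H \<longrightarrow>
     (\<forall>k. nt k \<longrightarrow> st k \<longrightarrow> (\<forall>x. el x \<longrightarrow> ty x = t1 \<longrightarrow> st x \<longrightarrow> x \<in> box (y \<bullet> k) \<longrightarrow>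
        (\<exists>z. nt z \<and> st z \<and> H \<bullet> x \<bullet> y \<bullet> z \<bullet> k = oo))) \<longrightarrow>
     (\<exists>\<xi>. el \<xi> \<and> ty \<xi> = t1 \<and> st \<xi> \<and> (\<forall>k. nt k \<longrightarrow> st k \<longrightarrow> bound y H k (\<xi> \<bullet> k)))))"
  unfolding Sprinciple_def Let_def bound_def Ball_def mem_box nt_def
  by (simp add: vdefs vH_def H0_def imp_conjL del: nt_el nt_ty boxD)

text \<open>The bound is the maximum over the box of the witnesses that \<open>g\<close> provides,
  so each of these witnesses lies below it.\<close>

lemma max_imp_USB:
  assumes mx: "max_functional mx"
  shows "sat e USB"
proof -
  note [simp] = max_functionalD(1,2)[OF mx]
  let ?t = "lam vx (Var vg \<cdot> Var vx \<cdot> Var vy \<cdot> Var vk)"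
  define \<Psi> where "\<Psi> = ev (e0(vmx := mx)) (lam vy (lam vg (lam vk (Var vmx \<cdot> (Var vy \<cdot> Var vk) \<cdot> ?t))))"
  define U where "U y g k = ev (e0(vmx := mx, vy := y, vg := g, vk := k)) ?t" for y g k
  have \<Psi>: "el \<Psi>" "ty \<Psi> = (N \<rightarrowtail> t1) \<rightarrowtail> tg \<rightarrowtail> t1"
    unfolding \<Psi>_def by (simp_all add: vdefs vg_def)
  have \<Psi>_eq: "\<Psi> \<bullet> y \<bullet> g \<bullet> k = mx \<bullet> (y \<bullet> k) \<bullet> U y g k"
    if "el y" "ty y = N \<rightarrowtail> t1" "el g" "ty g = tg" "nt k" for y g k
    unfolding \<Psi>_def U_def using that by (simp add: vdefs vg_def)
  have U: "el (U y g k)" "ty (U y g k) = t2" "el x \<Longrightarrow> ty x = t1 \<Longrightarrow> U y g k \<bullet> x = g \<bullet> x \<bullet> y \<bullet> k"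
    if "el y" "ty y = N \<rightarrowtail> t1" "el g" "ty g = tg" "nt k" for y g k x
    unfolding U_def using that by (simp_all add: vdefs vg_def)
  show ?thesis
    unfolding sat_USB
  proof (intro exI[of _ \<Psi>] conjI allI impI)
    fix y H g k assume **: "el y" "ty y = N \<rightarrowtail> t1" "el H" "ty H = tH" "el g" "ty g = tg" "selects y H g" "nt k"
    note * = **(1,2,5,6,8,3,4,7)
    show "bound y H k (\<Psi> \<bullet> y \<bullet> g \<bullet> k)"
      unfolding bound_def
    proof (intro ballI exI conjI)
      fix x assume x: "x \<in> box (y \<bullet> k)"
      show "nt (g \<bullet> x \<bullet> y \<bullet> k)" using * x by simp
      show "H \<bullet> x \<bullet> y \<bullet> (g \<bullet> x \<bullet> y \<bullet> k) \<bullet> k = oo" using * x by (simp add: selects_def)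
      show "g \<bullet> x \<bullet> y \<bullet> k \<sqsubseteq> \<Psi> \<bullet> y \<bullet> g \<bullet> k"
        using max_functionalD(3)[OF mx _ _ U(1,2)[OF *(1-5)] x] U(3)[OF *(1-5)] * x \<Psi>_eq[OF *(1-5)] by simp
    qed
  next
    fix y g k n assume *: "el y" "ty y = N \<rightarrowtail> t1" "el g" "ty g = tg" "nt k"
      and n: "nt n" and b: "\<forall>H. el H \<longrightarrow> ty H = tH \<longrightarrow> selects y H g \<longrightarrow> bound y H k n"
    \<comment> \<open>This \<open>H\<close> vanishes exactly when the witness of \<open>g\<close> is
      at most \<open>z\<close>, so a number that works for it is above all these witnesses.\<close>
    let ?H = "ev (e0(vg := g)) (lam vx (lam vy (lam vz (lam vk (monus (Var vg \<cdot> Var vx \<cdot> Var vy \<cdot> Var vk) (Var vz))))))"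
    have H: "el ?H" "ty ?H = tH" using * by (simp_all add: vdefs vg_def)
    have H_eq: "?H \<bullet> x \<bullet> y \<bullet> z \<bullet> k = mon (g \<bullet> x \<bullet> y \<bullet> k) z"
      if "el x" "ty x = t1" "nt z" "nt k" for x z k
      using that * by (simp add: vdefs vg_def)
    have "selects y ?H g" unfolding selects_def using * by (simp add: H_eq)
    then have bd: "bound y ?H k n" using b H by blast
    have "mx \<bullet> (y \<bullet> k) \<bullet> U y g k \<sqsubseteq> n"
    proof (rule max_functionalD(4)[OF mx _ _ U(1,2)[OF *] n])
      fix x assume x: "x \<in> box (y \<bullet> k)"
      then obtain z where z: "nt z" "z \<sqsubseteq> n" "?H \<bullet> x \<bullet> y \<bullet> z \<bullet> k = oo" using bd unfolding bound_def by blast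
      then have "g \<bullet> x \<bullet> y \<bullet> k \<sqsubseteq> z" using H_eq x * by simp
      then show "U y g k \<bullet> x \<sqsubseteq> n" using U(3)[OF *, of x] le_trans[of "g \<bullet> x \<bullet> y \<bullet> k" z n] z(1,2) n x * by simp
    qed (use * in simp_all)
    then show "\<Psi> \<bullet> y \<bullet> g \<bullet> k \<sqsubseteq> n" using \<Psi>_eq[OF *] by simp
  qed (use \<Psi> in simp_all)
qed

text \<open>Take \<open>y\<close> constantly \<open>b\<close>, let \<open>g\<close> return
  \<open>u(x)\<close>, and evaluate at index 0. The test \<open>u(x) - z\<close> shows that the
  result bounds \<open>u\<close>. Conversely any upper bound of \<open>u\<close> serves every
  \<open>H\<close> selected by \<open>g\<close>, so leastness applies.\<close>

lemma USB_imp_max: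
  assumes "sat e USB"
  shows "\<exists>mx. max_functional mx"
proof -
  obtain \<Psi> where \<Psi>[simp]: "el \<Psi>" "ty \<Psi> = (N \<rightarrowtail> t1) \<rightarrowtail> tg \<rightarrowtail> t1"
    and "\<forall>y. el y \<longrightarrow> ty y = N \<rightarrowtail> t1 \<longrightarrow> (\<forall>H. el H \<longrightarrow> ty H = tH \<longrightarrow> (\<forall>g. el g \<longrightarrow> ty g = tg \<longrightarrow>
        selects y H g \<longrightarrow> (\<forall>k. nt k \<longrightarrow> bound y H k (\<Psi> \<bullet> y \<bullet> g \<bullet> k))))"
    and "\<forall>y. el y \<longrightarrow> ty y = N \<rightarrowtail> t1 \<longrightarrow> (\<forall>g. el g \<longrightarrow> ty g = tg \<longrightarrow> (\<forall>k. nt k \<longrightarrow> (\<forall>n. nt n \<longrightarrow>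
        (\<forall>H. el H \<longrightarrow> ty H = tH \<longrightarrow> selects y H g \<longrightarrow> bound y H k n) \<longrightarrow> \<Psi> \<bullet> y \<bullet> g \<bullet> k \<sqsubseteq> n)))"
    using assms unfolding sat_USB by (elim exE conjE) (rule that)
  note upper = this(3)[rule_format] and least = this(4)[rule_format]
  let ?P = "(''Psi'', (N \<rightarrowtail> t1) \<rightarrowtail> tg \<rightarrowtail> t1)"
  let ?y = "lam vk (Var vb)" and ?g = "lam vx (lam vy (lam vk (Var vu \<cdot> Var vx)))"
  define mx where "mx = ev (e0(?P := \<Psi>)) (lam vb (lam vu (Var ?P \<cdot> ?y \<cdot> ?g \<cdot> zero)))"
  have mx: "el mx" "ty mx = t1 \<rightarrowtail> t2 \<rightarrowtail> N" unfolding mx_def by (simp_all add: vdefs)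
  have "(\<forall>x\<in>box b. u \<bullet> x \<sqsubseteq> mx \<bullet> b \<bullet> u) \<and> (\<forall>n. nt n \<longrightarrow> (\<forall>x\<in>box b. u \<bullet> x \<sqsubseteq> n) \<longrightarrow> mx \<bullet> b \<bullet> u \<sqsubseteq> n)"
    if bu: "el b" "ty b = t1" "el u" "ty u = t2" for b u
  proof -
    define y where "y = ev (e0(?P := \<Psi>, vb := b, vu := u)) ?y"
    define g where "g = ev (e0(?P := \<Psi>, vb := b, vu := u)) ?g"
    have y: "el y" "ty y = N \<rightarrowtail> t1" "nt k \<Longrightarrow> y \<bullet> k = b" for k
      unfolding y_def using bu by (simp_all add: vdefs)
    have g: "el g" "ty g = tg" "el x \<Longrightarrow> ty x = t1 \<Longrightarrow> nt k \<Longrightarrow> g \<bullet> x \<bullet> y \<bullet> k = u \<bullet> x" for x k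
      using bu y(1,2) by (simp_all add: g_def vdefs)
    have mx_eq: "mx \<bullet> b \<bullet> u = \<Psi> \<bullet> y \<bullet> g \<bullet> oo"
      unfolding mx_def y_def g_def using bu by (simp add: vdefs)
    show ?thesis
    proof (intro conjI ballI allI impI)
      fix x assume x: "x \<in> box b"
      let ?H = "ev (e0(vu := u)) (lam vx (lam vy (lam vz (lam vk (monus (Var vu \<cdot> Var vx) (Var vz))))))"
      have H: "el ?H" "ty ?H = tH" using bu by (simp_all add: vdefs)
      have H_eq: "?H \<bullet> x \<bullet> y \<bullet> z \<bullet> k = mon (u \<bullet> x) z" if "el x" "ty x = t1" "nt z" "nt k" for x z k
        using that y bu by (simp add: vdefs)
      have "selects y ?H g" unfolding selects_def using bu y g by (simp add: H_eq)
      then have "bound y ?H oo (\<Psi> \<bullet> y \<bullet> g \<bullet> oo)" using upper[OF y(1,2) H g(1,2) _ nt_0] by blast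
      then obtain z where "nt z" "z \<sqsubseteq> \<Psi> \<bullet> y \<bullet> g \<bullet> oo" "u \<bullet> x \<sqsubseteq> z"
        unfolding bound_def using x y H_eq[of x _ oo] by auto
      then show "u \<bullet> x \<sqsubseteq> mx \<bullet> b \<bullet> u" unfolding mx_eq
        using le_trans[of "u \<bullet> x" z "\<Psi> \<bullet> y \<bullet> g \<bullet> oo"] x bu y g by simp
    next
      fix n assume n: "nt n" and le: "\<forall>x\<in>box b. u \<bullet> x \<sqsubseteq> n"
      show "mx \<bullet> b \<bullet> u \<sqsubseteq> n"
        unfolding mx_eq
      proof (rule least[OF y(1,2) g(1,2) nt_0 n])
        fix H assume "el H" "ty H = tH" and sel: "selects y H g"
        show "bound y H oo n"
          unfolding bound_def
        proof
          fix x assume x: "x \<in> box (y \<bullet> oo)"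
          then have xb: "x \<in> box b" using y by simp
          have "H \<bullet> x \<bullet> y \<bullet> (g \<bullet> x \<bullet> y \<bullet> oo) \<bullet> oo = oo" using sel x nt_0 unfolding selects_def by blast
          then have "H \<bullet> x \<bullet> y \<bullet> (u \<bullet> x) \<bullet> oo = oo" using g xb by simp
          then show "\<exists>z. nt z \<and> z \<sqsubseteq> n \<and> H \<bullet> x \<bullet> y \<bullet> z \<bullet> oo = oo" using le xb bu by (intro exI[of _ "u \<bullet> x"]) simp
        qed
      qed
    qed
  qed
  then show ?thesis unfolding max_functional_def using mx by blast
qed

end

context rca_model
begin

lemma max_imp_UF:
  assumes mx: "max_functional mx"
  shows "sat e UF"
proof -
  note [simp] = max_functionalD(1,2)[OF mx]
  let ?P = "(''Phi'', N \<rightarrowtail> t2)"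
  define \<Theta> where "\<Theta> = ev (e0(vmx := mx)) (lam ?P (lam vy (lam vk (argmaxC \<cdot> Var vmx \<cdot> (Var ?P \<cdot> Var vk) \<cdot> (Var vy \<cdot> Var vk)))))"
  have \<Theta>: "el \<Theta>" "ty \<Theta> = (N \<rightarrowtail> t2) \<rightarrowtail> (N \<rightarrowtail> t1) \<rightarrowtail> N \<rightarrowtail> t1"
    unfolding \<Theta>_def by (simp_all add: vdefs)
  have \<Theta>_eq: "\<Theta> \<bullet> \<Phi> \<bullet> y \<bullet> k = argmaxM \<bullet> mx \<bullet> (\<Phi> \<bullet> k) \<bullet> (y \<bullet> k)"
    if "el \<Phi>" "ty \<Phi> = N \<rightarrowtail> t2" "el y" "ty y = N \<rightarrowtail> t1" "nt k" for \<Phi> y k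
    unfolding \<Theta>_def using that by (simp add: vdefs)
  show ?thesis
    unfolding sat_UF
  proof (intro exI[of _ \<Theta>] conjI)
    show "el \<Theta>" "ty \<Theta> = snd vTheta" using \<Theta> snd_vTheta by simp_all
    then show "sat (e(vTheta := \<Theta>)) UF_matrix"
      unfolding sat_UF_matrix[OF \<open>el \<Theta>\<close> \<open>ty \<Theta> = snd vTheta\<close>]
    proof (intro allI impI conjI)
    fix \<Phi> y k z assume *: "el \<Phi>" "ty \<Phi> = N \<rightarrowtail> t2" "el y" "ty y = N \<rightarrowtail> t1" "nt k" "z \<in> box (y \<bullet> k)"
    show "\<Theta> \<bullet> \<Phi> \<bullet> y \<bullet> j \<in> box (y \<bullet> j)" if "nt j" for j
      using argmax(1)[OF mx, of "y \<bullet> j" "\<Phi> \<bullet> j"] * that by (simp add: \<Theta>_eq)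
    show "\<Phi> \<bullet> k \<bullet> z \<sqsubseteq> \<Phi> \<bullet> k \<bullet> (\<Theta> \<bullet> \<Phi> \<bullet> y \<bullet> k)"
      using argmax(2)[OF mx, of "y \<bullet> k" "\<Phi> \<bullet> k"] max_functionalD(3)[OF mx, of "y \<bullet> k" "\<Phi> \<bullet> k" z] *
      by (simp add: \<Theta>_eq)
    qed
  qed
qed

end

section \<open>Standard functionals\<close>

definition vPsi :: var where "vPsi = (''Psi'', t1 \<rightarrowtail> t2 \<rightarrowtail> N)"
definition vw :: var where "vw = (''w'', t1)"

text \<open>
  The points of the box are parametrised by truncation, as relativisation turns
  \<open>x \<le>\<^sub>1 b\<close> into a weaker condition.
\<close>

definition is_max :: "trm \<Rightarrow> fm" where
  "is_max P = (let t = Var vu \<cdot> (minC \<cdot> Var vx \<cdot> Var vb); p = P \<cdot> Var vb \<cdot> Var vu in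
     All vx (t \<^bold>\<le> p) \<^bold>\<and> All vn (All vx (t \<^bold>\<le> Var vn) \<^bold>\<longrightarrow> (p \<^bold>\<le> Var vn)))"

definition max_formula :: fm where
  "max_formula = All vb (All vu (is_max (Var vPsi)))"

lemma substt_monus [simp]: "substt v s (monus t u) = monus (substt v s t) (substt v s u)"
  by (simp add: monus_def const_def predf_def idN_def Let_def)

lemma subst_leF [simp]: "subst v s (t \<^bold>\<le> u) = (substt v s t \<^bold>\<le> substt v s u)"
  by (simp add: leF_def)

lemma subst_Conj [simp]: "subst v s (A \<^bold>\<and> B) = (subst v s A \<^bold>\<and> subst v s B)"
  by (simp add: Conj_def Neg_def)

lemma subst_max_formula:
  "subst vPsi (Par i (snd vPsi)) max_formula = All vb (All vu (is_max (Par i (snd vPsi))))"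
  by (simp add: max_formula_def is_max_def Let_def vdefs vPsi_def substt_id)

lemma internal_Neg [simp]: "internal (\<^bold>\<not> A) = internal A" by (simp add: Neg_def)
lemma internal_Conj [simp]: "internal (A \<^bold>\<and> B) \<longleftrightarrow> internal A \<and> internal B" by (simp add: Conj_def)
lemma internal_Ex [simp]: "internal (Ex v A) = internal A" by (simp add: Ex_def)
lemma internal_leF [simp]: "internal (t \<^bold>\<le> u)" by (simp add: leF_def)
lemma internal_ltF [simp]: "internal (t \<^bold>< u)" by (simp add: ltF_def)
lemma internal_le1 [simp]: "internal (le1 t u)" by (simp add: le1_def Let_def)
lemma internal_le01 [simp]: "internal (le01 t u)" by (simp add: le01_def Let_def)
lemma internal_eqF [simp]: "internal (eqF \<tau> t u)"
  by (induction \<tau> arbitrary: t u) (auto simp: Let_def BAlll_def)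
lemma internal_Alls [simp]: "internal (Alls vs A) = internal A" by (induction vs) auto
lemma internal_subst [simp]: "internal (subst v s A) = internal A" by (induction A) auto
lemma qfree_internal: "qfree A \<Longrightarrow> internal A" by (induction A) auto

lemma internal_closures: "(\<And>A. A \<in> X \<Longrightarrow> internal A) \<Longrightarrow> B \<in> closures X \<Longrightarrow> internal B"
  by (auto simp: closures_def)

lemma internal_RCA0_omega: "B \<in> RCA0_omega \<Longrightarrow> internal B"
proof -
  have "internal A" if "A \<in> EPRA_schemata" for A
    using that by cases (auto simp: qfree_internal)
  then show "B \<in> RCA0_omega \<Longrightarrow> internal B"
    unfolding RCA0_omega_def EPRA_def QF_AC_def
    by (auto elim!: internal_closures[rotated] simp: qfree_internal)
qed

lemma sentence_RCA0_omega: "B \<in> RCA0_omega \<Longrightarrow> sentence B \<and> pars B = {}"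
  unfolding RCA0_omega_def EPRA_def QF_AC_def using sentence_closures by blast

context rca_model
begin

lemma sat_is_max:
  assumes "wt e" "tyof P = Some (snd vPsi)" "fvt P \<inter> {vb, vu, vx, vn} = {}" "el b" "ty b = t1" "el u" "ty u = t2"
  shows "sat (e(vb := b, vu := u)) (is_max P) \<longleftrightarrow>
    (\<forall>x. el x \<longrightarrow> ty x = t1 \<longrightarrow> u \<bullet> (minM \<bullet> x \<bullet> b) \<sqsubseteq> ev e P \<bullet> b \<bullet> u) \<and>
    (\<forall>n. nt n \<longrightarrow> (\<forall>x. el x \<longrightarrow> ty x = t1 \<longrightarrow> u \<bullet> (minM \<bullet> x \<bullet> b) \<sqsubseteq> n) \<longrightarrow> ev e P \<bullet> b \<bullet> u \<sqsubseteq> n)"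
proof -
  have "ev (e(vb := b, vu := u, vx := x)) P = ev e P" "ev (e(vb := b, vu := u, vn := x)) P = ev e P" for x
    using assms by (auto intro!: ev_cong)
  then show ?thesis
    using assms by (simp add: is_max_def Let_def nt_all vdefs)
qed

text \<open>Of two functionals with the property, each value is an upper bound and lies below every
  other upper bound.\<close>

lemma max_unique:
  "wt e \<Longrightarrow> sat e (subst vPsi (Par 0 (snd vPsi)) max_formula \<^bold>\<longrightarrow> subst vPsi (Par 1 (snd vPsi)) max_formula
     \<^bold>\<longrightarrow> eqF (snd vPsi) (Par 0 (snd vPsi)) (Par 1 (snd vPsi)))"
proof -
  assume e: "wt e"
  let ?P = "\<lambda>i. pr i (snd vPsi)"
  have "?P 0 = ?P 1"
    if s: "sat e (All vb (All vu (is_max (Par 0 (snd vPsi)))))" "sat e (All vb (All vu (is_max (Par 1 (snd vPsi)))))"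
  proof -
    have P: "(\<forall>x. el x \<longrightarrow> ty x = t1 \<longrightarrow> u \<bullet> (minM \<bullet> x \<bullet> b) \<sqsubseteq> ?P i \<bullet> b \<bullet> u) \<and>
        (\<forall>n. nt n \<longrightarrow> (\<forall>x. el x \<longrightarrow> ty x = t1 \<longrightarrow> u \<bullet> (minM \<bullet> x \<bullet> b) \<sqsubseteq> n) \<longrightarrow> ?P i \<bullet> b \<bullet> u \<sqsubseteq> n)"
      if "i = 0 \<or> i = 1" "el b" "ty b = t1" "el u" "ty u = t2" for i b u
    proof -
      have "sat e (All vb (All vu (is_max (Par i (snd vPsi)))))"
        using s that(1) by blast
      then have "sat (e(vb := b, vu := u)) (is_max (Par i (snd vPsi)))"
        using that by (simp add: vb_def vu_def)
      then show ?thesis using sat_is_max[OF e, of "Par i (snd vPsi)" b u] that by simp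
    qed
    have ty: "ty (?P i) = t1 \<rightarrowtail> t2 \<rightarrowtail> N" for i by (simp add: vPsi_def)
    show ?thesis
    proof (rule ext[OF _ _ ty ty])
      fix b assume b: "el b" "ty b = t1"
      show "?P 0 \<bullet> b = ?P 1 \<bullet> b"
      proof (rule ext[of _ _ t2 N])
        fix u assume u: "el u" "ty u = t2"
        have nt: "nt (?P i \<bullet> b \<bullet> u)" for i using b u ty by simp
        show "?P 0 \<bullet> b \<bullet> u = ?P 1 \<bullet> b \<bullet> u"
          by (rule le_antisym[OF _ _ nt nt]) (use P[of 0, OF _ b u] P[of 1, OF _ b u] nt in blast)+
      qed (use b ty in simp_all)
    qed simp_all
  qed
  then show ?thesis
    unfolding subst_max_formula using e by simp
qed

end

lemma wff_is_max: "tyof P = Some (snd vPsi) \<Longrightarrow> wff (is_max P)"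
  by (simp add: is_max_def Let_def vdefs vPsi_def)

lemma pars_is_max [simp]: "pars (is_max P) = parst P"
  by (simp add: is_max_def Let_def)

lemma internal_is_max [simp]: "internal (is_max P)"
  by (simp add: is_max_def Let_def)

lemma fv_Neg [simp]: "fv (\<^bold>\<not> A) = fv A" by (simp add: Neg_def)
lemma fv_Conj [simp]: "fv (A \<^bold>\<and> B) = fv A \<union> fv B" by (simp add: Conj_def)
lemma fv_Ex [simp]: "fv (Ex v A) = fv A - {v}" by (simp add: Ex_def)
lemma fv_Allst [simp]: "fv (Allst v A) = fv A - {v}" by (auto simp: Allst_def)
lemma fv_Exst [simp]: "fv (Exst v A) = fv A - {v}" by (auto simp: Exst_def)
lemma fv_leF [simp]: "fv (t \<^bold>\<le> u) = fvt t \<union> fvt u" by (simp add: leF_def)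
lemma fv_ltF [simp]: "fv (t \<^bold>< u) = fvt t \<union> fvt u" by (simp add: ltF_def)
lemma fv_BAlll [simp]: "v \<notin> fvt t \<Longrightarrow> fv (BAlll v t A) = fvt t \<union> (fv A - {v})" by (auto simp: BAlll_def)
lemma fv_le1 [simp]: "fv (le1 t u) = fvt t \<union> fvt u"
proof -
  have "(fresh t u, N) \<notin> fvt t" "(fresh t u, N) \<notin> fvt u" by simp_all
  then show ?thesis unfolding le1_def Let_def by auto
qed
lemma fv_le01 [simp]: "fv (le01 t u) = fvt t \<union> fvt u"
proof -
  have "(fresh t u, N) \<notin> fvt t" "(fresh t u, N) \<notin> fvt u" by simp_all
  then show ?thesis unfolding le01_def Let_def by auto
qed
lemma fv_eqF [simp]: "fv (eqF \<tau> t u) = fvt t \<union> fvt u"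
proof (induction \<tau> arbitrary: t u)
  case (Fun \<sigma> \<tau>)
  have "(fresh t u, \<sigma>) \<notin> fvt t" "(fresh t u, \<sigma>) \<notin> fvt u" by simp_all
  then show ?case unfolding eqF.simps Let_def fv.simps Fun.IH(2) by auto
next
  case (Seq \<sigma>)
  have "(fresh t u, N) \<notin> fvt t" "(fresh t u, N) \<notin> fvt u" by simp_all
  then show ?case unfolding eqF.simps Let_def fv_Conj by (auto simp: Seq.IH)
qed auto

lemma fv_is_max: "fvt P \<subseteq> {vPsi} \<Longrightarrow> fv (is_max P) = fvt P \<union> {vb, vu}"
  by (auto simp: is_max_def Let_def vdefs vPsi_def)

lemma finite_parset_0: "(\<And>B. B \<in> \<Gamma> \<Longrightarrow> pars B = {}) \<Longrightarrow> parset \<Gamma> = {}"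
  by (auto simp: parset_def)

text \<open>The formal derivation comes from \<open>max_unique\<close> by completeness.
  \<open>RCA0_omega\<close> lacks \<open>st_eq\<close>, so this rests on its axioms being
  internal.\<close>

lemma uniquely_defines_max: "uniquely_defines max_formula vPsi"
proof -
  let ?A = "subst vPsi (Par 0 (snd vPsi)) max_formula \<^bold>\<longrightarrow> subst vPsi (Par 1 (snd vPsi)) max_formula
     \<^bold>\<longrightarrow> eqF (snd vPsi) (Par 0 (snd vPsi)) (Par 1 (snd vPsi))"
  have "RCA0_omega \<turnstile> ?A"
  proof (rule completeness)
    show "sentence B" if "B \<in> RCA0_omega" for B using sentence_RCA0_omega that by blast
    show "finite (parset RCA0_omega)" using sentence_RCA0_omega by (subst finite_parset_0) auto
    show "EPRA \<subseteq> RCA0_omega" by (auto simp: RCA0_omega_def)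
    show "sentence ?A" unfolding subst_max_formula sentence_def by (auto simp: wff_is_max fv_is_max)
    show "closures st_schemata \<subseteq> RCA0_omega \<or> (\<forall>B\<in>insert ?A RCA0_omega. internal B)"
      using internal_RCA0_omega by (auto simp: max_formula_def)
  next
    fix el ap cn pr st and e :: "var \<Rightarrow> ty \<times> trm"
    assume m: "normal_model el fst ap cn pr" and e: "pre_model.wt el fst e"
      and sat: "\<And>B e. B \<in> RCA0_omega \<Longrightarrow> pre_model.sat el fst ap cn pr st e B"
    interpret rca_model el fst ap cn pr st
      by (intro rca_model.intro epra_model.intro m epra_model_axioms.intro rca_model_axioms.intro sat)
        (auto simp: RCA0_omega_def)
    show "pre_model.sat el fst ap cn pr st e ?A" using max_unique e by blast
  qed
  then show ?thesis
    by (auto simp: uniquely_defines_def max_formula_def wff_is_max fv_is_max)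
qed

section \<open>Standardness, choice and transfer in models\<close>

locale omega_model = rca_model +
  assumes sat_Omega: "B \<in> RCA0_Omega \<Longrightarrow> sat e B"
begin

lemma sat_st: "A \<in> st_schemata \<Longrightarrow> wff A \<Longrightarrow> pars A = {} \<Longrightarrow> wt e \<Longrightarrow> sat e A"
  using sat_closures[of A st_schemata] sat_Omega unfolding RCA0_Omega_def by blast

lemma st_cn [simp]: "st (cn c)"
  using sat_st[OF st_closed[of "Con c"], of e0] by simp

lemma st_ap [simp]:
  assumes "el f" "el a" "ty f = ty a \<rightarrowtail> cod (ty f)" "st f" "st a"
  shows "st (f \<bullet> a)"
proof -
  obtain \<sigma> \<tau> where \<sigma>: "ty f = \<sigma> \<rightarrowtail> \<tau>" "ty a = \<sigma>" using assms(3) by metis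
  let ?f = "(''f'', \<sigma> \<rightarrowtail> \<tau>)" and ?a = "(''a'', \<sigma>)"
  have "wt (e0(?f := f, ?a := a))" using assms(1,2) \<sigma> by simp
  from sat_st[OF st_app[of "Var ?f" "Var ?a"] _ _ this] show ?thesis using assms(4,5) by simp
qed

lemma st_le:
  assumes "nt n" "nt m" "st n" "m \<sqsubseteq> n"
  shows "st m"
proof -
  have "wt (e0(vn := n, vm := m))" using assms by (simp add: vdefs)
  from sat_st[OF st_schemata.st_le[of "Var vn" "Var vm"] _ _ this] show ?thesis using assms by (simp add: vdefs)
qed

definition ste :: "(var \<Rightarrow> 'a) \<Rightarrow> bool" where "ste e \<longleftrightarrow> (\<forall>v. st (e v))"

text \<open>Functionals defined below as values of terms in standard objects get their standardness
  from here.\<close>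

lemma st_ev [simp]: "wt e \<Longrightarrow> ste e \<Longrightarrow> tyof t \<noteq> None \<Longrightarrow> parst t = {} \<Longrightarrow> st (ev e t)"
proof (induction t)
  case (App t u)
  then obtain \<sigma> \<tau> where *: "tyof t = Some (\<sigma> \<rightarrowtail> \<tau>)" "tyof u = Some \<sigma>"
    by (auto split: option.splits ty.splits if_splits)
  then show ?case using App by simp
qed (auto simp: ste_def)

lemma ste_e0 [simp]: "ste e0"
proof -
  have z: "tyof (zerot \<tau>) = Some \<tau>" "parst (zerot \<tau>) = {}" for \<tau>
    by (induction \<tau>) (auto simp: const_def)
  have "st (ev e (zerot \<tau>))" for e \<tau>
  proof (induction \<tau>)
    case (Fun \<sigma> \<tau>)
    have "ev e (zerot \<tau>) = ev e0 (zerot \<tau>)"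
      by (rule ev_closed) (use cterm_zerot[of \<tau>] in \<open>simp add: cterm_def\<close>)
    then show ?case using Fun z by (simp add: const_def)
  next
    case (Seq \<sigma>)
    have "ev e (zerot \<sigma>) = ev e0 (zerot \<sigma>)"
      by (rule ev_closed) (use cterm_zerot[of \<sigma>] in \<open>simp add: cterm_def\<close>)
    then show ?case using Seq z by (simp add: const_def)
  qed simp
  then show ?thesis by (simp add: ste_def e0_def)
qed

lemma ste_upd [simp]: "ste e \<Longrightarrow> st d \<Longrightarrow> ste (e(v := d))"
  by (simp add: ste_def)

lemma sat_HAC_int: "B \<in> HAC_int \<Longrightarrow> sat e B"
  by (rule sat_Omega) (simp add: RCA0_Omega_def)

lemma sat_HAC:
  fixes xs y F A
  defines "C \<equiv> Exst F (Allsts xs (Ex y (memF (snd y) (Var y) (foldl App (Var F) (map Var xs)) \<^bold>\<and> A)))"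
  assumes "sat e (Allsts xs (Exst y A))"
    and "internal A" "distinct (y # xs)" "snd F = foldr Fun (map snd xs) (Seq (snd y))" "F \<notin> fv A \<union> set (y # xs)"
    and "wff (Allsts xs (Exst y A))" "wff C" "pars (Allsts xs (Exst y A)) = {}" "pars C = {}" "wt e"
  shows "sat e C"
proof -
  have "sat e (Allsts xs (Exst y A) \<^bold>\<longrightarrow> C)"
  proof (rule sat_closures[OF _ sat_HAC_int[unfolded HAC_int_def]])
    show "(Allsts xs (Exst y A) \<^bold>\<longrightarrow> C) \<in> {Allsts xs (Exst y A)
      \<^bold>\<longrightarrow> Exst F (Allsts xs (Ex y (memF (snd y) (Var y) (foldl App (Var F) (map Var xs)) \<^bold>\<and> A)))
      | xs y F A. internal A \<and> distinct (y # xs) \<and>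
          snd F = foldr Fun (map snd xs) (Seq (snd y)) \<and> F \<notin> fv A \<union> set (y # xs)}"
      unfolding C_def mem_Collect_eq using assms by blast
  qed (use assms in simp_all)
  then show ?thesis using assms by simp
qed

lemma transfer:
  assumes "internal A" "wff A" "pars A = {}" "fv A \<subseteq> set xs" "sat e (Allsts xs A)"
  shows "sat e (Alls xs A)"
proof -
  have "(Allsts xs A \<^bold>\<longrightarrow> Alls xs A) \<in> PF_TP" using assms unfolding PF_TP_def by blast
  then have "sat e (Allsts xs A \<^bold>\<longrightarrow> Alls xs A)" by (intro sat_Omega) (auto simp: RCA0_Omega_def)
  then show ?thesis using assms by simp
qed

text \<open>The index lies below a standard length and is therefore standard.\<close>

lemma st_member: "el s \<Longrightarrow> ty s = Seq \<sigma> \<Longrightarrow> st s \<Longrightarrow> nt i \<Longrightarrow> sc i \<sqsubseteq> cn (Len \<sigma>) \<bullet> s \<Longrightarrow>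
    st (cn (At \<sigma>) \<bullet> s \<bullet> i)"
proof -
  assume *: "el s" "ty s = Seq \<sigma>" "st s" "nt i" "sc i \<sqsubseteq> cn (Len \<sigma>) \<bullet> s"
  then have "st (sc i)" using st_le[of "cn (Len \<sigma>) \<bullet> s" "sc i"] by simp
  then have "st i" using st_le[of "sc i" i] le_S[of i i] * by simp
  then show ?thesis using * by simp
qed

text \<open>Transfer concerns universal statements. Applied to the negated matrix, it turns
  existence into existence of a standard functional.\<close>

lemma standard_UF:
  assumes "sat e UF"
  obtains \<Theta> where "el \<Theta>" "ty \<Theta> = (N \<rightarrowtail> t2) \<rightarrowtail> (N \<rightarrowtail> t1) \<rightarrowtail> N \<rightarrowtail> t1" "st \<Theta>"
    "\<And>\<Phi> y k z. el \<Phi> \<Longrightarrow> ty \<Phi> = N \<rightarrowtail> t2 \<Longrightarrow> el y \<Longrightarrow> ty y = N \<rightarrowtail> t1 \<Longrightarrow> nt k \<Longrightarrow> z \<in> box (y \<bullet> k) \<Longrightarrow>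
        \<Phi> \<bullet> k \<bullet> z \<sqsubseteq> \<Phi> \<bullet> k \<bullet> (\<Theta> \<bullet> \<Phi> \<bullet> y \<bullet> k)"
    "\<And>\<Phi> y k. el \<Phi> \<Longrightarrow> ty \<Phi> = N \<rightarrowtail> t2 \<Longrightarrow> el y \<Longrightarrow> ty y = N \<rightarrowtail> t1 \<Longrightarrow> nt k \<Longrightarrow>
        \<Theta> \<bullet> \<Phi> \<bullet> y \<bullet> k \<in> box (y \<bullet> k)"
proof -
  have "fv UF_matrix \<subseteq> {vTheta}"
    by (auto simp: UF_matrix_def Let_def)
  moreover have "internal UF_matrix" "wff UF_matrix" "pars UF_matrix = {}"
    by (simp_all add: UF_matrix_def Let_def vTheta_def)
  ultimately have "sat e (Allsts [vTheta] (\<^bold>\<not> UF_matrix)) \<Longrightarrow> sat e (Alls [vTheta] (\<^bold>\<not> UF_matrix))"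
    by (intro transfer) simp_all
  then have "\<exists>\<Theta>. el \<Theta> \<and> ty \<Theta> = snd vTheta \<and> st \<Theta> \<and> sat (e(vTheta := \<Theta>)) UF_matrix"
    using assms unfolding sat_UF foldr.simps comp_apply id_apply sat_Allst sat_Neg sat.simps by blast
  then obtain \<Theta> where \<Theta>: "el \<Theta>" "ty \<Theta> = snd vTheta" "st \<Theta>" "sat (e(vTheta := \<Theta>)) UF_matrix" by blast
  show ?thesis
  proof (rule that[OF \<Theta>(1) _ \<Theta>(3)])
    show "ty \<Theta> = (N \<rightarrowtail> t2) \<rightarrowtail> (N \<rightarrowtail> t1) \<rightarrowtail> N \<rightarrowtail> t1" using \<Theta>(2) by (simp add: snd_vTheta)
    fix \<Phi> y k assume *: "el \<Phi>" "ty \<Phi> = N \<rightarrowtail> t2" "el y" "ty y = N \<rightarrowtail> t1" "nt k"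
    show max: "\<Phi> \<bullet> k \<bullet> z \<sqsubseteq> \<Phi> \<bullet> k \<bullet> (\<Theta> \<bullet> \<Phi> \<bullet> y \<bullet> k)" if "z \<in> box (y \<bullet> k)" for z
      using \<Theta>(4)[unfolded sat_UF_matrix[OF \<Theta>(1,2)]] * that by blast
    \<comment> \<open>In UF the clause on membership in the box stands under the quantifier over
      \<open>z\<close>; the point \<open>y \<bullet> k\<close> makes it available.\<close>
    have "y \<bullet> k \<in> box (y \<bullet> k)" using * by (intro box_self) simp_all
    then show "\<Theta> \<bullet> \<Phi> \<bullet> y \<bullet> k \<in> box (y \<bullet> k)"
      using \<Theta>(4)[unfolded sat_UF_matrix[OF \<Theta>(1,2)]] * by blast
  qed
qed

theorem UF_imp_S:
  assumes "sat e UF"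
  shows "sat e' Sprinciple"
proof -
  obtain \<Theta> where \<Theta> [simp]: "el \<Theta>" "ty \<Theta> = (N \<rightarrowtail> t2) \<rightarrowtail> (N \<rightarrowtail> t1) \<rightarrowtail> N \<rightarrowtail> t1" "st \<Theta>"
    and \<Theta>_max: "\<And>\<Phi> y k z. el \<Phi> \<Longrightarrow> ty \<Phi> = N \<rightarrowtail> t2 \<Longrightarrow> el y \<Longrightarrow> ty y = N \<rightarrowtail> t1 \<Longrightarrow> nt k \<Longrightarrow> z \<in> box (y \<bullet> k) \<Longrightarrow>
        \<Phi> \<bullet> k \<bullet> z \<sqsubseteq> \<Phi> \<bullet> k \<bullet> (\<Theta> \<bullet> \<Phi> \<bullet> y \<bullet> k)"
    and \<Theta>_box: "\<And>\<Phi> y k. el \<Phi> \<Longrightarrow> ty \<Phi> = N \<rightarrowtail> t2 \<Longrightarrow> el y \<Longrightarrow> ty y = N \<rightarrowtail> t1 \<Longrightarrow> nt k \<Longrightarrow>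
        \<Theta> \<bullet> \<Phi> \<bullet> y \<bullet> k \<in> box (y \<bullet> k)"
    using standard_UF[OF assms] by blast
  show ?thesis
    unfolding sat_S
  proof (intro allI impI)
    fix y H assume y [simp]: "el y" "ty y = N \<rightarrowtail> t1" "st y" and H [simp]: "el H" "ty H = tH" "st H"
      and hyp: "\<forall>k. nt k \<longrightarrow> st k \<longrightarrow> (\<forall>x. el x \<longrightarrow> ty x = t1 \<longrightarrow> st x \<longrightarrow> x \<in> box (y \<bullet> k) \<longrightarrow>
        (\<exists>z. nt z \<and> st z \<and> H \<bullet> x \<bullet> y \<bullet> z \<bullet> k = oo))"
    \<comment> \<open>\<open>HAC_int\<close> asks for a value at every standard argument, so points
      outside the box get 0 and membership moves into the internal formula.\<close>
    have hyp': "\<exists>z. el z \<and> ty z = N \<and> st z \<and> (x \<in> box (y \<bullet> k) \<longrightarrow> H \<bullet> x \<bullet> y \<bullet> z \<bullet> k = oo)"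
      if "el k" "ty k = N" "st k" "el x" "ty x = t1" "st x" for k x
    proof (cases "x \<in> box (y \<bullet> k)")
      case True
      then show ?thesis using hyp ntI that by (metis nt_def)
    next
      case False
      then show ?thesis using st_cn[of Zero] by (metis el_cn ty_cn contype.simps(1))
    qed
    let ?F = "(''F'', N \<rightarrowtail> t1 \<rightarrowtail> Seq N)" and ?A = "le1 (Var vx) (Var vy \<cdot> Var vk) \<^bold>\<longrightarrow> H0 (Var vz)"
    let ?e = "e0(vy := y, vH := H)"
    have "sat ?e (Exst ?F (Allsts [vk, vx] (Ex vz (memF (snd vz) (Var vz)
        (foldl App (Var ?F) (map Var [vk, vx])) \<^bold>\<and> ?A))))"
    proof (rule sat_HAC)
      show "sat ?e (Allsts [vk, vx] (Exst vz ?A))"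
        using hyp' by (simp add: vdefs vH_def H0_def sat_le1_box del: boxD)
    qed (simp_all add: vdefs vH_def H0_def)
    then obtain F where F [simp]: "el F" "ty F = N \<rightarrowtail> t1 \<rightarrowtail> Seq N" "st F"
      and F_mem: "\<And>k x. el k \<Longrightarrow> ty k = N \<Longrightarrow> st k \<Longrightarrow> el x \<Longrightarrow> ty x = t1 \<Longrightarrow> st x \<Longrightarrow>
        \<exists>z. el z \<and> ty z = N \<and> (\<exists>i. el i \<and> ty i = N \<and> sc i \<sqsubseteq> cn (Len N) \<bullet> (F \<bullet> k \<bullet> x) \<and>
            z = cn (At N) \<bullet> (F \<bullet> k \<bullet> x) \<bullet> i) \<and> (x \<in> box (y \<bullet> k) \<longrightarrow> H \<bullet> x \<bullet> y \<bullet> z \<bullet> k = oo)"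
      by (simp add: vdefs vH_def H0_def sat_le1_box cong: conj_cong del: boxD) blast
    let ?s = "Var ?F \<cdot> Var vk \<cdot> Var vx"
    have tyof_idN [simp]: "tyof idN = Some (N \<rightarrowtail> N)" "parst idN = {}" by (simp_all add: idN_def)
    define idM where "idM = ev e0 idN"
    have idM [simp]: "el idM" "ty idM = N \<rightarrowtail> N" "nt n \<Longrightarrow> idM \<bullet> n = n" "ev e idN = idM" for n e
      unfolding idM_def by (simp_all add: idN_def)
    \<comment> \<open>One of the finitely many candidates is a witness, though it is not known
      which; the largest bounds it. The entries are themselves numbers, hence the identity as
      weight.\<close>
    define g where "g = ev (e0(?F := F)) (lam vk (lam vx (lmaxC N \<cdot> idN \<cdot> ?s \<cdot> len N ?s)))"
    have g [simp]: "el g" "ty g = N \<rightarrowtail> t2" "st g" unfolding g_def by (simp_all add: vdefs)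
    have g_eq: "g \<bullet> k \<bullet> x = lmaxM N \<bullet> idM \<bullet> (F \<bullet> k \<bullet> x) \<bullet> (cn (Len N) \<bullet> (F \<bullet> k \<bullet> x))"
      if "nt k" "el x" "ty x = t1" for k x
      unfolding g_def using that by (simp add: vdefs)
    define m where "m = ev (e0((''g'', N \<rightarrowtail> t2) := g, vy := y, (''T'', ty \<Theta>) := \<Theta>))
      (lam vk (Var (''g'', N \<rightarrowtail> t2) \<cdot> Var vk \<cdot> (Var (''T'', ty \<Theta>) \<cdot> Var (''g'', N \<rightarrowtail> t2) \<cdot> Var vy \<cdot> Var vk)))"
    have m [simp]: "el m" "ty m = t1" "st m" unfolding m_def by (simp_all add: vdefs)
    have m_eq: "m \<bullet> k = g \<bullet> k \<bullet> (\<Theta> \<bullet> g \<bullet> y \<bullet> k)" if "nt k" for k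
      unfolding m_def using that by (simp add: vdefs)
    define h where "h k x = ev (e0(vy := y, vH := H, vk := k, vx := x)) (lam vz (Var vH \<cdot> Var vx \<cdot> Var vy \<cdot> Var vz \<cdot> Var vk))" for k x
    have h: "el (h k x)" "ty (h k x) = t1" "nt z \<Longrightarrow> h k x \<bullet> z = H \<bullet> x \<bullet> y \<bullet> z \<bullet> k"
      if "nt k" "el x" "ty x = t1" for k x z
      unfolding h_def using that by (simp_all add: vdefs vH_def)
    \<comment> \<open>Value 0 if there is a witness of at most \<open>m k\<close>, and 1 otherwise.
      The search is strict, hence the successor.\<close>
    define \<Phi> where "\<Phi> = ev (e0(vy := y, vH := H, (''m'', t1) := m)) (lam vk (lam vx
      (srchC \<cdot> (lam vz (Var vH \<cdot> Var vx \<cdot> Var vy \<cdot> Var vz \<cdot> Var vk)) \<cdot> suc (Var (''m'', t1) \<cdot> Var vk))))"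
    have \<Phi> [simp]: "el \<Phi>" "ty \<Phi> = N \<rightarrowtail> t2" "st \<Phi>" unfolding \<Phi>_def by (simp_all add: vdefs vH_def)
    have \<Phi>_eq: "\<Phi> \<bullet> k \<bullet> x = srchM \<bullet> h k x \<bullet> sc (m \<bullet> k)" if "nt k" "el x" "ty x = t1" for k x
    proof -
      have "ev (e0(vy := y, vH := H, (''m'', t1) := m, vk := k, vx := x)) t = ev (e0(vy := y, vH := H, vk := k, vx := x)) t"
        if "(''m'', t1) \<notin> fvt t" for t
        using that by (intro ev_cong) auto
      then show ?thesis unfolding \<Phi>_def h_def using that by (simp add: vdefs vH_def)
    qed
    show "\<exists>\<xi>. el \<xi> \<and> ty \<xi> = t1 \<and> st \<xi> \<and> (\<forall>k. nt k \<longrightarrow> st k \<longrightarrow> bound y H k (\<xi> \<bullet> k))"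
    proof (intro exI[of _ m] conjI allI impI)
      fix k assume k [simp]: "nt k" "st k"
      have st0: "\<Phi> \<bullet> k \<bullet> x = oo" if x: "x \<in> box (y \<bullet> k)" "st x" for x
      proof -
        obtain i z where z: "nt i" "sc i \<sqsubseteq> cn (Len N) \<bullet> (F \<bullet> k \<bullet> x)" "z = cn (At N) \<bullet> (F \<bullet> k \<bullet> x) \<bullet> i"
          "nt z" "H \<bullet> x \<bullet> y \<bullet> z \<bullet> k = oo"
          using F_mem[OF nt_el[OF k(1)] nt_ty[OF k(1)] k(2) boxD(1,2)[OF x(1)] x(2)] x(1)
          unfolding nt_def by blast
        have "z \<sqsubseteq> g \<bullet> k \<bullet> x"
          using lmax_ge[of idM N "F \<bullet> k \<bullet> x" i "cn (Len N) \<bullet> (F \<bullet> k \<bullet> x)"] z(1-4) x by (simp add: g_eq)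
        moreover have "g \<bullet> k \<bullet> x \<sqsubseteq> m \<bullet> k" using \<Theta>_max[of g y k x] x m_eq by simp
        ultimately have "z \<sqsubseteq> m \<bullet> k" using le_trans[of z "g \<bullet> k \<bullet> x" "m \<bullet> k"] z(4) x by simp
        then show ?thesis
          using srch_0[of "h k x" z "sc (m \<bullet> k)"] h[of k x] z(4,5) x by (simp add: \<Phi>_eq del: mon_S)
      qed
      show "bound y H k (m \<bullet> k)"
        unfolding bound_def
      proof
        fix x assume x: "x \<in> box (y \<bullet> k)"
        let ?x = "\<Theta> \<bullet> \<Phi> \<bullet> y \<bullet> k"
        have "\<Phi> \<bullet> k \<bullet> x \<sqsubseteq> \<Phi> \<bullet> k \<bullet> ?x" by (rule \<Theta>_max) (use x in simp_all)
        \<comment> \<open>The point of maximum is computed from standard objects and so is standard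
          itself, where the value is known to be 0.\<close>
        moreover have "\<Phi> \<bullet> k \<bullet> ?x = oo" using st0[of ?x] \<Theta>_box[of \<Phi> y k] by simp
        ultimately have "srchM \<bullet> h k x \<bullet> sc (m \<bullet> k) = oo"
          using x \<Phi>_eq[of k x] h(1,2)[OF k(1) boxD(1,2)[OF x]] by simp
        then obtain i where "nt i" "sc i \<sqsubseteq> sc (m \<bullet> k)" "h k x \<bullet> i = oo"
          using srch_witness[of "h k x" "sc (m \<bullet> k)"] h[of k x] x by auto
        then show "\<exists>z. nt z \<and> z \<sqsubseteq> m \<bullet> k \<and> H \<bullet> x \<bullet> y \<bullet> z \<bullet> k = oo"
          using h[of k x] x by (intro exI[of _ i]) (simp del: mon_S)
      qed
    qed simp_all
  qed
qed

text \<open>The principle for a single box: \<open>y\<close> is constant, \<open>H\<close> depends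
  on \<open>x\<close> and \<open>z\<close> alone, and the bound is taken at the standard index
  0.\<close>

lemma S_instance:
  assumes S: "sat e Sprinciple" and b [simp]: "el b" "ty b = t1" "st b"
    and h [simp]: "el h" "ty h = t1 \<rightarrowtail> t1" "st h"
    and hyp: "\<And>x. x \<in> box b \<Longrightarrow> st x \<Longrightarrow> \<exists>z. nt z \<and> st z \<and> h \<bullet> x \<bullet> z = oo"
  shows "\<exists>m. nt m \<and> st m \<and> (\<forall>x\<in>box b. \<exists>z. nt z \<and> z \<sqsubseteq> m \<and> h \<bullet> x \<bullet> z = oo)"
proof -
  let ?h = "(''h'', t1 \<rightarrowtail> t1)"
  define y where "y = ev (e0(vb := b)) (lam vk (Var vb))"
  define H where "H = ev (e0(?h := h)) (lam vx (lam vy (lam vz (lam vk (Var ?h \<cdot> Var vx \<cdot> Var vz)))))"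
  have y: "el y" "ty y = N \<rightarrowtail> t1" "st y" "nt k \<Longrightarrow> y \<bullet> k = b" for k
    unfolding y_def by (simp_all add: vdefs)
  have H: "el H" "ty H = tH" "st H" "el x \<Longrightarrow> ty x = t1 \<Longrightarrow> nt z \<Longrightarrow> nt k \<Longrightarrow> H \<bullet> x \<bullet> y \<bullet> z \<bullet> k = h \<bullet> x \<bullet> z" for x z k
    unfolding H_def using y(1,2) by (simp_all add: vdefs)
  have "\<exists>\<xi>. el \<xi> \<and> ty \<xi> = t1 \<and> st \<xi> \<and> (\<forall>k. nt k \<longrightarrow> st k \<longrightarrow> bound y H k (\<xi> \<bullet> k))"
  proof (rule S[unfolded sat_S, rule_format, OF y(1-3) H(1-3)])
    fix k x assume "nt k" "el x" "ty x = t1" "st x" "x \<in> box (y \<bullet> k)"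
    then show "\<exists>z. nt z \<and> st z \<and> H \<bullet> x \<bullet> y \<bullet> z \<bullet> k = oo" using hyp[of x] y(4) H(4) by auto
  qed
  then obtain \<xi> where \<xi>: "el \<xi>" "ty \<xi> = t1" "st \<xi>" "bound y H oo (\<xi> \<bullet> oo)" using st_cn nt_0 by blast
  have "\<exists>z. nt z \<and> z \<sqsubseteq> \<xi> \<bullet> oo \<and> h \<bullet> x \<bullet> z = oo" if "x \<in> box b" for x
    using \<xi>(4) that y(4)[of oo] H(4)[of x _ oo] unfolding bound_def by fastforce
  then show ?thesis using \<xi> by (intro exI[of _ "\<xi> \<bullet> oo"]) simp
qed

text \<open>
  The natural numbers below some value at a standard point are cut out by an external formula.
  For standard \<open>n\<close>, it is equivalent to \<open>n \<le> d n\<close> where \<open>d n\<close> is the greatest value on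
  a standard list of candidates, and this is open to quantifier-free induction.
\<close>

lemma standard_argmax:
  assumes S: "sat e Sprinciple" and b [simp]: "el b" "ty b = t1" "st b" and u [simp]: "el u" "ty u = t2" "st u"
  shows "\<exists>x. el x \<and> ty x = t1 \<and> st x \<and>
    (\<forall>w. el w \<longrightarrow> ty w = t1 \<longrightarrow> u \<bullet> (minM \<bullet> w \<bullet> b) \<sqsubseteq> u \<bullet> (minM \<bullet> x \<bullet> b))"
proof -
  \<comment> \<open>At a standard point \<open>x\<close>, the value \<open>u(x)\<close> is its own
    standard witness.\<close>
  have bounded: "\<exists>m. nt m \<and> st m \<and> (\<forall>x\<in>box b. u \<bullet> x \<sqsubseteq> m)"
  proof -
    define h where "h = ev (e0(vu := u)) (lam vx (lam vz (monus (Var vu \<cdot> Var vx) (Var vz))))"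
    have h: "el h" "ty h = t1 \<rightarrowtail> t1" "st h" "el x \<Longrightarrow> ty x = t1 \<Longrightarrow> nt z \<Longrightarrow> h \<bullet> x \<bullet> z = mon (u \<bullet> x) z" for x z
      unfolding h_def by (simp_all add: vdefs)
    have "\<exists>z. nt z \<and> st z \<and> h \<bullet> x \<bullet> z = oo" if "x \<in> box b" "st x" for x
      using that h by (intro exI[of _ "u \<bullet> x"]) simp
    then obtain m where m: "nt m" "st m" "\<forall>x\<in>box b. \<exists>z. nt z \<and> z \<sqsubseteq> m \<and> h \<bullet> x \<bullet> z = oo"
      using S_instance[OF S b h(1-3)] by blast
    have "u \<bullet> x \<sqsubseteq> m" if x: "x \<in> box b" for x
    proof -
      obtain z where z: "nt z" "z \<sqsubseteq> m" "h \<bullet> x \<bullet> z = oo" using m x by blast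
      then show ?thesis using le_trans[of "u \<bullet> x" z m] m h(4) x by simp
    qed
    then show ?thesis using m by blast
  qed
  \<comment> \<open>Here \<open>h\<close> does not depend on \<open>z\<close>. So 0 is a witness at
    each standard point, and the principle carries the inequality to all points of the box.\<close>
  have standard_part: "\<forall>x\<in>box b. sc (u \<bullet> x) \<sqsubseteq> n"
    if n: "nt n" "st n" and le: "\<And>x. x \<in> box b \<Longrightarrow> st x \<Longrightarrow> sc (u \<bullet> x) \<sqsubseteq> n" for n
  proof -
    define h where "h = ev (e0(vu := u, vn := n)) (lam vx (lam vz (monus (suc (Var vu \<cdot> Var vx)) (Var vn))))"
    have h: "el h" "ty h = t1 \<rightarrowtail> t1" "st h" "el x \<Longrightarrow> ty x = t1 \<Longrightarrow> nt z \<Longrightarrow> h \<bullet> x \<bullet> z = mon (sc (u \<bullet> x)) n" for x z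
      unfolding h_def using n by (simp_all add: vdefs)
    have "\<exists>z. nt z \<and> st z \<and> h \<bullet> x \<bullet> z = oo" if "x \<in> box b" "st x" for x
      using that h le by (intro exI[of _ oo]) simp
    then show ?thesis using S_instance[OF S b h(1-3)] h(4) by fastforce
  qed
  \<comment> \<open>Truncation lets the comparisons below range over all arguments, without a bound
    on the quantifier.\<close>
  define v where "v = ev (e0(vu := u, vb := b)) (lam vx (Var vu \<cdot> (minC \<cdot> Var vx \<cdot> Var vb)))"
  have v [simp]: "el v" "ty v = t2" "st v" unfolding v_def by (simp_all add: vdefs)
  have v_eq: "v \<bullet> x = u \<bullet> (minM \<bullet> x \<bullet> b)" if "el x" "ty x = t1" for x
    unfolding v_def using that by (simp add: vdefs)
  obtain m where m: "nt m" "st m" "\<And>x. el x \<Longrightarrow> ty x = t1 \<Longrightarrow> v \<bullet> x \<sqsubseteq> m"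
    using bounded min_box v_eq by auto
  \<comment> \<open>If no standard point reaches \<open>n\<close>, then by
    \<open>standard_part\<close> no point does.\<close>
  have ex: "\<exists>x. el x \<and> ty x = t1 \<and> st x \<and> (n \<sqsubseteq> v \<bullet> x \<or> (\<forall>w. el w \<longrightarrow> ty w = t1 \<longrightarrow> sc (v \<bullet> w) \<sqsubseteq> n))"
    if n: "nt n" "st n" for n
  proof (cases "\<exists>x. x \<in> box b \<and> st x \<and> n \<sqsubseteq> u \<bullet> x")
    case True
    then obtain x where x: "x \<in> box b" "st x" "n \<sqsubseteq> u \<bullet> x" by blast
    then show ?thesis using v_eq[of x] min_eq[of x b] by (intro exI[of _ x]) simp
  next
    case False
    then have "sc (u \<bullet> x) \<sqsubseteq> n" if "x \<in> box b" "st x" for x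
      using not_le[of n "u \<bullet> x"] that n by auto
    then have "\<forall>x\<in>box b. sc (u \<bullet> x) \<sqsubseteq> n" by (rule standard_part[OF n])
    then have "sc (v \<bullet> w) \<sqsubseteq> n" if "el w" "ty w = t1" for w using v_eq min_box that by simp
    then show ?thesis by (intro exI[of _ b]) simp
  qed
  let ?F = "(''F'', N \<rightarrowtail> Seq t1)"
  \<comment> \<open>The second alternative speaks of all points rather than the standard ones, and
    so is internal as \<open>HAC_int\<close> requires.\<close>
  let ?A = "(\<^bold>\<not> (Var vn \<^bold>\<le> Var vu \<cdot> Var vx)) \<^bold>\<longrightarrow> All vw (suc (Var vu \<cdot> Var vw) \<^bold>\<le> Var vn)"
  have "sat (e0(vu := v)) (Exst ?F (Allsts [vn] (Ex vx (memF (snd vx) (Var vx)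
      (foldl App (Var ?F) (map Var [vn])) \<^bold>\<and> ?A))))"
  proof (rule sat_HAC)
    show "sat (e0(vu := v)) (Allsts [vn] (Exst vx ?A))"
      using ex[OF ntI] by (simp add: vdefs vw_def) blast
  qed (simp_all add: vdefs vw_def)
  then obtain F where F [simp]: "el F" "ty F = N \<rightarrowtail> Seq t1" "st F"
    and F_mem: "\<And>n. el n \<Longrightarrow> ty n = N \<Longrightarrow> st n \<Longrightarrow> \<exists>x. el x \<and> ty x = t1 \<and>
        (\<exists>i. el i \<and> ty i = N \<and> sc i \<sqsubseteq> cn (Len t1) \<bullet> (F \<bullet> n) \<and> x = cn (At t1) \<bullet> (F \<bullet> n) \<bullet> i) \<and>
        (\<not> n \<sqsubseteq> v \<bullet> x \<longrightarrow> (\<forall>w. el w \<longrightarrow> ty w = t1 \<longrightarrow> sc (v \<bullet> w) \<sqsubseteq> n))"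
    by (simp add: vdefs vw_def cong: conj_cong) blast
  let ?d = "\<lambda>n. lmaxM t1 \<bullet> v \<bullet> (F \<bullet> n) \<bullet> (cn (Len t1) \<bullet> (F \<bullet> n))"
  have F_cases: "(\<exists>x. el x \<and> ty x = t1 \<and> st x \<and> n \<sqsubseteq> v \<bullet> x \<and> v \<bullet> x \<sqsubseteq> ?d n) \<or>
      (\<forall>w. el w \<longrightarrow> ty w = t1 \<longrightarrow> sc (v \<bullet> w) \<sqsubseteq> n)" if n: "nt n" "st n" for n
  proof -
    obtain x i where x: "el x" "ty x = t1" "nt i" "sc i \<sqsubseteq> cn (Len t1) \<bullet> (F \<bullet> n)" "x = cn (At t1) \<bullet> (F \<bullet> n) \<bullet> i"
      "\<not> n \<sqsubseteq> v \<bullet> x \<longrightarrow> (\<forall>w. el w \<longrightarrow> ty w = t1 \<longrightarrow> sc (v \<bullet> w) \<sqsubseteq> n)"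
      using F_mem[OF nt_el[OF n(1)] nt_ty[OF n(1)] n(2)] unfolding nt_def by blast
    have "v \<bullet> x \<sqsubseteq> ?d n" using lmax_ge[of v t1 "F \<bullet> n" i "cn (Len t1) \<bullet> (F \<bullet> n)"] x n by simp
    moreover have "st x" unfolding x(5) by (rule st_member) (use x(3,4) n in simp_all)
    ultimately show ?thesis using x by blast
  qed
  have d_le: "?d n \<sqsubseteq> c" if "nt n" "nt c" "\<And>w. el w \<Longrightarrow> ty w = t1 \<Longrightarrow> v \<bullet> w \<sqsubseteq> c" for n c
    using that by (intro lmax_le) simp_all
  have "\<exists>n. nt n \<and> st n \<and> n \<sqsubseteq> ?d n \<and> \<not> sc n \<sqsubseteq> ?d (sc n)"
  proof (rule ccontr)
    assume *: "\<not> ?thesis"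
    \<comment> \<open>The restriction to \<open>sc m\<close> keeps \<open>n\<close> standard in the
      induction step, and still reaches \<open>sc m\<close>, which no value of \<open>v\<close>
      attains.\<close>
    have "n \<sqsubseteq> sc m \<longrightarrow> n \<sqsubseteq> ?d n" if "nt n" for n
    proof (rule ind[where A = "(Var vn \<^bold>\<le> suc (Var vm)) \<^bold>\<longrightarrow>
          (Var vn \<^bold>\<le> lmaxC t1 \<cdot> Var vu \<cdot> (Var ?F \<cdot> Var vn) \<cdot> len t1 (Var ?F \<cdot> Var vn))" and v = vn
          and e = "e0(vu := v, ?F := F, vm := m)" and P = "\<lambda>n. n \<sqsubseteq> sc m \<longrightarrow> n \<sqsubseteq> ?d n"])
      fix n assume n: "nt n" and IH: "n \<sqsubseteq> sc m \<longrightarrow> n \<sqsubseteq> ?d n"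
      show "sc n \<sqsubseteq> sc m \<longrightarrow> sc n \<sqsubseteq> ?d (sc n)"
      proof
        assume "sc n \<sqsubseteq> sc m"
        then have le: "n \<sqsubseteq> m" using n m by (simp del: mon_S)
        then have "st n" using st_le[of m n] n m by simp
        moreover have "n \<sqsubseteq> ?d n" using IH le le_S n m by blast
        ultimately show "sc n \<sqsubseteq> ?d (sc n)" using * n by blast
      qed
    qed (use that m(1) in \<open>simp_all add: vdefs\<close>)
    then have "sc m \<sqsubseteq> ?d (sc m)" using m(1) by (simp del: mon_S)
    moreover have "?d (sc m) \<sqsubseteq> m" using d_le[of "sc m" m] m by simp
    ultimately have "sc m \<sqsubseteq> m" using le_trans[of "sc m" "?d (sc m)" m] m(1) by simp
    then show False using m by simp
  qed
  then obtain n where n: "nt n" "st n" "n \<sqsubseteq> ?d n" "\<not> sc n \<sqsubseteq> ?d (sc n)" by blast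
  \<comment> \<open>\<open>sc n\<close> is out of reach on its list, so the second alternative must
    hold for it.\<close>
  have upper: "v \<bullet> w \<sqsubseteq> n" if w: "el w" "ty w = t1" for w
  proof -
    have "\<not> (\<exists>x. el x \<and> ty x = t1 \<and> st x \<and> sc n \<sqsubseteq> v \<bullet> x \<and> v \<bullet> x \<sqsubseteq> ?d (sc n))"
    proof
      assume "\<exists>x. el x \<and> ty x = t1 \<and> st x \<and> sc n \<sqsubseteq> v \<bullet> x \<and> v \<bullet> x \<sqsubseteq> ?d (sc n)"
      then obtain x where "el x" "ty x = t1" "sc n \<sqsubseteq> v \<bullet> x" "v \<bullet> x \<sqsubseteq> ?d (sc n)" by blast
      then have "sc n \<sqsubseteq> ?d (sc n)" using le_trans[of "sc n" "v \<bullet> x" "?d (sc n)"] n(1) by simp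
      then show False using n by blast
    qed
    then have "sc (v \<bullet> w) \<sqsubseteq> sc n" using F_cases[of "sc n"] n w by (simp del: mon_S le_SS) blast
    then show ?thesis using n w by (simp del: mon_S)
  qed
  \<comment> \<open>Otherwise all values were below \<open>n\<close>, hence also the greatest one on
    the list for \<open>n\<close>.\<close>
  have "\<not> (\<forall>w. el w \<longrightarrow> ty w = t1 \<longrightarrow> sc (v \<bullet> w) \<sqsubseteq> n)"
  proof
    assume *: "\<forall>w. el w \<longrightarrow> ty w = t1 \<longrightarrow> sc (v \<bullet> w) \<sqsubseteq> n"
    from n(1) show False
    proof (cases rule: nt_cases)
      case 1
      then show False using *[rule_format, of b] by simp
    next
      case (2 j)
      have "?d n \<sqsubseteq> j" using * 2 n(1) by (intro d_le) (simp_all del: mon_S)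
      then have "n \<sqsubseteq> j" using le_trans[of n "?d n" j] n 2 by (simp del: mon_S)
      then show False using 2 by simp
    qed
  qed
  then obtain x where x: "el x" "ty x = t1" "st x" "n \<sqsubseteq> v \<bullet> x" using F_cases[OF n(1,2)] by blast
  have "v \<bullet> w \<sqsubseteq> v \<bullet> x" if "el w" "ty w = t1" for w
    using le_trans[of "v \<bullet> w" n "v \<bullet> x"] upper[OF that] x n that by simp
  then show ?thesis using x v_eq by auto
qed

theorem S_imp_max:
  assumes S: "sat e Sprinciple"
  shows "\<exists>mx. max_functional mx"
proof -
  let ?F = "(''F'', t1 \<rightarrowtail> t2 \<rightarrowtail> Seq t1)"
  let ?A = "All vw (Var vu \<cdot> (minC \<cdot> Var vw \<cdot> Var vb) \<^bold>\<le> Var vu \<cdot> (minC \<cdot> Var vx \<cdot> Var vb))"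
  have "sat e0 (Exst ?F (Allsts [vb, vu] (Ex vx (memF (snd vx) (Var vx)
      (foldl App (Var ?F) (map Var [vb, vu])) \<^bold>\<and> ?A))))"
  proof (rule sat_HAC)
    show "sat e0 (Allsts [vb, vu] (Exst vx ?A))"
      using standard_argmax[OF S] by (simp add: vdefs vw_def)
  qed (simp_all add: vdefs vw_def)
  then obtain F where F [simp]: "el F" "ty F = t1 \<rightarrowtail> t2 \<rightarrowtail> Seq t1" "st F"
    and F_mem: "\<And>b u. el b \<Longrightarrow> ty b = t1 \<Longrightarrow> st b \<Longrightarrow> el u \<Longrightarrow> ty u = t2 \<Longrightarrow> st u \<Longrightarrow>
      \<exists>x. el x \<and> ty x = t1 \<and>
        (\<exists>i. el i \<and> ty i = N \<and> sc i \<sqsubseteq> cn (Len t1) \<bullet> (F \<bullet> b \<bullet> u) \<and> x = cn (At t1) \<bullet> (F \<bullet> b \<bullet> u) \<bullet> i) \<and>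
        (\<forall>w. el w \<longrightarrow> ty w = t1 \<longrightarrow> u \<bullet> (minM \<bullet> w \<bullet> b) \<sqsubseteq> u \<bullet> (minM \<bullet> x \<bullet> b))"
    by (simp add: vdefs vw_def cong: conj_cong) blast
  let ?s = "Var ?F \<cdot> Var vb \<cdot> Var vu" and ?v = "lam vx (Var vu \<cdot> (minC \<cdot> Var vx \<cdot> Var vb))"
  \<comment> \<open>At standard \<open>b\<close> and \<open>u\<close> the list contains a point of
    maximum, so the greatest value on it is the maximum itself.\<close>
  define \<Psi> where "\<Psi> = ev (e0(?F := F)) (lam vb (lam vu (lmaxC t1 \<cdot> ?v \<cdot> ?s \<cdot> len t1 ?s)))"
  have \<Psi> [simp]: "el \<Psi>" "ty \<Psi> = t1 \<rightarrowtail> t2 \<rightarrowtail> N" "st \<Psi>" unfolding \<Psi>_def by (simp_all add: vdefs)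
  \<comment> \<open>Standardness of the point is recorded because the relativised leastness clause
    looks at values in standard points only.\<close>
  have \<Psi>_max: "\<exists>x. el x \<and> ty x = t1 \<and> st x \<and> \<Psi> \<bullet> b \<bullet> u = u \<bullet> (minM \<bullet> x \<bullet> b) \<and>
      (\<forall>w. el w \<longrightarrow> ty w = t1 \<longrightarrow> u \<bullet> (minM \<bullet> w \<bullet> b) \<sqsubseteq> \<Psi> \<bullet> b \<bullet> u)"
    if bu [simp]: "el b" "ty b = t1" "st b" "el u" "ty u = t2" "st u" for b u
  proof -
    define v where "v = ev (e0(?F := F, vb := b, vu := u)) ?v"
    have v [simp]: "el v" "ty v = t2" unfolding v_def by (simp_all add: vdefs)
    have v_eq: "v \<bullet> x = u \<bullet> (minM \<bullet> x \<bullet> b)" if "el x" "ty x = t1" for x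
      unfolding v_def using that by (simp add: vdefs)
    have \<Psi>_eq: "\<Psi> \<bullet> b \<bullet> u = lmaxM t1 \<bullet> v \<bullet> (F \<bullet> b \<bullet> u) \<bullet> (cn (Len t1) \<bullet> (F \<bullet> b \<bullet> u))"
      unfolding \<Psi>_def v_def by (simp add: vdefs)
    obtain x i where x: "el x" "ty x = t1" "nt i" "sc i \<sqsubseteq> cn (Len t1) \<bullet> (F \<bullet> b \<bullet> u)" "x = cn (At t1) \<bullet> (F \<bullet> b \<bullet> u) \<bullet> i"
      "\<forall>w. el w \<longrightarrow> ty w = t1 \<longrightarrow> u \<bullet> (minM \<bullet> w \<bullet> b) \<sqsubseteq> u \<bullet> (minM \<bullet> x \<bullet> b)"
      using F_mem[OF bu] unfolding nt_def by blast
    have x_max: "v \<bullet> w \<sqsubseteq> v \<bullet> x" if "el w" "ty w = t1" for w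
      using x(6) that v_eq[OF that] v_eq[OF x(1,2)] by simp
    have "\<Psi> \<bullet> b \<bullet> u \<sqsubseteq> v \<bullet> x" unfolding \<Psi>_eq by (rule lmax_le) (use x(1-4) x_max in simp_all)
    moreover have "v \<bullet> x \<sqsubseteq> \<Psi> \<bullet> b \<bullet> u"
      unfolding \<Psi>_eq unfolding x(5) by (rule lmax_ge) (use x(3,4) in simp_all)
    ultimately have "\<Psi> \<bullet> b \<bullet> u = v \<bullet> x" by (rule le_antisym) (use x(1,2) in simp_all)
    moreover have "st x" unfolding x(5) by (rule st_member) (use x(3,4) in simp_all)
    ultimately show ?thesis using x(1,2,6) v_eq[OF x(1,2)] by (intro exI[of _ x]) simp
  qed
  let ?O = "Con (Omega vPsi max_formula)"
  have "Omega_axiom vPsi max_formula \<in> RCA0_Omega"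
    using uniquely_defines_max unfolding RCA0_Omega_def Omega_axioms_def by blast
  then have "sat (e0(vPsi := \<Psi>)) (relst max_formula \<^bold>\<longrightarrow> relst (eqF (snd vPsi) ?O (Var vPsi)))"
    using sat_Omega[of "Omega_axiom vPsi max_formula" e0] unfolding Omega_axiom_def
    by (simp add: vPsi_def)
  moreover have "sat (e0(vPsi := \<Psi>)) (relst max_formula)"
  proof -
    have "\<Psi> \<bullet> b \<bullet> u \<sqsubseteq> n" if "el b" "ty b = t1" "st b" "el u" "ty u = t2" "st u"
      "\<forall>x. el x \<longrightarrow> ty x = t1 \<longrightarrow> st x \<longrightarrow> u \<bullet> (minM \<bullet> x \<bullet> b) \<sqsubseteq> n" for b u n
      using \<Psi>_max[OF that(1-6)] that(7) by metis
    moreover have "u \<bullet> (minM \<bullet> x \<bullet> b) \<sqsubseteq> \<Psi> \<bullet> b \<bullet> u" if "el b" "ty b = t1" "st b" "el u" "ty u = t2" "st u"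
      "el x" "ty x = t1" for b u x
      using \<Psi>_max[OF that(1-6)] that(7,8) by metis
    ultimately show ?thesis
      by (simp add: max_formula_def is_max_def Let_def bounded_all_def leF_def ltF_def Conj_def Neg_def vdefs vPsi_def)
  qed
  ultimately have "sat (e0(vPsi := \<Psi>)) (relst (eqF (snd vPsi) ?O (Var vPsi)))" by simp
  then have O_eq: "cn (Omega vPsi max_formula) \<bullet> b \<bullet> u = \<Psi> \<bullet> b \<bullet> u"
    if "el b" "ty b = t1" "st b" "el u" "ty u = t2" "st u" for b u
    using that by (simp add: vPsi_def fresh_def Let_def bounded_all_def)
  have O_sat: "sat (e0(vb := b, vu := u)) (is_max ?O) \<longleftrightarrow>
    (\<forall>x. el x \<longrightarrow> ty x = t1 \<longrightarrow> u \<bullet> (minM \<bullet> x \<bullet> b) \<sqsubseteq> ev e0 ?O \<bullet> b \<bullet> u) \<and>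
    (\<forall>n. nt n \<longrightarrow> (\<forall>x. el x \<longrightarrow> ty x = t1 \<longrightarrow> u \<bullet> (minM \<bullet> x \<bullet> b) \<sqsubseteq> n) \<longrightarrow> ev e0 ?O \<bullet> b \<bullet> u \<sqsubseteq> n)"
    if "el b" "ty b = t1" "el u" "ty u = t2" for b u
    by (rule sat_is_max) (use that in simp_all)
  have "sat (e0(vb := b, vu := u)) (is_max ?O)" if "el b" "ty b = t1" "st b" "el u" "ty u = t2" "st u" for b u
    unfolding O_sat[OF that(1,2,4,5)] using O_eq[OF that] \<Psi>_max[OF that] by auto
  then have "sat e0 (Allsts [vb, vu] (is_max ?O))"
    by (simp add: vb_def vu_def)
  \<comment> \<open>The constant is a closed term, so \<open>vb\<close> and \<open>vu\<close> are
    the only free variables and parameter-free transfer applies.\<close>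
  then have "sat e0 (Alls [vb, vu] (is_max ?O))"
    by (intro transfer) (auto simp: wff_is_max fv_is_max)
  then have all: "sat (e0(vb := b, vu := u)) (is_max ?O)" if "el b" "ty b = t1" "el u" "ty u = t2" for b u
    using that by (simp add: vb_def vu_def)
  let ?mx = "ev e0 ?O"
  have "(\<forall>x\<in>box b. u \<bullet> x \<sqsubseteq> ?mx \<bullet> b \<bullet> u) \<and> (\<forall>n. nt n \<longrightarrow> (\<forall>x\<in>box b. u \<bullet> x \<sqsubseteq> n) \<longrightarrow> ?mx \<bullet> b \<bullet> u \<sqsubseteq> n)"
    if bu: "el b" "ty b = t1" "el u" "ty u = t2" for b u
  proof -
    note * = all[OF bu, unfolded O_sat[OF bu]]
    have "u \<bullet> x \<sqsubseteq> ?mx \<bullet> b \<bullet> u" if x: "x \<in> box b" for x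
      using *[THEN conjunct1, rule_format, of x] min_eq[OF x] x bu by simp
    moreover have "?mx \<bullet> b \<bullet> u \<sqsubseteq> n" if "nt n" "\<forall>x\<in>box b. u \<bullet> x \<sqsubseteq> n" for n
      using *[THEN conjunct2, rule_format, OF that(1)] that(2) min_box bu by blast
    ultimately show ?thesis by blast
  qed
  then have "max_functional ?mx" unfolding max_functional_def by (simp add: vPsi_def)
  then show ?thesis by blast
qed

theorem equivalences: "sat e (UF \<^bold>\<longleftrightarrow> Sprinciple)" "sat e (Sprinciple \<^bold>\<longleftrightarrow> USB)"
  using UF_imp_S[of e e] S_imp_max[of e] USB_imp_max[of e] max_imp_UF[of _ e] max_imp_USB[of _ e] by auto

end

section \<open>The axioms are sentences without parameters\<close>

lemma wff_relst [simp]: "wff (relst A) = wff A" by (induction A) auto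
lemma fv_relst [simp]: "fv (relst A) = fv A" by (induction A) auto
lemma pars_relst [simp]: "pars (relst A) = pars A" by (induction A) auto

lemma sentence_PF_TP: "B \<in> PF_TP \<Longrightarrow> sentence B \<and> pars B = {}"
proof -
  have "wff (Alls xs A) = wff A" "wff (Allsts xs A) = wff A"
    "fv (Alls xs A) = fv A - set xs" "fv (Allsts xs A) = fv A - set xs"
    "pars (Alls xs A) = pars A" "pars (Allsts xs A) = pars A" for xs A
    by (induction xs) auto
  then show "B \<in> PF_TP \<Longrightarrow> sentence B \<and> pars B = {}"
    by (auto simp: PF_TP_def sentence_def)
qed

lemma M_fan: "wff M_fan" "fv M_fan \<subseteq> {vXi}" "pars M_fan = {}"
  by (auto simp: M_fan_def fan_modulus_def Let_def vXi_def BAlll_def restr_def one1_def simp del: eqF.simps)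

lemma sentence_Omega_axiom:
  "wff M \<Longrightarrow> pars M = {} \<Longrightarrow> fv M \<subseteq> {v} \<Longrightarrow> sentence (Omega_axiom v M) \<and> pars (Omega_axiom v M) = {}"
  by (auto simp: Omega_axiom_def sentence_def)

lemma sentence_Lambda_axiom: "sentence Lambda_axiom \<and> pars Lambda_axiom = {}"
  by (auto simp: Lambda_axiom_def K_mod_def associate_def restr_def ext0_def one1_def sentence_def Let_def
      simp del: eqF.simps)

text \<open>Completeness needs axioms that are sentences; their lack of parameters leaves every
  parameter free to serve as a counterexample.\<close>

lemma sentence_axiom:
  assumes "B \<in> RCA0_Omega \<union> QF_AC 2"
  shows "sentence B \<and> pars B = {}"
proof -
  have "sentence B \<and> pars B = {}" if "B \<in> Omega_axioms"
    using that M_fan sentence_Omega_axiom unfolding Omega_axioms_def uniquely_defines_def by blast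
  then show ?thesis
    using assms sentence_RCA0_omega sentence_PF_TP sentence_Lambda_axiom sentence_closures
    unfolding RCA0_Omega_def QF_AC_def I_axioms_def HAC_int_def by blast
qed

lemma sentence_principles: "sentence UF" "sentence Sprinciple" "sentence USB"
  by (auto simp: sentence_def UF_def Sprinciple_def USB_def Let_def H0_def vdefs vH_def vg_def BEx_def BAll_def)

lemma provable_if_valid:
  assumes "sentence A"
    and valid: "\<And>el ap cn pr st e. omega_model el fst ap cn pr st \<Longrightarrow>
      pre_model.sat el fst ap cn pr st (e :: var \<Rightarrow> ty \<times> trm) A"
  shows "RCA0_Omega \<union> QF_AC 2 \<turnstile> A"
proof (rule completeness)
  show "sentence B" if "B \<in> RCA0_Omega \<union> QF_AC 2" for B using sentence_axiom that by blast
  show "finite (parset (RCA0_Omega \<union> QF_AC 2))" using sentence_axiom by (subst finite_parset_0) auto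
  show "EPRA \<subseteq> RCA0_Omega \<union> QF_AC 2" by (auto simp: RCA0_Omega_def RCA0_omega_def)
  show "closures st_schemata \<subseteq> RCA0_Omega \<union> QF_AC 2 \<or> (\<forall>B\<in>insert A (RCA0_Omega \<union> QF_AC 2). internal B)"
    by (auto simp: RCA0_Omega_def)
next
  fix el :: "ty \<times> trm \<Rightarrow> bool" and ap cn pr st and e :: "var \<Rightarrow> ty \<times> trm"
  assume m: "normal_model el fst ap cn pr"
    and sat: "\<And>B e. B \<in> RCA0_Omega \<union> QF_AC 2 \<Longrightarrow> pre_model.sat el fst ap cn pr st e B"
  have "omega_model el fst ap cn pr st"
    by (intro omega_model.intro rca_model.intro epra_model.intro m epra_model_axioms.intro
        rca_model_axioms.intro omega_model_axioms.intro sat)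
      (auto simp: RCA0_Omega_def RCA0_omega_def)
  then show "pre_model.sat el fst ap cn pr st e A" by (rule valid)
qed (fact assms(1))

theorem theorem4p4:
  shows "(RCA0_Omega \<union> QF_AC 2 \<turnstile> UF \<^bold>\<longleftrightarrow> Sprinciple) \<and>
         (RCA0_Omega \<union> QF_AC 2 \<turnstile> Sprinciple \<^bold>\<longleftrightarrow> USB)"
  using provable_if_valid[OF _ omega_model.equivalences(1)] provable_if_valid[OF _ omega_model.equivalences(2)]
    sentence_principles by (simp add: Iff_def Conj_def)

end
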